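(* Let $\Bbbk$ be a field of characteristic zero, $S=\Bbbk[x_1,\ldots,x_n]$, and let $V_0\subseteq S_d$ be a linear subspace consisting of homogeneous forms of degree $d$. Then there is a nonempty Zariski-open subset $U\subseteq GL(\langle x_1,\ldots,x_n\rangle)$ such that for every $g\in U$ the space $V=g.V_0$ (i.e. $V$ "in general coordinates") satisfies the following, where $I_V\subseteq S$ denotes the ideal generated by $V$. (a) If $(\mathrm{in}(V):x_n)\cdot\langle x_1,\ldots,x_n\rangle=\mathrm{in}(V)$, i.e. if the ideal $\mathcal{J}(\mathrm{in}(V))_{x_n}$ of $\Bbbk[x_1,\ldots,x_{n-1}]$ has no minimal generator in degree $d$, then the initial ideal $\mathrm{in}\big((I_V)_{|x_n}\big)$ is equal to $\mathcal{J}(\mathrm{in}(V))_{x_n}$ in all degrees $\geq d$. (b) More generally, let $0\le r\le n-1$. If the ideal $\mathcal{J}\big(\mathrm{in}(V)_{|x_n,\ldots,x_{n-r+1}}\big)_{x_{n-r}}$ of $\Bbbk[x_1,\ldots,x_{n-r-1}]$ has no minimal generator in degree $d$, then the initial ideal $\mathrm{in}\big((I_V)_{|x_n,\ldots,x_{n-r}}\big)$ is equal to this ideal in all degrees $\geq d$.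
   Context: Monomial order: the reverse lexicographic order; for monomials of the same total degree, $x_1^{i_1}\cdots x_n^{i_n}>x_1^{j_1}\cdots x_n^{j_n}$ if for the largest index $r$ with $i_r\ne j_r$ one has $i_r<j_r$. For a linear subspace $W$ of homogeneous forms of a fixed degree, $\mathrm{in}(W)$ is the vector space spanned by the largest monomials of the nonzero elements of $W$; for a homogeneous ideal $I$, $\mathrm{in}(I)$ is the ideal generated by the largest monomials of the elements of $I$. Brackets $\langle\ldots\rangle$ denote linear span. For subspaces $A$ and $B$, $A\cdot B$ is the span of all products. $GL(\langle x_1,\ldots,x_n\rangle)$ acts on $S$ by linear changes of coordinates. Colon: for a subspace $W$, $W:x_n^r=\{p : p\,x_n^r\in W\}$. Restriction: $W_{|x_n,\ldots,x_{n-r+1}}$ is the image of $W$ under the map $\Bbbk[x_1,\ldots,x_n]\to\Bbbk[x_1,\ldots,x_{n-r}]$ setting $x_n,\ldots,x_{n-r+1}$ to $0$ (for $r=0$ it is $W$ itself). The restriction of an ideal is an ideal. A monomial space $T$ is strongly stable if for every monomial $m\in T$, every $x_j$ dividing $m$ and every $i<j$, also $x_i m/x_j\in T$. For general $g$, $\mathrm{in}(g.V_0)$ is constant and strongly stable. Definition of $\mathcal{J}$: if $T\subseteq\Bbbk[x_1,\ldots,x_m]_d$ is a strongly stable subspace spanned by monomials of degree $d$ and $I_T$ is the ideal generated by $T$, then $$\mathcal{J}(T)_{x_m}=\bigoplus_{r=1}^{d}(T:x_m^r)_{|x_m}\ \oplus\ (I_T)_{|x_m}\subseteq\Bbbk[x_1,\ldots,x_{m-1}],$$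 which is a homogeneous ideal of $\Bbbk[x_1,\ldots,x_{m-1}]$ (the summand with index $r$ lies in degree $d-r$). *)

theory Defs
  imports "HOL-Library.Poly_Mapping" "Jordan_Normal_Form.Matrix"
begin

text \<open>
  Exponent vectors are finitely supported maps \<open>nat \<Rightarrow>\<^sub>0 nat\<close>, and polynomials are finitely
  supported maps from exponent vectors to coefficients, with the ring structure of
  \<open>HOL-Library.Poly_Mapping\<close>. The variables are \<open>X 1, X 2, \<dots>\<close>, numbered as on paper; the ring
  \<open>k[x\<^sub>1,\<dots>,x\<^sub>m]\<close> is the set \<open>polys m\<close>, so that all these rings lie in one type.
\<close>

type_synonym monom = "nat \<Rightarrow>\<^sub>0 nat"
type_synonym 'a mpoly = "monom \<Rightarrow>\<^sub>0 'a"

definition monomial :: "monom \<Rightarrow> 'a::comm_ring_1 mpoly" where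
  "monomial t = Poly_Mapping.single t 1"

definition X :: "nat \<Rightarrow> 'a::comm_ring_1 mpoly" where
  "X i = monomial (Poly_Mapping.single i 1)"

definition const :: "'a::comm_ring_1 \<Rightarrow> 'a mpoly" where
  "const c = Poly_Mapping.single 0 c"

definition polys :: "nat \<Rightarrow> 'a::comm_ring_1 mpoly set" where
  "polys m = {p. \<forall>t\<in>Poly_Mapping.keys p. Poly_Mapping.keys t \<subseteq> {1..m}}"

definition mdeg :: "monom \<Rightarrow> nat" where
  "mdeg t = (\<Sum>i\<in>Poly_Mapping.keys t. Poly_Mapping.lookup t i)"

text \<open>The homogeneous component of degree \<open>d\<close> of \<open>polys m\<close>; it contains \<open>0\<close>.\<close>

definition forms :: "nat \<Rightarrow> nat \<Rightarrow> 'a::comm_ring_1 mpoly set" where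
  "forms m d = {p \<in> polys m. \<forall>t\<in>Poly_Mapping.keys p. mdeg t = d}"


subsection \<open>Linear spans, products of subspaces, ideals\<close>

global_interpretation lin: vector_space "\<lambda>(c::'a::field) (p::'a mpoly). const c * p"
  by unfold_locales
    (simp_all add: const_def algebra_simps single_add mult_single flip: mult.assoc)

definition space_prod :: "'a::field mpoly set \<Rightarrow> 'a mpoly set \<Rightarrow> 'a mpoly set" where
  "space_prod A B = lin.span {a * b | a b. a \<in> A \<and> b \<in> B}"

text \<open>The ideal of \<open>polys m\<close> generated by a subset \<open>T\<close> of \<open>polys m\<close>, i.e. all finite sums of
  products \<open>p * t\<close>; the scalars are themselves in \<open>polys m\<close>.\<close>

definition ideal_gen :: "nat \<Rightarrow> 'a::field mpoly set \<Rightarrow> 'a mpoly set" where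
  "ideal_gen m T = space_prod (polys m) T"

text \<open>A homogeneous ideal has no minimal generator in degree \<open>d\<close> iff no minimal system of
  homogeneous generators contains a form of degree \<open>d\<close>. Minimality excludes \<open>0\<close> from such
  a system.\<close>

definition min_hom_generators :: "nat \<Rightarrow> 'a::field mpoly set \<Rightarrow> 'a mpoly set \<Rightarrow> bool" where
  "min_hom_generators m I G \<longleftrightarrow>
     (\<forall>p\<in>G. \<exists>e. p \<in> forms m e) \<and> ideal_gen m G = I \<and> (\<forall>H. H \<subset> G \<longrightarrow> ideal_gen m H \<noteq> I)"

definition has_min_generator :: "nat \<Rightarrow> 'a::field mpoly set \<Rightarrow> nat \<Rightarrow> bool" where
  "has_min_generator m I d \<longleftrightarrow> (\<exists>G. min_hom_generators m I G \<and> G \<inter> forms m d \<noteq> {})"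

definition agree_from :: "nat \<Rightarrow> nat \<Rightarrow> 'a::field mpoly set \<Rightarrow> 'a mpoly set \<Rightarrow> bool" where
  "agree_from m d I J \<longleftrightarrow> (\<forall>e\<ge>d. I \<inter> forms m e = J \<inter> forms m e)"


subsection \<open>Reverse lexicographic order and initial spaces\<close>

text \<open>Monomials of different degrees are compared by degree. For spaces of forms and for
  homogeneous ideals this choice does not affect the initial space.\<close>

definition mless :: "monom \<Rightarrow> monom \<Rightarrow> bool" where
  "mless s t \<longleftrightarrow> mdeg s < mdeg t \<or>
     (mdeg s = mdeg t \<and>
      (\<exists>r. Poly_Mapping.lookup t r < Poly_Mapping.lookup s r \<and>
           (\<forall>i>r. Poly_Mapping.lookup t i = Poly_Mapping.lookup s i)))"

definition is_largest_monom :: "monom \<Rightarrow> 'a::comm_ring_1 mpoly \<Rightarrow> bool" where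
  "is_largest_monom t p \<longleftrightarrow>
     t \<in> Poly_Mapping.keys p \<and> (\<forall>s\<in>Poly_Mapping.keys p. s = t \<or> mless s t)"

definition largest_monoms :: "'a::comm_ring_1 mpoly set \<Rightarrow> 'a mpoly set" where
  "largest_monoms W = {monomial t | t. \<exists>p\<in>W. is_largest_monom t p}"

definition in_space :: "'a::field mpoly set \<Rightarrow> 'a mpoly set" where
  "in_space W = lin.span (largest_monoms W)"

definition in_ideal :: "nat \<Rightarrow> 'a::field mpoly set \<Rightarrow> 'a mpoly set" where
  "in_ideal m I = ideal_gen m (largest_monoms I)"


subsection \<open>Substitution, restriction, colon\<close>

text \<open>Evaluation of a polynomial (in variables indexed by \<open>'i\<close>) at the point \<open>\<sigma>\<close>, the
  coefficients being mapped by \<open>\<phi>\<close>.\<close>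

definition eval_at :: "('a::zero \<Rightarrow> 'b::comm_ring_1) \<Rightarrow> ('i \<Rightarrow> 'b) \<Rightarrow> (('i \<Rightarrow>\<^sub>0 nat) \<Rightarrow>\<^sub>0 'a) \<Rightarrow> 'b"
  where
  "eval_at \<phi> \<sigma> p = (\<Sum>t\<in>Poly_Mapping.keys p.
     \<phi> (Poly_Mapping.lookup p t) * (\<Prod>i\<in>Poly_Mapping.keys t. \<sigma> i ^ Poly_Mapping.lookup t i))"

text \<open>The image of \<open>W\<close> under the map that sets the variables with index in \<open>A\<close> to \<open>0\<close>.\<close>

definition restrict_space :: "nat set \<Rightarrow> 'a::comm_ring_1 mpoly set \<Rightarrow> 'a mpoly set" where
  "restrict_space A W = eval_at const (\<lambda>i. if i \<in> A then 0 else X i) ` W"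

text \<open>\<open>W : x\<^sub>m\<^sup>r\<close>. If \<open>W\<close> is contained in \<open>polys m\<close>, then so is the colon space.\<close>

definition colon :: "'a::comm_ring_1 mpoly set \<Rightarrow> nat \<Rightarrow> nat \<Rightarrow> 'a mpoly set" where
  "colon W m r = {p. p * X m ^ r \<in> W}"

text \<open>The ideal \<open>\<J>(T)\<close> with respect to \<open>x\<^sub>m\<close>, for a strongly stable space \<open>T\<close> of forms of
  degree \<open>d\<close> in \<open>x\<^sub>1,\<dots>,x\<^sub>m\<close>. The summands lie in different degrees, so their direct sum is the
  span of their union.\<close>

definition J_ideal :: "nat \<Rightarrow> nat \<Rightarrow> 'a::field mpoly set \<Rightarrow> 'a mpoly set" where
  "J_ideal m d T = lin.span
     ((\<Union>r\<in>{1..d}. restrict_space {m} (colon T m r)) \<union> restrict_space {m} (ideal_gen m T))"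


subsection \<open>The general linear group and its Zariski topology\<close>

definition GL :: "nat \<Rightarrow> 'a::field mat set" where
  "GL n = {g \<in> carrier_mat n n. invertible_mat g}"

text \<open>\<open>g.x\<^sub>j = \<Sum>\<^sub>i g\<^sub>i\<^sub>j x\<^sub>i\<close>, extended to polynomials by substitution. Matrix indices start at 0,
  variable indices at 1.\<close>

definition act :: "nat \<Rightarrow> 'a::field mat \<Rightarrow> 'a mpoly \<Rightarrow> 'a mpoly" where
  "act n g p = eval_at const (\<lambda>j. \<Sum>i\<in>{1..n}. const (g $$ (i - 1, j - 1)) * X i) p"

text \<open>Open subsets of \<open>GL n\<close> in the Zariski topology induced from the space of all matrices:
  complements in \<open>GL n\<close> of zero sets of families \<open>F\<close> of polynomials in the matrix entries.
  Inverting the determinant in addition yields no further open sets.\<close>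

definition zariski_open_GL :: "nat \<Rightarrow> 'a::field mat set \<Rightarrow> bool" where
  "zariski_open_GL n U \<longleftrightarrow>
     (\<exists>F :: ((nat \<times> nat \<Rightarrow>\<^sub>0 nat) \<Rightarrow>\<^sub>0 'a) set.
        (\<forall>f\<in>F. \<forall>t\<in>Poly_Mapping.keys f. Poly_Mapping.keys t \<subseteq> {..<n} \<times> {..<n}) \<and>
        U = {g \<in> GL n. \<exists>f\<in>F. eval_at id (\<lambda>ij. g $$ ij) f \<noteq> 0})"

end

theory Submission
  imports Defs "Jordan_Normal_Form.Determinant"
begin

text \<open>
  In general coordinates all ranks of the projections of \<open>V\<close> onto the monomials above a given
  monomial \<open>b\<close> are maximal. Moving \<open>V\<close> by the shears \<open>x\<^sub>j \<mapsto> x\<^sub>j + \<epsilon> x\<^sub>i\<close> to first order in \<open>\<epsilon>\<close>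
  then shows that for \<open>p \<in> V\<close> with leading monomial \<open>b\<close> the derivative \<open>x\<^sub>i \<partial>p/\<partial>x\<^sub>j\<close>, \<open>i < j\<close>, lies in \<open>V\<close> up
  to monomials \<open>\<le> b\<close>. Two consequences follow: \<open>in(V)\<close> is strongly stable, and, after setting
  \<open>x\<^sub>m\<^sub>+\<^sub>1,\<dots>,x\<^sub>n\<close> to \<open>0\<close>, one has \<open>(V : x\<^sub>m)|\<^sub>x\<^sub>m \<cdot> x\<^sub>i \<subseteq> V|\<^sub>x\<^sub>m\<close>. If \<open>\<J>\<close> has no minimal generator in degree \<open>d\<close>,
  then \<open>W = (V : x\<^sub>m)|\<^sub>x\<^sub>m\<close> satisfies \<open>W \<cdot> \<langle>x\<^sub>1,\<dots>,x\<^sub>m\<^sub>-\<^sub>1\<rangle> = V|\<^sub>x\<^sub>m\<close> with the initial space generated by \<open>in(W)\<close>.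
  As \<open>in(W)\<close> is stable, its syzygies are generated by linear ones, so a basis of \<open>W\<close> with leading
  monomials \<open>in(W)\<close> is a Groebner basis and nothing new occurs in higher degrees.
\<close>

text \<open>Strong stability of \<open>in(V)\<close> alone does not suffice: it constrains leading
  monomials, while relations among the polynomials of V could still create new ones in higher
  degrees. The missing link is a statement about V itself; it and strong stability both come from
  \<open>infinitesimally_stable\<close>. No limits are taken: maximality makes a larger minor vanish
  for every group element, sheared ones included, and since this minor is polynomial in eps, it
  vanishes at eps = 0 too. Characteristic zero enters twice: the field is infinite, and exponents
  produced by differentiation stay nonzero. The reverse lexicographic order enters through two
  facts: a leading monomial survives restriction as soon as any monomial does, and an element with
  leading monomial t x_m becomes divisible by x_m once the later variables are 0. No critical pairs
  are computed. The quotients w_s have degree d-1, outside the restricted ideal, but the products v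
  w_s with v of positive degree and max(s) at most min(v) span it. Such a splitting v s is unique
  (Eliahou-Kervaire), so their leading monomials are distinct and no others occur.\<close>

abbreviation lookup where "lookup \<equiv> Poly_Mapping.lookup"
abbreviation keys where "keys \<equiv> Poly_Mapping.keys"
abbreviation single where "single \<equiv> Poly_Mapping.single"
abbreviation unit_exp :: "nat \<Rightarrow> monom" where "unit_exp i \<equiv> single i (Suc 0)"

subsection \<open>Exponent vectors\<close>

lemma keys_add_monom: "keys (s + t) = keys s \<union> keys (t::monom)"
  by (auto simp: in_keys_iff lookup_add)

lemma mdeg_superset:
  assumes "finite A" "keys t \<subseteq> A"
  shows "mdeg t = (\<Sum>i\<in>A. lookup t i)"
  unfolding mdeg_def using assms by (intro sum.mono_neutral_left) (auto simp: in_keys_iff)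

lemma mdeg_add [simp]: "mdeg (s + t) = mdeg s + mdeg t"
proof -
  let ?A = "keys s \<union> keys t"
  have "mdeg (s + t) = (\<Sum>i\<in>?A. lookup (s + t) i)"
    by (rule mdeg_superset) (auto simp: keys_add_monom)
  also have "\<dots> = (\<Sum>i\<in>?A. lookup s i) + (\<Sum>i\<in>?A. lookup t i)"
    by (simp add: lookup_add sum.distrib)
  also have "\<dots> = mdeg s + mdeg t"
    by (simp add: mdeg_superset[of ?A s] mdeg_superset[of ?A t])
  finally show ?thesis .
qed

lemma mdeg_zero [simp]: "mdeg 0 = 0"
  by (simp add: mdeg_def)

lemma mdeg_single [simp]: "mdeg (single i k) = k"
  by (simp add: mdeg_def)

lemma mdeg_eq_0_iff: "mdeg t = 0 \<longleftrightarrow> t = 0"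
  by (auto simp: mdeg_def in_keys_iff sum_eq_0_iff intro!: poly_mapping_eqI)

lemma lookup_unit_exp: "lookup (unit_exp i) j = (if i = j then 1 else 0)"
  by (simp add: lookup_single when_def)

lemma divide_by_variable:
  assumes "i \<in> keys (t::monom)"
  obtains s where "t = s + unit_exp i"
proof
  show "t = (t - unit_exp i) + unit_exp i"
    using assms by (intro poly_mapping_eqI) (auto simp: in_keys_iff lookup_add lookup_minus lookup_unit_exp)
qed

definition monoms :: "nat \<Rightarrow> nat \<Rightarrow> monom set" where
  "monoms m d = {t. keys t \<subseteq> {1..m} \<and> mdeg t = d}"

lemma finite_monoms: "finite (monoms m d)"
proof -
  have "lookup t i \<le> d" if "t \<in> monoms m d" for t i
  proof (cases "i \<in> keys t")
    case True
    then have "lookup t i \<le> (\<Sum>i\<in>keys t. lookup t i)" by (intro member_le_sum) auto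
    then show ?thesis using that by (simp add: monoms_def mdeg_def)
  qed (simp add: in_keys_iff)
  then have "lookup ` monoms m d \<subseteq> {f. \<forall>i. (i \<in> {1..m} \<longrightarrow> f i \<in> {..d}) \<and> (i \<notin> {1..m} \<longrightarrow> f i = 0)}"
    by (auto simp: monoms_def in_keys_iff subset_iff)
  then have "finite (lookup ` monoms m d)"
    by (rule finite_subset) (intro finite_set_of_finite_funs; simp)
  then show ?thesis by (rule finite_imageD) (auto intro!: inj_onI poly_mapping_eqI)
qed

section \<open>The reverse lexicographic order as a linear order\<close>

definition mle :: "monom \<Rightarrow> monom \<Rightarrow> bool" where
  "mle s t \<longleftrightarrow> s = t \<or> mless s t"

lemma mlessE:
  assumes "mless s t" "mdeg s = mdeg t"
  obtains r where "lookup t r < lookup s r" "\<And>i. i > r \<Longrightarrow> lookup t i = lookup s i"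
proof -
  have "\<exists>r. lookup t r < lookup s r \<and> (\<forall>i>r. lookup t i = lookup s i)"
    using assms(1) unfolding mless_def assms(2) by simp
  then show ?thesis using that by blast
qed

lemma mless_irrefl: "\<not> mless t t"
  by (simp add: mless_def)

lemma mless_trans:
  assumes "mless s t" "mless t u"
  shows "mless s u"
proof (cases "mdeg s = mdeg t \<and> mdeg t = mdeg u")
  case True
  obtain a where a: "lookup t a < lookup s a" "\<forall>i>a. lookup t i = lookup s i"
    using assms(1) True by (auto simp: mless_def)
  obtain b where b: "lookup u b < lookup t b" "\<forall>i>b. lookup u i = lookup t i"
    using assms(2) True by (auto simp: mless_def)
  \<comment> \<open>The larger of the two deciding indices decides the composite comparison.\<close>
  have "lookup u (max a b) < lookup s (max a b)" "\<forall>i>max a b. lookup u i = lookup s i"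
    using a b by (cases a b rule: linorder_cases; force simp: max_def)+
  then show ?thesis using True by (auto simp: mless_def)
qed (use assms in \<open>auto simp: mless_def\<close>)

lemma mless_linear: "s = t \<or> mless s t \<or> mless t s"
proof -
  have "mless s t \<or> mless t s" if "s \<noteq> t" "mdeg s = mdeg t"
  proof -
    let ?D = "{i. lookup s i \<noteq> lookup t i}"
    have "?D \<subseteq> keys s \<union> keys t" by (auto simp: in_keys_iff)
    then have fin: "finite ?D" by (rule finite_subset) simp
    have ne: "?D \<noteq> {}" using that(1) by (auto intro: poly_mapping_eqI)
    define r where "r = Max ?D"
    have "r \<in> ?D" unfolding r_def by (rule Max_in[OF fin ne])
    moreover have "\<forall>i>r. lookup s i = lookup t i"
      unfolding r_def using Max_ge[OF fin] by (meson leD mem_Collect_eq)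
    ultimately show ?thesis
      using that(2) by (cases "lookup s r < lookup t r") (auto simp: mless_def intro!: exI[of _ r])
  qed
  moreover have "mless s t \<or> mless t s" if "mdeg s \<noteq> mdeg t"
    using that by (auto simp: mless_def)
  ultimately show ?thesis by blast
qed

interpretation ml: linorder mle mless
  by unfold_locales
    (auto simp: mle_def mless_irrefl intro: mless_trans dest: mless_trans, use mless_irrefl mless_trans mless_linear in blast)+

lemma mless_add_cancel [simp]: "mless (s + u) (t + u) \<longleftrightarrow> mless s t"
  by (simp add: mless_def lookup_add)

lemma mle_add_cancel [simp]: "mle (s + u) (t + u) \<longleftrightarrow> mle s t"
  by (simp add: mle_def)

lemma mless_unit_exp: "i < j \<Longrightarrow> mless (unit_exp j) (unit_exp i)"
  by (auto simp: mless_def lookup_unit_exp intro!: exI[of _ j])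

lemma mless_add_unit_exp: "i < j \<Longrightarrow> mless (t + unit_exp j) (t + unit_exp i)"
  using mless_add_cancel[of "unit_exp j" t "unit_exp i"] mless_unit_exp by (simp add: add.commute)

text \<open>The property that distinguishes the reverse lexicographic order: among monomials of a given
  degree, those in the first variables are the largest.\<close>

lemma keys_of_larger:
  assumes "mle s t" "mdeg s = mdeg t" "keys s \<subseteq> {1..m}" "0 \<notin> keys t"
  shows "keys t \<subseteq> {1..m}"
proof (cases "s = t")
  case False
  then have "mless s t" using assms(1) by (simp add: mle_def)
  then obtain r where r: "lookup t r < lookup s r" "\<And>i. i > r \<Longrightarrow> lookup t i = lookup s i"
    using assms(2) by (rule mlessE) blast
  have "r \<in> keys s" using r(1) by (simp add: in_keys_iff)
  then have "r \<le> m" using assms(3) by auto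
  show ?thesis
  proof
    fix i assume i: "i \<in> keys t"
    have "i \<le> m"
    proof (rule ccontr)
      assume "\<not> i \<le> m"
      then have "lookup t i = lookup s i" using r(2) \<open>r \<le> m\<close> by simp
      with i have "i \<in> keys s" by (simp add: in_keys_iff)
      with assms(3) \<open>\<not> i \<le> m\<close> show False by auto
    qed
    with i assms(4) show "i \<in> {1..m}" by (cases i) auto
  qed
qed (use assms in simp)

text \<open>The deciding index is at most \<open>m\<close>, because \<open>s\<close> has a positive
  exponent there. Hence at \<open>m\<close> the exponent of \<open>s\<close> is at least that of t
  x_m, which is positive.\<close>

lemma smaller_involves_last:
  assumes "mle s (t + unit_exp m)" "mdeg s = Suc (mdeg t)" "keys s \<subseteq> {1..m}" "keys t \<subseteq> {1..m}"
  shows "m \<in> keys s"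
proof (cases "s = t + unit_exp m")
  case False
  then have "mless s (t + unit_exp m)" using assms(1) by (simp add: mle_def)
  then obtain r where r: "lookup (t + unit_exp m) r < lookup s r"
    "\<And>i. i > r \<Longrightarrow> lookup (t + unit_exp m) i = lookup s i"
    by (rule mlessE) (use assms(2) in auto)
  have "r \<in> keys s" using r(1) by (simp add: in_keys_iff)
  then have "r \<le> m" using assms(3) by auto
  have "lookup s m \<noteq> 0"
  proof (cases "r = m")
    case False
    then have "lookup (t + unit_exp m) m = lookup s m" using r(2) \<open>r \<le> m\<close> by simp
    then show ?thesis by (simp add: lookup_add lookup_unit_exp)
  qed (use r(1) in simp)
  then show ?thesis by (simp add: in_keys_iff)
qed (simp add: keys_add_monom)

subsection \<open>Polynomials as sums of monomials\<close>

lemma poly_mapping_expand: "p = (\<Sum>t\<in>keys p. single t (lookup p t))"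
  by (rule poly_mapping_eqI) (auto simp: lookup_sum lookup_single when_def in_keys_iff)

lemma lookup_const_mult [simp]: "lookup (const c * p) t = c * lookup p t"
  by (simp add: const_def lookup_mult lookup_single when_mult)

lemma const_mult_single: "const c * single t a = single t (c * a)"
  by (simp add: const_def mult_single)

lemma const_mult_monomial: "const c * monomial t = single t c"
  by (simp add: const_mult_single monomial_def)

lemma const_zero [simp]: "const 0 = 0"
  by (simp add: const_def)

lemma const_one [simp]: "const 1 = 1"
  by (simp add: const_def)

lemma const_add: "const (a + b) = const a + const b"
  by (simp add: const_def single_add)

lemma const_mult: "const (a * b) = const a * const b"
  by (simp add: const_def mult_single)

lemma expand_monomials: "p = (\<Sum>t\<in>keys p. const (lookup p t) * monomial t)"
  using poly_mapping_expand[of p] by (simp add: const_mult_monomial)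

lemma monomial_add: "monomial (s + t) = monomial s * monomial t"
  by (simp add: monomial_def mult_single)

lemma monomial_zero [simp]: "monomial 0 = 1"
  by (simp add: monomial_def)

lemma keys_monomial [simp]: "keys (monomial t :: 'a::comm_ring_1 mpoly) = {t}"
  by (simp add: monomial_def)

lemma X_alt: "X i = monomial (unit_exp i)"
  by (simp add: X_def)

lemma lookup_monomial_mult [simp]: "lookup (monomial u * p) (u + t) = lookup p t"
  by (simp add: monomial_def lookup_mult lookup_single when_mult)

lemma lookup_monomial_mult_not:
  assumes "\<And>s. t \<noteq> u + s"
  shows "lookup (monomial u * p) t = 0"
  using assms by (simp add: monomial_def lookup_mult lookup_single when_mult)

lemma keys_monomial_mult: "keys (monomial u * p) = (\<lambda>t. u + t) ` keys p"
proof (rule Set.set_eqI)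
  fix t
  show "t \<in> keys (monomial u * p) \<longleftrightarrow> t \<in> (\<lambda>t. u + t) ` keys p"
  proof (cases "\<exists>s. t = u + s")
    case True
    then show ?thesis by (auto simp: in_keys_iff)
  next
    case False
    then have "lookup (monomial u * p) t = 0" by (intro lookup_monomial_mult_not) auto
    then show ?thesis using False by (auto simp: in_keys_iff)
  qed
qed

text \<open>All monomial spaces of the statement have this form, which turns equations between them
  into equations between exponent sets (\<open>monom_space_inject\<close>).\<close>

definition monom_space :: "monom set \<Rightarrow> 'a::field mpoly set" where
  "monom_space A = {p. keys p \<subseteq> A}"

lemma subspaceI:
  assumes "0 \<in> W" "\<And>p q. p \<in> W \<Longrightarrow> q \<in> W \<Longrightarrow> p + q \<in> W" "\<And>c p. p \<in> W \<Longrightarrow> const c * p \<in> W"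
  shows "lin.subspace W"
  using assms by (auto simp: lin.subspace_def)

lemma subspace_monom_space: "lin.subspace (monom_space A)"
proof (rule subspaceI)
  fix p q :: "'a mpoly" assume "p \<in> monom_space A" "q \<in> monom_space A"
  then show "p + q \<in> monom_space A" using keys_add[of p q] by (auto simp: monom_space_def)
next
  fix p :: "'a mpoly" and c :: 'a assume "p \<in> monom_space A"
  then show "const c * p \<in> monom_space A" by (auto simp: monom_space_def in_keys_iff subset_iff)
qed (simp add: monom_space_def)

lemma monomial_in_monom_space [simp]: "monomial t \<in> monom_space A \<longleftrightarrow> t \<in> A"
  by (simp add: monom_space_def)

lemma span_monomials: "lin.span (monomial ` A) = (monom_space A :: 'a::field mpoly set)" (is "?L = ?R")
proof
  show "?L \<subseteq> ?R"
    by (rule lin.span_minimal[OF _ subspace_monom_space]) auto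
  show "?R \<subseteq> ?L"
  proof
    fix p :: "'a mpoly" assume "p \<in> monom_space A"
    then have "(\<Sum>t\<in>keys p. const (lookup p t) * monomial t) \<in> lin.span (monomial ` A)"
      by (intro lin.span_sum lin.span_scale lin.span_base) (auto simp: monom_space_def)
    then show "p \<in> lin.span (monomial ` A)" by (simp flip: expand_monomials)
  qed
qed

lemma polys_eq_monom_space: "polys m = monom_space {t. keys t \<subseteq> {1..m}}"
  by (auto simp: polys_def monom_space_def)

lemma forms_eq_monom_space: "forms m d = monom_space (monoms m d)"
  by (auto simp: forms_def polys_def monom_space_def monoms_def)

lemma monom_space_Int: "monom_space A \<inter> monom_space B = monom_space (A \<inter> B)"
  by (auto simp: monom_space_def)

lemma monom_space_inject: "monom_space A = (monom_space B :: 'a::field mpoly set) \<longleftrightarrow> A = B"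
proof
  assume eq: "monom_space A = (monom_space B :: 'a mpoly set)"
  have "t \<in> A \<longleftrightarrow> t \<in> B" for t
    using eq by (metis monomial_in_monom_space)
  then show "A = B" by blast
qed simp

lemma space_prod_span:
  "space_prod (lin.span A) (lin.span B) = lin.span {a * b | a b. a \<in> A \<and> b \<in> (B :: 'a::field mpoly set)}"
proof
  let ?S = "lin.span {a * b | a b. a \<in> A \<and> b \<in> B}"
  have 1: "a * b \<in> ?S" if "a \<in> A" "b \<in> lin.span B" for a b
    using that(2)
  proof (induction rule: lin.span_induct_alt)
    case base
    then show ?case using lin.span_zero by simp
  next
    case (step c x y)
    have "a * x \<in> ?S" using step that(1) by (intro lin.span_base) auto
    then have "const c * (a * x) + a * y \<in> ?S" using step by (intro lin.span_add lin.span_scale)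
    then show ?case by (simp add: algebra_simps)
  qed
  have 2: "a * b \<in> ?S" if "a \<in> lin.span A" "b \<in> lin.span B" for a b
    using that(1)
  proof (induction rule: lin.span_induct_alt)
    case base
    then show ?case using lin.span_zero by simp
  next
    case (step c x y)
    have "x * b \<in> ?S" using step 1 that(2) by blast
    then have "const c * (x * b) + y * b \<in> ?S" using step by (intro lin.span_add lin.span_scale)
    then show ?case by (simp add: algebra_simps)
  qed
  show "space_prod (lin.span A) (lin.span B) \<subseteq> ?S"
    unfolding space_prod_def using 2 by (intro lin.span_minimal) auto
  show "?S \<subseteq> space_prod (lin.span A) (lin.span B)"
    unfolding space_prod_def by (intro lin.span_mono) (auto intro: lin.span_base)
qed

lemma space_prod_monom_space:
  "space_prod (monom_space A) (monom_space B) = (monom_space {s + t | s t. s \<in> A \<and> t \<in> B} :: 'a::field mpoly set)"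
proof -
  have "{a * b | a b. a \<in> monomial ` A \<and> b \<in> monomial ` B}
      = (monomial ` {s + t | s t. s \<in> A \<and> t \<in> B} :: 'a mpoly set)"
    by (force simp: monomial_add)
  then show ?thesis
    using space_prod_span[of "monomial ` A :: 'a mpoly set" "monomial ` B"] by (simp add: span_monomials)
qed

lemma span_subspace: "lin.subspace W \<Longrightarrow> lin.span W = W"
  by (rule lin.span_eq_iff[THEN iffD2])

text \<open>Monomials span \<open>polys m\<close>, so monomial multipliers suffice. This is the form
  on which the span inductions below run.\<close>

lemma ideal_gen_span:
  "ideal_gen m (T :: 'a::field mpoly set) = lin.span {monomial u * t | u t. keys u \<subseteq> {1..m} \<and> t \<in> T}"
proof -
  have "ideal_gen m T = space_prod (polys m) (lin.span T)"
  proof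
    show "ideal_gen m T \<subseteq> space_prod (polys m) (lin.span T)"
      unfolding ideal_gen_def space_prod_def by (intro lin.span_mono) (auto intro: lin.span_base)
    have "space_prod (polys m) (lin.span T) = space_prod (lin.span (polys m)) (lin.span T)"
      by (simp add: polys_eq_monom_space span_subspace[OF subspace_monom_space])
    also have "\<dots> = ideal_gen m T" by (subst space_prod_span) (simp add: ideal_gen_def space_prod_def)
    finally show "space_prod (polys m) (lin.span T) \<subseteq> ideal_gen m T" by simp
  qed
  also have "\<dots> = lin.span {a * t | a t. a \<in> monomial ` {t. keys t \<subseteq> {1..m}} \<and> t \<in> T}"
    by (subst polys_eq_monom_space, subst span_monomials[symmetric], rule space_prod_span)
  also have "{a * t | a t. a \<in> monomial ` {t. keys t \<subseteq> {1..m}} \<and> t \<in> T}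
      = {monomial u * t | u t. keys u \<subseteq> {1..m} \<and> t \<in> T}" by blast
  finally show ?thesis .
qed

definition up :: "nat \<Rightarrow> monom set \<Rightarrow> monom set" where
  "up m B = {u + t | u t. keys u \<subseteq> {1..m} \<and> t \<in> B}"

lemma ideal_gen_monomials: "ideal_gen m (monomial ` B) = (monom_space (up m B) :: 'a::field mpoly set)"
proof -
  have "{monomial u * t | u t. keys u \<subseteq> {1..m} \<and> t \<in> monomial ` B} = (monomial ` up m B :: 'a mpoly set)"
    by (force simp: up_def monomial_add)
  then show ?thesis by (simp add: ideal_gen_span span_monomials)
qed

lemma ideal_gen_monom_space: "ideal_gen m (monom_space B) = (monom_space (up m B) :: 'a::field mpoly set)"
  by (simp add: ideal_gen_def polys_eq_monom_space space_prod_monom_space up_def)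

subsection \<open>Evaluation is a ring homomorphism\<close>

definition monom_val :: "('i \<Rightarrow> 'b::comm_ring_1) \<Rightarrow> ('i \<Rightarrow>\<^sub>0 nat) \<Rightarrow> 'b" where
  "monom_val \<sigma> t = (\<Prod>i\<in>keys t. \<sigma> i ^ lookup t i)"

lemma monom_val_superset:
  assumes "finite A" "keys t \<subseteq> A"
  shows "monom_val \<sigma> t = (\<Prod>i\<in>A. \<sigma> i ^ lookup t i)"
  unfolding monom_val_def using assms
  by (intro prod.mono_neutral_left) (auto simp: in_keys_iff)

lemma monom_val_add: "monom_val \<sigma> (s + t) = monom_val \<sigma> s * monom_val \<sigma> t"
proof -
  let ?A = "keys s \<union> keys t"
  have "monom_val \<sigma> (s + t) = (\<Prod>i\<in>?A. \<sigma> i ^ lookup (s + t) i)"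
    by (rule monom_val_superset) (use keys_add[of s t] in auto)
  also have "\<dots> = (\<Prod>i\<in>?A. \<sigma> i ^ lookup s i) * (\<Prod>i\<in>?A. \<sigma> i ^ lookup t i)"
    by (simp add: lookup_add power_add prod.distrib)
  also have "\<dots> = monom_val \<sigma> s * monom_val \<sigma> t"
    by (simp add: monom_val_superset[of ?A s] monom_val_superset[of ?A t])
  finally show ?thesis .
qed

lemma monom_val_zero [simp]: "monom_val \<sigma> 0 = 1"
  by (simp add: monom_val_def)

lemma monom_val_single: "monom_val \<sigma> (single i k) = \<sigma> i ^ k"
  by (simp add: monom_val_def)

text \<open>Instantiated twice: with \<open>const\<close> for substitution of polynomials, and with
  \<open>id\<close> for evaluation at the entries of a matrix.\<close>

locale eval_hom =
  fixes \<phi> :: "'a::comm_ring_1 \<Rightarrow> 'b::comm_ring_1" and \<sigma> :: "'i \<Rightarrow> 'b"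
  assumes hom_zero: "\<phi> 0 = 0" and hom_one: "\<phi> 1 = 1"
    and hom_add: "\<phi> (a + b) = \<phi> a + \<phi> b" and hom_mult: "\<phi> (a * b) = \<phi> a * \<phi> b"
begin

lemma eval_superset:
  assumes "finite A" "keys p \<subseteq> A"
  shows "eval_at \<phi> \<sigma> p = (\<Sum>t\<in>A. \<phi> (lookup p t) * monom_val \<sigma> t)"
  unfolding eval_at_def monom_val_def[symmetric] using assms
  by (intro sum.mono_neutral_left) (auto simp: in_keys_iff hom_zero)

lemma eval_zero: "eval_at \<phi> \<sigma> 0 = 0"
  by (simp add: eval_at_def)

lemma eval_single: "eval_at \<phi> \<sigma> (single t a) = \<phi> a * monom_val \<sigma> t"
  by (subst eval_superset[of "{t}"]) auto

lemma eval_one: "eval_at \<phi> \<sigma> 1 = 1"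
  using eval_single[of 0 1] by (simp add: hom_one)

lemma eval_add: "eval_at \<phi> \<sigma> (p + q) = eval_at \<phi> \<sigma> p + eval_at \<phi> \<sigma> q"
proof -
  let ?A = "keys p \<union> keys q"
  have "eval_at \<phi> \<sigma> (p + q) = (\<Sum>t\<in>?A. \<phi> (lookup (p + q) t) * monom_val \<sigma> t)"
    by (rule eval_superset) (use keys_add[of p q] in auto)
  also have "\<dots> = (\<Sum>t\<in>?A. \<phi> (lookup p t) * monom_val \<sigma> t) + (\<Sum>t\<in>?A. \<phi> (lookup q t) * monom_val \<sigma> t)"
    by (simp add: lookup_add hom_add distrib_right sum.distrib)
  also have "\<dots> = eval_at \<phi> \<sigma> p + eval_at \<phi> \<sigma> q"
    by (simp add: eval_superset[of ?A p] eval_superset[of ?A q])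
  finally show ?thesis .
qed

lemma eval_sum: "eval_at \<phi> \<sigma> (\<Sum>x\<in>A. f x) = (\<Sum>x\<in>A. eval_at \<phi> \<sigma> (f x))"
  by (induction A rule: infinite_finite_induct) (auto simp: eval_zero eval_add)

lemma eval_mult: "eval_at \<phi> \<sigma> (p * q) = eval_at \<phi> \<sigma> p * eval_at \<phi> \<sigma> q"
proof -
  let ?s = "\<lambda>p t. single t (lookup p t)"
  have "p * q = (\<Sum>s\<in>keys p. ?s p s) * (\<Sum>t\<in>keys q. ?s q t)"
    by (simp flip: poly_mapping_expand)
  also have "\<dots> = (\<Sum>s\<in>keys p. \<Sum>t\<in>keys q. ?s p s * ?s q t)"
    by (simp add: sum_product)
  also have "eval_at \<phi> \<sigma> \<dots> = (\<Sum>s\<in>keys p. \<Sum>t\<in>keys q. eval_at \<phi> \<sigma> (?s p s) * eval_at \<phi> \<sigma> (?s q t))"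
    by (simp add: eval_sum mult_single eval_single hom_mult monom_val_add mult_ac)
  also have "\<dots> = (\<Sum>s\<in>keys p. eval_at \<phi> \<sigma> (?s p s)) * (\<Sum>t\<in>keys q. eval_at \<phi> \<sigma> (?s q t))"
    by (simp add: sum_product)
  also have "\<dots> = eval_at \<phi> \<sigma> p * eval_at \<phi> \<sigma> q"
    by (simp flip: eval_sum poly_mapping_expand)
  finally show ?thesis .
qed

lemma eval_power: "eval_at \<phi> \<sigma> (p ^ k) = eval_at \<phi> \<sigma> p ^ k"
  by (induction k) (auto simp: eval_one eval_mult)

lemma eval_prod: "eval_at \<phi> \<sigma> (\<Prod>x\<in>A. f x) = (\<Prod>x\<in>A. eval_at \<phi> \<sigma> (f x))"
  by (induction A rule: infinite_finite_induct) (auto simp: eval_one eval_mult)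

end

global_interpretation ev: eval_hom const "\<sigma> :: nat \<Rightarrow> 'a::comm_ring_1 mpoly" for \<sigma>
  by unfold_locales (simp_all add: const_add const_mult)

lemma ev_const: "eval_at const \<sigma> (const c) = const c"
  using ev.eval_single[of \<sigma> 0 c] by (simp add: const_def)

lemma ev_X: "eval_at const \<sigma> (X i) = \<sigma> i"
  by (simp add: X_alt monomial_def ev.eval_single monom_val_single)

lemma ev_const_mult: "eval_at const \<sigma> (const c * p) = const c * eval_at const \<sigma> p"
  by (simp add: ev.eval_mult ev_const)

lemma eval_eq_sum: "eval_at const \<sigma> p = (\<Sum>t\<in>keys p. const (lookup p t) * monom_val \<sigma> t)"
  by (simp add: eval_at_def monom_val_def)

lemma X_power: "X i ^ k = monomial (single i k)"
  by (induction k) (auto simp: X_alt simp flip: monomial_add single_add)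

lemma monom_val_X: "monom_val X t = (monomial t :: 'a::comm_ring_1 mpoly)"
proof -
  have "monomial (\<Sum>i\<in>A. f i) = (\<Prod>i\<in>A. monomial (f i) :: 'a mpoly)" for A and f :: "nat \<Rightarrow> monom"
    by (induction A rule: infinite_finite_induct) (auto simp: monomial_add)
  from this[of "\<lambda>i. single i (lookup t i)" "keys t"] show ?thesis
    by (simp add: monom_val_def X_power poly_mapping_expand[of t, symmetric])
qed

subsection \<open>Restriction\<close>

definition restr :: "nat set \<Rightarrow> 'a::comm_ring_1 mpoly \<Rightarrow> 'a mpoly" where
  "restr A = eval_at const (\<lambda>i. if i \<in> A then 0 else X i)"

lemma lookup_restr:
  fixes p :: "'a::comm_ring_1 mpoly"
  shows "lookup (restr A p) s = (if keys s \<inter> A = {} then lookup p s else 0)"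
proof -
  have val: "monom_val (\<lambda>i. if i \<in> A then 0 else X i :: 'a mpoly) t = (if keys t \<inter> A = {} then monomial t else 0)" for t
  proof (cases "keys t \<inter> A = {}")
    case True
    then have "monom_val (\<lambda>i. if i \<in> A then 0 else X i) t = monom_val X t"
      unfolding monom_val_def by (intro prod.cong) auto
    then show ?thesis using True by (simp add: monom_val_X)
  next
    case False
    then obtain i where i: "i \<in> keys t" "i \<in> A" by blast
    then have "(if i \<in> A then 0 else X i :: 'a mpoly) ^ lookup t i = 0" by (simp add: in_keys_iff zero_power)
    then have "monom_val (\<lambda>i. if i \<in> A then 0 else X i :: 'a mpoly) t = 0"
      unfolding monom_val_def by (rule prod_zero[OF finite_keys bexI[OF _ i(1)]])
    then show ?thesis using False by simp
  qed
  have "restr A p = (\<Sum>t\<in>keys p. if keys t \<inter> A = {} then single t (lookup p t) else 0)"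
    by (auto simp: restr_def eval_eq_sum val const_mult_monomial intro!: sum.cong)
  also have "lookup \<dots> s = (\<Sum>t\<in>keys p. if t = s then (if keys s \<inter> A = {} then lookup p s else 0) else 0)"
    unfolding lookup_sum by (intro sum.cong) (auto simp: lookup_single when_def)
  also have "\<dots> = (if keys s \<inter> A = {} then lookup p s else 0)"
    by (simp add: in_keys_iff)
  finally show ?thesis .
qed

lemma keys_restr: "keys (restr A p) = {t \<in> keys p. keys t \<inter> A = {}}"
proof (rule Set.set_eqI)
  show "t \<in> keys (restr A p) \<longleftrightarrow> t \<in> {t \<in> keys p. keys t \<inter> A = {}}" for t
    by (simp add: in_keys_iff[of t] lookup_restr)
qed

lemma restrict_space_alt: "restrict_space A W = restr A ` W"
  by (simp add: restrict_space_def restr_def)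

lemma restr_zero: "restr A 0 = 0"
  by (simp add: restr_def ev.eval_zero)

lemma restr_add: "restr A (p + q) = restr A p + restr A q"
  by (simp add: restr_def ev.eval_add)

lemma restr_mult: "restr A (p * q) = restr A p * restr A q"
  by (simp add: restr_def ev.eval_mult)

lemma restr_const_mult: "restr A (const c * p) = const c * restr A p"
  by (simp add: restr_def ev_const_mult)

lemma restrict_monom_space:
  "restrict_space A (monom_space B) = (monom_space {t \<in> B. keys t \<inter> A = {}} :: 'a::field mpoly set)"
proof -
  have "p \<in> restr A ` monom_space B" if "keys p \<subseteq> {t \<in> B. keys t \<inter> A = {}}" for p :: "'a mpoly"
  proof
    show "p = restr A p" using that by (intro poly_mapping_eqI) (auto simp: lookup_restr in_keys_iff)
    show "p \<in> monom_space B" using that by (auto simp: monom_space_def)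
  qed
  then show ?thesis by (auto simp: restrict_space_alt monom_space_def keys_restr)
qed

lemma subspace_eval_image:
  assumes "lin.subspace (W :: 'a::field mpoly set)"
  shows "lin.subspace (eval_at const \<sigma> ` W)"
proof (rule subspaceI)
  show "0 \<in> eval_at const \<sigma> ` W"
    using lin.subspace_0[OF assms] ev.eval_zero[of \<sigma>] by (metis imageI)
  show "p + q \<in> eval_at const \<sigma> ` W" if "p \<in> eval_at const \<sigma> ` W" "q \<in> eval_at const \<sigma> ` W" for p q
    using that lin.subspace_add[OF assms] by (auto simp flip: ev.eval_add)
  show "const c * p \<in> eval_at const \<sigma> ` W" if "p \<in> eval_at const \<sigma> ` W" for c p
    using that lin.subspace_scale[OF assms] by (auto simp flip: ev_const_mult)
qed

subsection \<open>Leading monomials\<close>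

definition lead_monoms :: "'a::comm_ring_1 mpoly set \<Rightarrow> monom set" where
  "lead_monoms W = {t. \<exists>p\<in>W. is_largest_monom t p}"

lemma is_largest_monom_iff: "is_largest_monom t p \<longleftrightarrow> t \<in> keys p \<and> (\<forall>s\<in>keys p. mle s t)"
  by (auto simp: is_largest_monom_def mle_def)

lemma max_monom_exists:
  assumes "finite A" "A \<noteq> {}"
  shows "\<exists>t\<in>A. \<forall>s\<in>A. mle s t"
  using assms
proof (induction A rule: finite_ne_induct)
  case (insert x A)
  then obtain t where t: "t \<in> A" "\<forall>s\<in>A. mle s t" by blast
  show ?case
  proof (cases "mle x t")
    case False
    then have "mle t x" using ml.linear by blast
    then show ?thesis using t ml.order_trans by blast
  qed (use t in auto)
qed auto

lemma largest_monom_exists: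
  assumes "p \<noteq> 0"
  obtains t where "is_largest_monom t p"
  using max_monom_exists[of "keys p"] that assms by (auto simp: is_largest_monom_iff)

lemma largest_monom_unique: "is_largest_monom s p \<Longrightarrow> is_largest_monom t p \<Longrightarrow> s = t"
  by (meson is_largest_monom_iff ml.order_antisym)

lemma largest_monom_mult:
  "is_largest_monom t p \<Longrightarrow> is_largest_monom (u + t) (monomial u * p)"
  by (auto simp: is_largest_monom_iff keys_monomial_mult add.commute[of u])

lemma largest_monoms_alt: "largest_monoms W = monomial ` lead_monoms W"
  by (auto simp: largest_monoms_def lead_monoms_def)

lemma in_space_alt: "in_space W = monom_space (lead_monoms W)"
  by (simp add: in_space_def largest_monoms_alt span_monomials)

lemma in_ideal_alt: "in_ideal m I = monom_space (up m (lead_monoms I))"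
  by (simp add: in_ideal_def largest_monoms_alt ideal_gen_monomials)

text \<open>Distinct leading monomials cannot cancel: the largest one among the terms that really
  occur appears in a single term, so it survives in the sum. This takes the place of a Buchberger
  criterion.\<close>

lemma largest_monom_span:
  assumes "f \<in> lin.span S" "is_largest_monom t f"
    and "\<And>g. g \<in> S \<Longrightarrow> is_largest_monom (l g) g" "inj_on l S"
  shows "\<exists>g\<in>S. l g = t"
proof -
  obtain F r where F: "finite F" "F \<subseteq> S" "f = (\<Sum>g\<in>F. const (r g) * g)"
    using assms(1) unfolding lin.span_explicit by blast
  \<comment> \<open>Terms with coefficient zero must go, since their leading monomials could exceed
    that of \<open>f\<close>.\<close>
  let ?G = "{g \<in> F. r g \<noteq> 0}"
  have f: "f = (\<Sum>g\<in>?G. const (r g) * g)"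
    unfolding F(3) using F(1) by (intro sum.mono_neutral_right) auto
  have "f \<noteq> 0" using assms(2) by (auto simp: is_largest_monom_iff)
  have "?G \<noteq> {}"
  proof
    assume "?G = {}"
    then have "f = 0" using f by (simp only: sum.empty)
    then show False using \<open>f \<noteq> 0\<close> by simp
  qed
  then obtain t' where t': "t' \<in> l ` ?G" "\<forall>s\<in>l ` ?G. mle s t'"
    using max_monom_exists[of "l ` ?G"] F(1) by auto
  then obtain g where g: "g \<in> ?G" "l g = t'" by blast
  have max: "mle (l h) t'" if "h \<in> ?G" for h
    using t' that by blast
  have lk: "lookup f s = (\<Sum>h\<in>?G. r h * lookup h s)" for s
    using arg_cong[OF f, of "\<lambda>f. lookup f s"] by (simp add: lookup_sum)
  have "lookup h t' = 0" if "h \<in> ?G" "h \<noteq> g" for h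
  proof (rule ccontr)
    assume "lookup h t' \<noteq> 0"
    then have "mle t' (l h)" using assms(3)[of h] that F(2) by (auto simp: is_largest_monom_iff in_keys_iff)
    then have "l h = l g" using max[OF that(1)] g(2) by (metis ml.order_antisym)
    then show False using inj_onD[OF assms(4)] that g(1) F(2) by blast
  qed
  then have "lookup f t' = (\<Sum>h\<in>?G. if h = g then r g * lookup g t' else 0)"
    unfolding lk by (intro sum.cong) auto
  also have "\<dots> = r g * lookup g t'" using g F(1) by simp
  also have "\<dots> \<noteq> 0"
    using g assms(3)[of g] F(2) by (auto simp: is_largest_monom_iff in_keys_iff)
  finally have "t' \<in> keys f" by (simp add: in_keys_iff)
  moreover have "mle s t'" if "s \<in> keys f" for s
  proof -
    from that have "(\<Sum>h\<in>?G. r h * lookup h s) \<noteq> 0" unfolding lk[symmetric] by (simp add: in_keys_iff)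
    then obtain h where h: "h \<in> ?G" "r h * lookup h s \<noteq> 0"
      by (rule sum.not_neutral_contains_not_neutral)
    then have "mle s (l h)" using assms(3)[of h] F(2) by (auto simp: is_largest_monom_iff in_keys_iff)
    then show ?thesis using max[OF h(1)] ml.order_trans by blast
  qed
  ultimately have "is_largest_monom t' f" by (simp add: is_largest_monom_iff)
  then have "t' = t" using assms(2) by (rule largest_monom_unique)
  then show ?thesis using g F(2) by auto
qed

subsection \<open>Monomial ideals and minimal generators\<close>

lemma colon_monom_space: "colon (monom_space B) m r = monom_space {s. s + single m r \<in> B}"
  by (auto simp: colon_def monom_space_def X_power mult.commute[of _ "monomial _"] keys_monomial_mult
      add.commute)

lemma span_Union_monom_space:
  "lin.span (\<Union>A\<in>\<A>. monom_space A) = (monom_space (\<Union>\<A>) :: 'a::field mpoly set)" (is "?L = ?R")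
proof
  show "?L \<subseteq> ?R"
    by (rule lin.span_minimal[OF _ subspace_monom_space]) (auto simp: monom_space_def)
  have "?R = lin.span (monomial ` \<Union>\<A>)" by (simp add: span_monomials)
  also have "\<dots> \<subseteq> ?L" by (intro lin.span_mono) auto
  finally show "?R \<subseteq> ?L" .
qed

lemma up_base: "t \<in> B \<Longrightarrow> t \<in> up m B"
  unfolding up_def by (rule CollectI, rule exI[of _ 0], rule exI[of _ t]) simp

definition J_set :: "nat \<Rightarrow> nat \<Rightarrow> monom set \<Rightarrow> monom set" where
  "J_set m d B = {s. m \<notin> keys s \<and> ((\<exists>r\<in>{1..d}. s + single m r \<in> B) \<or> s \<in> up m B)}"

lemma J_ideal_monom_space:
  "J_ideal m d (monom_space B) = (monom_space (J_set m d B) :: 'a::field mpoly set)"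
proof -
  let ?\<A> = "insert {s \<in> up m B. keys s \<inter> {m} = {}}
    ((\<lambda>r. {t \<in> {s. s + single m r \<in> B}. keys t \<inter> {m} = {}}) ` {1..d})"
  have "J_ideal m d (monom_space B) = lin.span (\<Union>A\<in>?\<A>. monom_space A :: 'a mpoly set)"
    by (simp add: J_ideal_def colon_monom_space restrict_monom_space ideal_gen_monom_space Un_commute)
  also have "\<dots> = monom_space (\<Union>?\<A>)" by (rule span_Union_monom_space)
  also have "\<Union>?\<A> = J_set m d B" by (auto simp: J_set_def)
  finally show ?thesis .
qed

section \<open>Generated ideals and truncation by degree\<close>

lemma ideal_gen_base: "G \<subseteq> ideal_gen m (G :: 'a::field mpoly set)"
proof
  fix p assume "p \<in> G"
  moreover have "p = monomial 0 * p" by simp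
  ultimately show "p \<in> ideal_gen m G"
    unfolding ideal_gen_span by (intro lin.span_base CollectI exI[of _ 0] exI[of _ p]) auto
qed

lemma subspace_ideal_gen: "lin.subspace (ideal_gen m G)"
  unfolding ideal_gen_span by (rule lin.subspace_span)

lemma ideal_gen_mult:
  assumes "keys u \<subseteq> {1..m}" "p \<in> ideal_gen m (G :: 'a::field mpoly set)"
  shows "monomial u * p \<in> ideal_gen m G"
  using assms(2) unfolding ideal_gen_span
proof (induction rule: lin.span_induct_alt)
  case base
  then show ?case using lin.span_zero by simp
next
  case (step c x y)
  then obtain v g where x: "x = monomial v * g" "keys v \<subseteq> {1..m}" "g \<in> G" by blast
  have "monomial u * x = monomial (u + v) * g" by (simp add: x monomial_add mult.assoc)
  moreover have "keys (u + v) \<subseteq> {1..m}" using x assms(1) by (auto simp: keys_add_monom)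
  ultimately have "monomial u * x \<in> lin.span {monomial u * t |u t. keys u \<subseteq> {1..m} \<and> t \<in> G}"
    using x(3) by (intro lin.span_base) blast
  then have "const c * (monomial u * x) + monomial u * y
      \<in> lin.span {monomial u * t |u t. keys u \<subseteq> {1..m} \<and> t \<in> G}"
    using step by (intro lin.span_add lin.span_scale)
  then show ?case by (simp add: algebra_simps)
qed

lemma ideal_gen_minimal:
  assumes "G \<subseteq> ideal_gen m (H :: 'a::field mpoly set)"
  shows "ideal_gen m G \<subseteq> ideal_gen m H"
  unfolding ideal_gen_span[of m G]
  using assms by (intro lin.span_minimal subspace_ideal_gen) (auto intro!: ideal_gen_mult)

lemma ideal_gen_mono: "G \<subseteq> H \<Longrightarrow> ideal_gen m G \<subseteq> ideal_gen m (H :: 'a::field mpoly set)"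
  using ideal_gen_minimal ideal_gen_base by (metis order_trans)

definition truncate :: "nat \<Rightarrow> 'a::comm_ring_1 mpoly \<Rightarrow> 'a mpoly" where
  "truncate d p = (\<Sum>t\<in>{t \<in> keys p. mdeg t < d}. single t (lookup p t))"

lemma lookup_truncate: "lookup (truncate d p) s = (if mdeg s < d then lookup p s else 0)"
proof -
  have "lookup (truncate d p) s = (\<Sum>t\<in>{t \<in> keys p. mdeg t < d}. if t = s then lookup p s else 0)"
    unfolding truncate_def lookup_sum by (intro sum.cong) (auto simp: lookup_single when_def)
  then show ?thesis by (simp add: in_keys_iff)
qed

lemma truncate_linear: "truncate d (const c * p + q) = const c * truncate d p + truncate d q"
  by (rule poly_mapping_eqI) (simp add: lookup_truncate lookup_add)

lemma truncate_eq_self: "(\<And>t. t \<in> keys p \<Longrightarrow> mdeg t < d) \<Longrightarrow> truncate d p = p"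
  by (rule poly_mapping_eqI) (auto simp: lookup_truncate in_keys_iff)

lemma truncate_eq_0: "(\<And>t. t \<in> keys p \<Longrightarrow> d \<le> mdeg t) \<Longrightarrow> truncate d p = 0"
  by (rule poly_mapping_eqI) (metis lookup_truncate lookup_zero in_keys_iff not_less)

text \<open>Truncate a representation of \<open>h\<close> below degree \<open>d\<close>. Every term
  is homogeneous; those involving \<open>f\<close> have degree at least \<open>d\<close> and
  disappear, while \<open>h\<close> is unchanged.\<close>

lemma ideal_gen_low_degree:
  fixes G :: "'a::field mpoly set"
  assumes hom: "\<forall>p\<in>G. \<exists>e. p \<in> forms m e" and f: "f \<in> forms m d"
    and h: "h \<in> ideal_gen m G" and deg: "\<And>t. t \<in> keys h \<Longrightarrow> mdeg t < d"
  shows "h \<in> ideal_gen m (G - {f})"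
proof -
  let ?I = "ideal_gen m (G - {f})"
  have "truncate d h \<in> ?I"
    using h unfolding ideal_gen_span[of m G]
  proof (induction rule: lin.span_induct_alt)
    case base
    have "truncate d 0 = (0 :: 'a mpoly)" by (rule truncate_eq_0) auto
    then show ?case using lin.subspace_0[OF subspace_ideal_gen] by simp
  next
    case (step c x y)
    then obtain v g where x: "x = monomial v * g" "keys v \<subseteq> {1..m}" "g \<in> G" by blast
    obtain e where e: "g \<in> forms m e" using hom x(3) by blast
    have deg_x: "mdeg t = mdeg v + e" if "t \<in> keys x" for t
      using that e by (auto simp: x keys_monomial_mult forms_def)
    have "truncate d x \<in> ?I"
    proof (cases "g = f \<or> d \<le> mdeg v + e")
      case True
      have "d \<le> mdeg t" if "t \<in> keys x" for t
        using True
      proof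
        assume "g = f"
        with that f show ?thesis by (auto simp: x keys_monomial_mult forms_def)
      next
        assume "d \<le> mdeg v + e"
        then show ?thesis using deg_x[OF that] by simp
      qed
      then have "truncate d x = 0" by (rule truncate_eq_0)
      then show ?thesis using lin.subspace_0[OF subspace_ideal_gen] by simp
    next
      case False
      then have "truncate d x = x" using deg_x by (intro truncate_eq_self) auto
      moreover have "x \<in> ?I"
        unfolding x(1) using False x ideal_gen_base[of "G - {f}" m] by (intro ideal_gen_mult) auto
      ultimately show ?thesis by simp
    qed
    then show ?case unfolding truncate_linear using step
      by (intro lin.subspace_add lin.subspace_scale subspace_ideal_gen)
  qed
  then show ?thesis using truncate_eq_self[of h d] deg by simp
qed

lemma up_closed:
  assumes closed: "\<And>s i. s \<in> K \<Longrightarrow> i \<in> {1..m} \<Longrightarrow> s + unit_exp i \<in> K"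
    and "keys u \<subseteq> {1..m}" "s \<in> K"
  shows "u + s \<in> K"
  using assms(2)
proof (induction "mdeg u" arbitrary: u)
  case 0
  then show ?case using assms(3) mdeg_eq_0_iff[of u] by simp
next
  case (Suc k)
  then have "keys u \<noteq> {}" by auto
  then obtain i where i: "i \<in> keys u" by blast
  then obtain v where v: "u = v + unit_exp i" by (rule divide_by_variable)
  have "v + s \<in> K" using Suc v by (intro Suc(1)) (auto simp: keys_add_monom)
  then have "(v + s) + unit_exp i \<in> K" using closed i Suc(3) by auto
  then show ?case by (simp add: v ac_simps)
qed

lemma has_min_generator_monom_space:
  assumes K: "\<And>s. s \<in> K \<Longrightarrow> keys s \<subseteq> {1..m}"
    and closed: "\<And>s i. s \<in> K \<Longrightarrow> i \<in> {1..m} \<Longrightarrow> s + unit_exp i \<in> K"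
  shows "has_min_generator m (monom_space K :: 'a::field mpoly set) d
    \<longleftrightarrow> (\<exists>s\<in>K. mdeg s = d \<and> (\<forall>s' i. s = s' + unit_exp i \<longrightarrow> s' \<notin> K))" (is "?L \<longleftrightarrow> ?R")
proof
  assume ?L
  then obtain G and f :: "'a mpoly" where G: "min_hom_generators m (monom_space K) G" and f: "f \<in> G" "f \<in> forms m d"
    unfolding has_min_generator_def by blast
  have gen: "ideal_gen m G = monom_space K" and hom: "\<forall>p\<in>G. \<exists>e. p \<in> forms m e"
    and min: "\<And>H. H \<subset> G \<Longrightarrow> ideal_gen m H \<noteq> monom_space K"
    using G unfolding min_hom_generators_def by blast+
  let ?I = "ideal_gen m (G - {f})"
  show ?R
  proof (rule ccontr)
    assume no: "\<not> ?R"
    have mem: "monomial s \<in> ?I" if "s \<in> keys f" for s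
    proof -
      have "f \<in> monom_space K" using f(1) gen ideal_gen_base by blast
      then have "s \<in> K" using that by (auto simp: monom_space_def)
      moreover have "mdeg s = d" using f(2) that by (auto simp: forms_def)
      ultimately obtain s' i where s': "s = s' + unit_exp i" "s' \<in> K" using no by blast
      have "monomial s' \<in> ?I"
        using s' \<open>mdeg s = d\<close> f(2) gen by (intro ideal_gen_low_degree[OF hom]) auto
      moreover have "keys (unit_exp i) \<subseteq> {1..m}"
        using K[OF \<open>s \<in> K\<close>] by (auto simp: s' keys_add_monom)
      ultimately have "monomial (unit_exp i) * monomial s' \<in> ?I" by (intro ideal_gen_mult)
      then show ?thesis by (simp add: s' add.commute flip: monomial_add)
    qed
    have "(\<Sum>s\<in>keys f. const (lookup f s) * monomial s) \<in> ?I"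
      by (intro lin.subspace_sum lin.subspace_scale subspace_ideal_gen mem)
    then have "f \<in> ?I" by (simp flip: expand_monomials)
    then have "G \<subseteq> ?I" using ideal_gen_base[of "G - {f}" m] by blast
    then have "ideal_gen m G \<subseteq> ?I" by (rule ideal_gen_minimal)
    moreover have "?I \<subseteq> ideal_gen m G" by (rule ideal_gen_mono) blast
    ultimately show False using min[of "G - {f}"] f(1) gen by blast
  qed
next
  assume ?R
  \<comment> \<open>The monomials of \<open>K\<close> minimal under divisibility; as
    \<open>K\<close> is closed under multiplication, testing division by one variable is
    enough.\<close>
  define D where "D = {s \<in> K. \<forall>s' i. s = s' + unit_exp i \<longrightarrow> s' \<notin> K}"
  obtain s where s: "s \<in> D" "mdeg s = d" using \<open>?R\<close> by (auto simp: D_def)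
  have sub: "up m K \<subseteq> K"
    using up_closed[of K m, OF closed] by (auto simp: up_def)
  have "t \<in> up m D" if "t \<in> K" for t
    using that
  proof (induction "mdeg t" arbitrary: t rule: less_induct)
    case less
    show ?case
    proof (cases "t \<in> D")
      case True
      then show ?thesis by (rule up_base)
    next
      case False
      then obtain t' i where t': "t = t' + unit_exp i" "t' \<in> K" using less(2) by (auto simp: D_def)
      then have "t' \<in> up m D" by (intro less(1)) auto
      then obtain u w where uw: "t' = u + w" "keys u \<subseteq> {1..m}" "w \<in> D" by (auto simp: up_def)
      have "t = (u + unit_exp i) + w" by (simp add: t' uw ac_simps)
      moreover have "keys (u + unit_exp i) \<subseteq> {1..m}"
        using uw K[OF less(2)] by (auto simp: t' keys_add_monom)
      ultimately show ?thesis using uw(3) by (auto simp: up_def)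
    qed
  qed
  moreover have "up m D \<subseteq> up m K" by (auto simp: up_def D_def)
  ultimately have upD: "up m D = K" using sub by blast
  have "min_hom_generators m (monom_space K) (monomial ` D :: 'a mpoly set)"
    unfolding min_hom_generators_def
  proof (intro conjI allI impI ballI)
    fix p :: "'a mpoly" assume "p \<in> monomial ` D"
    then obtain t where "t \<in> D" "p = monomial t" by blast
    then show "\<exists>e. p \<in> forms m e" using K
      by (intro exI[of _ "mdeg t"]) (auto simp: forms_eq_monom_space monoms_def D_def)
  next
    show "ideal_gen m (monomial ` D) = (monom_space K :: 'a mpoly set)" by (simp add: ideal_gen_monomials upD)
  next
    fix H :: "'a mpoly set" assume H: "H \<subset> monomial ` D"
    define D' where "D' = {t \<in> D. monomial t \<in> H}"
    have H': "H = monomial ` D'" using H by (auto simp: D'_def)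
    then obtain t where t: "t \<in> D" "t \<notin> D'" using H by blast
    have "t \<notin> up m D'"
    proof
      assume "t \<in> up m D'"
      then obtain u w where uw: "t = u + w" "keys u \<subseteq> {1..m}" "w \<in> D'" by (auto simp: up_def)
      then have "u \<noteq> 0" using t by auto
      then have "keys u \<noteq> {}" by simp
      then obtain i where i: "i \<in> keys u" by blast
      then obtain v where v: "u = v + unit_exp i" by (rule divide_by_variable)
      have "keys v \<subseteq> {1..m}" using uw(2) by (auto simp: v keys_add_monom)
      then have "v + w \<in> K" using uw(3) by (intro up_closed[of K m, OF closed]) (auto simp: D'_def D_def)
      moreover have "t = (v + w) + unit_exp i" by (simp add: uw v ac_simps)
      ultimately show False using t(1) by (auto simp: D_def)
    qed
    moreover have "t \<in> K" using t by (simp add: D_def)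
    ultimately show "ideal_gen m H \<noteq> monom_space K"
      by (auto simp: H' ideal_gen_monomials monom_space_inject)
  qed
  moreover have "monomial s \<in> (monomial ` D \<inter> forms m d :: 'a mpoly set)"
    using s K by (auto simp: forms_eq_monom_space monoms_def D_def)
  ultimately show ?L unfolding has_min_generator_def by blast
qed

subsection \<open>Strongly stable monomial spaces\<close>

text \<open>The type of exponent vectors also has an index 0, which is no variable;
  \<open>1 \<le> i\<close> keeps the exchange among the variables.\<close>

definition strongly_stable :: "monom set \<Rightarrow> bool" where
  "strongly_stable B \<longleftrightarrow> (\<forall>t i j. t + unit_exp j \<in> B \<longrightarrow> 1 \<le> i \<longrightarrow> i < j \<longrightarrow> t + unit_exp i \<in> B)"

lemma strongly_stableD: "strongly_stable B \<Longrightarrow> t + unit_exp j \<in> B \<Longrightarrow> 1 \<le> i \<Longrightarrow> i \<le> j \<Longrightarrow> t + unit_exp i \<in> B"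
  by (cases "i = j") (auto simp: strongly_stable_def)

text \<open>The common combinatorial content of the two forms of the hypothesis: every monomial free
  of x_m is a variable times a monomial of the colon space by x_m.\<close>

definition generated_below :: "nat \<Rightarrow> monom set \<Rightarrow> bool" where
  "generated_below m B \<longleftrightarrow> (\<forall>t\<in>B. m \<notin> keys t \<longrightarrow> (\<exists>s i. t = s + unit_exp i \<and> s + unit_exp m \<in> B))"

text \<open>The summand with index \<open>r\<close> lies in degree d - r, below \<open>d\<close>,
  and an element of the generated ideal in degree \<open>d\<close> can only have the trivial
  multiplier.\<close>

lemma J_set_degree_d:
  assumes "B \<subseteq> monoms m d" "mdeg s = d"
  shows "s \<in> J_set m d B \<longleftrightarrow> s \<in> B \<and> m \<notin> keys s"
proof
  assume s: "s \<in> J_set m d B"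
  have "s + single m r \<notin> B" if "r \<in> {1..d}" for r
    using that assms by (auto simp: monoms_def)
  with s have "s \<in> up m B" by (auto simp: J_set_def)
  then obtain u t where ut: "s = u + t" "t \<in> B" by (auto simp: up_def)
  then have "mdeg u = 0" using assms by (auto simp: monoms_def)
  then have "u = 0" by (simp add: mdeg_eq_0_iff)
  then show "s \<in> B \<and> m \<notin> keys s" using ut s by (auto simp: J_set_def)
next
  assume "s \<in> B \<and> m \<notin> keys s"
  then show "s \<in> J_set m d B" by (auto simp: J_set_def intro: up_base)
qed

text \<open>Only the restricted ideal contributes here. A product free of x_m has both factors free
  of x_m, so generators and multipliers may be restricted separately.\<close>

lemma J_set_degree_above:
  assumes "B \<subseteq> monoms m d" "d \<le> mdeg s" "1 \<le> m"
  shows "s \<in> J_set m d B \<longleftrightarrow> s \<in> up (m - 1) {t \<in> B. m \<notin> keys t}"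
proof
  assume s: "s \<in> J_set m d B"
  have "s + single m r \<notin> B" if "r \<in> {1..d}" for r
    using that assms by (auto simp: monoms_def)
  with s obtain u t where ut: "s = u + t" "t \<in> B" "keys u \<subseteq> {1..m}" "m \<notin> keys s"
    by (auto simp: J_set_def up_def)
  then have "keys u \<subseteq> {1..m} - {m}" "m \<notin> keys t" by (auto simp: keys_add_monom)
  moreover have "{1..m} - {m} = {1..m-1}" by auto
  ultimately show "s \<in> up (m - 1) {t \<in> B. m \<notin> keys t}" using ut by (auto simp: up_def)
next
  assume "s \<in> up (m - 1) {t \<in> B. m \<notin> keys t}"
  then obtain u t where ut: "s = u + t" "t \<in> B" "keys u \<subseteq> {1..m-1}" "m \<notin> keys t" by (auto simp: up_def)
  moreover have "m \<notin> {1..m-1}" using assms by auto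
  moreover have "{1..m-1} \<subseteq> {1..m}" by auto
  ultimately have "keys u \<subseteq> {1..m}" "m \<notin> keys s" by (auto simp: keys_add_monom)
  then show "s \<in> J_set m d B" using ut by (auto simp: J_set_def up_def)
qed

text \<open>For degree reasons only the summand with r = 1 is left.\<close>

lemma J_set_degree_pred:
  assumes "B \<subseteq> monoms m d" "Suc (mdeg s) = d"
  shows "s \<in> J_set m d B \<longleftrightarrow> s + unit_exp m \<in> B \<and> m \<notin> keys s"
proof
  assume s: "s \<in> J_set m d B"
  have deg: "mdeg t = Suc (mdeg s)" if "t \<in> B" for t using assms that by (auto simp: monoms_def)
  have "s \<notin> up m B" using deg by (fastforce simp: up_def)
  then obtain r where r: "s + single m r \<in> B" using s by (auto simp: J_set_def)
  then have "r = Suc 0" using deg[OF r] by simp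
  then show "s + unit_exp m \<in> B \<and> m \<notin> keys s" using r s by (simp add: J_set_def)
next
  assume "s + unit_exp m \<in> B \<and> m \<notin> keys s"
  moreover have "1 \<in> {1..d}" using assms(2) by auto
  ultimately show "s \<in> J_set m d B" unfolding J_set_def One_nat_def by blast
qed

lemma J_set_keys:
  assumes "B \<subseteq> monoms m d" "s \<in> J_set m d B"
  shows "keys s \<subseteq> {1..m-1}"
proof -
  have B: "keys t \<subseteq> {1..m}" if "t \<in> B" for t using assms(1) that by (auto simp: monoms_def)
  from assms(2) consider r where "s + single m r \<in> B" | "s \<in> up m B" by (auto simp: J_set_def)
  then have "keys s \<subseteq> {1..m}"
  proof cases
    case (1 r)
    then show ?thesis using B[OF 1] by (simp add: keys_add_monom)
  next
    case 2
    then obtain u t where "s = u + t" "keys u \<subseteq> {1..m}" "t \<in> B" by (auto simp: up_def)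
    then show ?thesis using B[of t] by (simp add: keys_add_monom)
  qed
  moreover have "m \<notin> keys s" using assms by (simp add: J_set_def)
  ultimately have "keys s \<subseteq> {1..m} - {m}" by blast
  moreover have "{1..m} - {m} \<subseteq> {1..m-1}" by auto
  ultimately show ?thesis by (rule subset_trans)
qed

text \<open>This is where strong stability makes the direct sum an ideal: in s x_m^r one factor x_m
  is exchanged for x_i, which moves s x_i into the summand with index r - 1, or into the restricted
  ideal when r = 1.\<close>

lemma J_set_closed:
  assumes "strongly_stable B" "s \<in> J_set m d B" "i \<in> {1..m-1}" "1 \<le> m"
  shows "s + unit_exp i \<in> J_set m d B"
proof -
  have m: "m \<notin> keys (s + unit_exp i)" using assms by (auto simp: J_set_def keys_add_monom)
  from assms(2) consider r where "r \<in> {1..d}" "s + single m r \<in> B" | "s \<in> up m B"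
    by (auto simp: J_set_def)
  then show ?thesis
  proof cases
    case (1 r)
    have "single m (r - 1) + unit_exp m = single m (r - 1 + Suc 0)" by (simp only: single_add)
    also have "r - 1 + Suc 0 = r" using 1 by simp
    finally have "s + single m r = (s + single m (r - 1)) + unit_exp m" by (simp only: add.assoc)
    then have "(s + single m (r - 1)) + unit_exp m \<in> B" using 1 by simp
    then have "(s + single m (r - 1)) + unit_exp i \<in> B"
      by (rule strongly_stableD[OF assms(1)]) (use assms in auto)
    then have B: "(s + unit_exp i) + single m (r - 1) \<in> B" by (simp only: ac_simps)
    show ?thesis
    proof (cases "r = 1")
      case True
      then show ?thesis using B m by (auto simp: J_set_def intro: up_base)
    next
      case False
      then have "r - 1 \<in> {1..d}" using 1 by auto
      then show ?thesis using B m by (auto simp: J_set_def)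
    qed
  next
    case 2
    then obtain u t where ut: "s = u + t" "keys u \<subseteq> {1..m}" "t \<in> B" by (auto simp: up_def)
    have "s + unit_exp i = (u + unit_exp i) + t" by (simp only: ut ac_simps)
    moreover have "keys (u + unit_exp i) \<subseteq> {1..m}"
      using ut(2) assms(3) by (auto simp: keys_add_monom)
    ultimately have "s + unit_exp i \<in> up m B" using ut(3) unfolding up_def by blast
    then show ?thesis using m by (simp add: J_set_def)
  qed
qed

text \<open>A monomial of degree \<open>d\<close> fails to be a minimal generator exactly if some
  variable can be divided out within the ideal; the quotient then has degree d - 1, where membership
  means lying in the colon space by x_m.\<close>

lemma has_min_generator_J_ideal:
  assumes "B \<subseteq> monoms m d" "strongly_stable B" "1 \<le> m"
  shows "\<not> has_min_generator (m - 1) (J_ideal m d (monom_space B) :: 'a::field mpoly set) d \<longleftrightarrow> generated_below m B"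
proof -
  let ?K = "J_set m d B"
  have "\<not> has_min_generator (m - 1) (J_ideal m d (monom_space B) :: 'a mpoly set) d
      \<longleftrightarrow> (\<forall>s\<in>?K. mdeg s = d \<longrightarrow> (\<exists>s' i. s = s' + unit_exp i \<and> s' \<in> ?K))"
    unfolding J_ideal_monom_space
    using J_set_keys[OF assms(1)] J_set_closed[OF assms(2) _ _ assms(3)]
    by (subst has_min_generator_monom_space) blast+
  also have "\<dots> \<longleftrightarrow> generated_below m B"
    unfolding generated_below_def
  proof (intro iffI ballI impI)
    fix t assume *: "\<forall>s\<in>?K. mdeg s = d \<longrightarrow> (\<exists>s' i. s = s' + unit_exp i \<and> s' \<in> ?K)" and t: "t \<in> B" "m \<notin> keys t"
    have "mdeg t = d" using t assms by (auto simp: monoms_def)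
    then have "t \<in> ?K" using J_set_degree_d[OF assms(1)] t by blast
    then obtain s i where s: "t = s + unit_exp i" "s \<in> ?K" using * \<open>mdeg t = d\<close> by blast
    then have "s + unit_exp m \<in> B" using J_set_degree_pred[OF assms(1), of s] \<open>mdeg t = d\<close> by simp
    then show "\<exists>s i. t = s + unit_exp i \<and> s + unit_exp m \<in> B" using s by blast
  next
    fix s assume *: "\<forall>t\<in>B. m \<notin> keys t \<longrightarrow> (\<exists>s i. t = s + unit_exp i \<and> s + unit_exp m \<in> B)"
      and s: "s \<in> ?K" "mdeg s = d"
    then have "s \<in> B" "m \<notin> keys s" using J_set_degree_d[OF assms(1)] by blast+
    then obtain s' i where s': "s = s' + unit_exp i" "s' + unit_exp m \<in> B" using * by blast
    then have "s' \<in> ?K" using J_set_degree_pred[OF assms(1), of s'] s(2) \<open>m \<notin> keys s\<close>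
      by (simp add: keys_add_monom)
    then show "\<exists>s' i. s = s' + unit_exp i \<and> s' \<in> ?K" using s' by blast
  qed
  finally show ?thesis .
qed

text \<open>Strong stability gives one inclusion. In the other, monomials divisible by x_m are
  automatic, so the condition only concerns those free of x_m.\<close>

lemma colon_times_variables:
  assumes "B \<subseteq> monoms m d" "strongly_stable B" "1 \<le> m"
  shows "space_prod (colon (monom_space B) m 1) (lin.span (X ` {1..m})) = (monom_space B :: 'a::field mpoly set)
    \<longleftrightarrow> generated_below m B"
proof -
  let ?C = "{s + t | s t. s \<in> {s. s + single m 1 \<in> B} \<and> t \<in> unit_exp ` {1..m}}"
  have "X ` {1..m} = (monomial ` unit_exp ` {1..m} :: 'a mpoly set)"
    by (simp add: image_image X_alt)
  then have "space_prod (colon (monom_space B) m 1) (lin.span (X ` {1..m})) = (monom_space ?C :: 'a mpoly set)"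
    by (simp only: colon_monom_space span_monomials space_prod_monom_space)
  then have "space_prod (colon (monom_space B) m 1) (lin.span (X ` {1..m})) = (monom_space B :: 'a mpoly set) \<longleftrightarrow> ?C = B"
    by (simp add: monom_space_inject)
  moreover have "?C \<subseteq> B" using strongly_stableD[OF assms(2)] by auto
  moreover have "B \<subseteq> ?C \<longleftrightarrow> generated_below m B"
  proof
    assume "B \<subseteq> ?C"
    then show "generated_below m B" by (fastforce simp: generated_below_def)
  next
    assume gb: "generated_below m B"
    show "B \<subseteq> ?C"
    proof
      fix t assume t: "t \<in> B"
      show "t \<in> ?C"
      proof (cases "m \<in> keys t")
        case True
        then obtain s where "t = s + unit_exp m" by (rule divide_by_variable)
        then show ?thesis using t assms(3) by (intro CollectI exI[of _ s] exI[of _ "unit_exp m"]) auto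
      next
        case False
        then obtain s i where s: "t = s + unit_exp i" "s + unit_exp m \<in> B"
          using gb t by (auto simp: generated_below_def)
        moreover have "i \<in> {1..m}" using t assms(1) s by (auto simp: monoms_def keys_add_monom)
        ultimately show ?thesis by (intro CollectI exI[of _ s] exI[of _ "unit_exp i"]) auto
      qed
    qed
  qed
  ultimately show ?thesis by blast
qed

subsection \<open>Crystallization\<close>

text \<open>The Eliahou-Kervaire condition on a product u s: no variable of \<open>s\<close> comes
  after a variable of \<open>u\<close>.\<close>

definition separated :: "monom \<Rightarrow> monom \<Rightarrow> bool" where
  "separated s u \<longleftrightarrow> (\<forall>k\<in>keys s. \<forall>j\<in>keys u. k \<le> j)"

lemma lookup_le_imp_eq:
  assumes "\<And>k. lookup s k \<le> lookup t k" "mdeg s = mdeg t"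
  shows "s = t"
proof -
  have t: "t = s + (t - s)" using assms(1) by (intro poly_mapping_eqI) (simp add: lookup_add lookup_minus)
  then have "mdeg t = mdeg s + mdeg (t - s)" using mdeg_add[of s "t - s"] by simp
  then have "t - s = 0" using assms(2) by (simp add: mdeg_eq_0_iff)
  then show ?thesis using t by simp
qed

text \<open>The factor \<open>s\<close> must consist of the first variables of the product, counted
  with multiplicity up to its degree. If \<open>s\<close> has more of x_k and \<open>s'\<close> more
  of x_l, then x_l occurs in \<open>u\<close> and x_k in \<open>u'\<close>, and the two separations
  force k = l.\<close>

lemma separated_unique:
  assumes "separated s u" "separated s' u'" "u + s = u' + s'" "mdeg s = mdeg s'"
  shows "s = s'"
proof (rule ccontr)
  assume ne: "s \<noteq> s'"
  obtain k where k: "lookup s' k < lookup s k"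
    using lookup_le_imp_eq[of s s'] ne assms(4) not_less by metis
  obtain l where l: "lookup s l < lookup s' l"
    using lookup_le_imp_eq[of s' s] ne assms(4) not_less by metis
  have eq: "lookup u i + lookup s i = lookup u' i + lookup s' i" for i
    using arg_cong[OF assms(3), of "\<lambda>t. lookup t i"] by (simp add: lookup_add)
  have "k \<in> keys s" "k \<in> keys u'" using k eq[of k] by (auto simp: in_keys_iff)
  moreover have "l \<in> keys s'" "l \<in> keys u" using l eq[of l] by (auto simp: in_keys_iff)
  ultimately have "k = l" using assms(1,2) by (auto simp: separated_def intro: antisym)
  then show False using k l by simp
qed

text \<open>Position among the finitely many monomials of the same degree; it makes descent along
  the monomial order an induction on numbers.\<close>

definition monom_rank :: "nat \<Rightarrow> monom \<Rightarrow> nat" where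
  "monom_rank m t = card {s \<in> monoms m (mdeg t). mless s t}"

lemma monom_rank_less:
  assumes "mless s t" "s \<in> monoms m d" "t \<in> monoms m d"
  shows "monom_rank m s < monom_rank m t"
proof -
  have "{r \<in> monoms m d. mless r s} \<subset> {r \<in> monoms m d. mless r t}"
    using assms mless_trans mless_irrefl by blast
  then have "card {r \<in> monoms m d. mless r s} < card {r \<in> monoms m d. mless r t}"
    by (intro psubset_card_mono) (auto simp: finite_monoms)
  moreover have "mdeg s = d" "mdeg t = d" using assms by (auto simp: monoms_def)
  ultimately show ?thesis by (simp add: monom_rank_def)
qed

lemma monoms_add: "s \<in> monoms m d \<Longrightarrow> t \<in> monoms m e \<Longrightarrow> s + t \<in> monoms m (d + e)"
  by (simp add: monoms_def keys_add_monom)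

text \<open>When \<open>w s\<close> has leading monomial \<open>s\<close>, the product has leading
  monomial \<open>v + s\<close>. The bound \<open>b\<close> thus excludes representations whose
  terms cancel above \<open>b\<close>.\<close>

definition separated_products :: "nat \<Rightarrow> monom set \<Rightarrow> (monom \<Rightarrow> 'a::field mpoly) \<Rightarrow> nat \<Rightarrow> monom \<Rightarrow> 'a mpoly set" where
  "separated_products m A w k b =
     {monomial v * w s | v s. s \<in> A \<and> v \<in> monoms m k \<and> separated s v \<and> mle (v + s) b}"

text \<open>If \<open>x\<^sub>i w\<^sub>t\<close> is not a separated product, replace it by separated products. This lowers the
  leading monomial \<open>u t\<close> of \<open>u w\<^sub>t\<close> or, when the leading monomial stays the same, moves the first
  factor \<open>u\<close> towards the later variables.\<close>

lemma span_separated_products: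
  fixes w :: "monom \<Rightarrow> 'a::field mpoly"
  assumes A: "A \<subseteq> monoms m e"
    and lin: "\<And>t i. t \<in> A \<Longrightarrow> i \<in> {1..m} \<Longrightarrow>
      monomial (unit_exp i) * w t \<in> lin.span (separated_products m A w 1 (unit_exp i + t))"
    and "t \<in> A" "u \<in> monoms m k"
  shows "monomial u * w t \<in> lin.span (separated_products m A w k (u + t))"
  using assms(3,4)
proof (induction "(u, t)" arbitrary: u t
    rule: wf_induct_rule[OF wf_measures[of "[\<lambda>(u, t). monom_rank m (u + t), \<lambda>(u, t). monom_rank m u]"]])
  case (1 u t)
  let ?P = "separated_products m A w k (u + t)"
  show ?case
  proof (cases "separated t u")
    case True
    then show ?thesis
      using 1(2,3) by (intro lin.span_base) (auto simp: separated_products_def)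
  next
    case False
    then obtain l i where li: "l \<in> keys t" "i \<in> keys u" "i < l" by (force simp: separated_def)
    then obtain u' where u': "u = u' + unit_exp i" by (metis divide_by_variable)
    have i: "i \<in> {1..m}" using 1(3) li(2) by (auto simp: monoms_def)
    have u'k: "keys u' \<subseteq> {1..m}" "Suc (mdeg u') = k" using 1(3) by (auto simp: u' monoms_def keys_add_monom)
    have step: "monomial u' * x \<in> lin.span ?P" if "x \<in> separated_products m A w 1 (unit_exp i + t)" for x
    proof -
      from that obtain v s where x: "x = monomial v * w s" "s \<in> A" "v \<in> monoms m 1"
        "separated s v" "mle (v + s) (unit_exp i + t)"
        unfolding separated_products_def by blast
      have v1: "mdeg v = 1" using x(3) by (simp add: monoms_def)
      then have "v \<noteq> 0" by auto
      then have "keys v \<noteq> {}" by simp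
      then obtain j where j: "j \<in> keys v" by blast
      then obtain v' where v': "v = v' + unit_exp j" by (rule divide_by_variable)
      then have "v' = 0" using v1 by (simp flip: mdeg_eq_0_iff)
      then have v: "v = unit_exp j" using v' by simp
      have u'v: "u' + v \<in> monoms m k" using u'k x(3) v1 by (auto simp: monoms_def keys_add_monom)
      have le: "mle ((u' + v) + s) (u + t)"
      proof -
        have "mle ((v + s) + u') ((unit_exp i + t) + u')" using x(5) by simp
        then show ?thesis by (simp only: u' ac_simps)
      qed
      have "((u' + v, s), (u, t)) \<in> measures [\<lambda>(u, t). monom_rank m (u + t), \<lambda>(u, t). monom_rank m u]"
      proof (cases "(u' + v) + s = u + t")
        \<comment> \<open>With an unchanged leading monomial, x_l divides v s. As \<open>s\<close>
          and v = x_j are separated, l is at most j, so i < j and the new first factor is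
          smaller.\<close>
        case True
        then have "u' + (v + s) = u' + (unit_exp i + t)" by (simp only: u' ac_simps)
        then have "v + s = unit_exp i + t" by simp
        then have "l \<in> keys (v + s)" using li(1) by (simp add: keys_add_monom)
        then have "l \<le> j" using x(4) by (auto simp: separated_def v keys_add_monom)
        then have "mless (u' + v) u" unfolding u' v using li(3) by (intro mless_add_unit_exp) auto
        then have "monom_rank m (u' + v) < monom_rank m u" by (rule monom_rank_less[OF _ u'v 1(3)])
        then show ?thesis using True by simp
      next
        case False
        then have "mless ((u' + v) + s) (u + t)" using le by (simp add: mle_def)
        moreover have "(u' + v) + s \<in> monoms m (k + e)" "u + t \<in> monoms m (k + e)"
          using u'v x(2) 1(2,3) A by (auto intro!: monoms_add)
        ultimately have "monom_rank m ((u' + v) + s) < monom_rank m (u + t)" by (rule monom_rank_less)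
        then show ?thesis by simp
      qed
      then have "monomial (u' + v) * w s \<in> lin.span (separated_products m A w k ((u' + v) + s))"
        using x(2) u'v by (intro 1(1)) auto
      moreover have "separated_products m A w k ((u' + v) + s) \<subseteq> ?P"
        using le ml.order_trans by (fastforce simp: separated_products_def)
      ultimately have "monomial (u' + v) * w s \<in> lin.span ?P" using lin.span_mono by blast
      then show ?thesis by (simp add: x(1) monomial_add mult.assoc)
    qed
    have "monomial u' * x \<in> lin.span ?P" if "x \<in> lin.span (separated_products m A w 1 (unit_exp i + t))" for x
      using that
    proof (induction rule: lin.span_induct_alt)
      case base
      then show ?case using lin.span_zero by simp
    next
      case (step c x y)
      then have "const c * (monomial u' * x) + monomial u' * y \<in> lin.span ?P"
        using \<open>\<And>x. x \<in> separated_products m A w 1 (unit_exp i + t) \<Longrightarrow> monomial u' * x \<in> lin.span ?P\<close>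
        by (intro lin.span_add lin.span_scale)
      then show ?case by (simp add: algebra_simps)
    qed
    from this[OF lin[OF 1(2) i]] show ?thesis by (simp add: u' monomial_add mult.assoc)
  qed
qed

text \<open>Gaussian elimination: subtracting a multiple of \<open>h c\<close> removes the leading
  monomial and leaves an element of \<open>W\<close> with a smaller one. The bound by
  \<open>c\<close> is what later controls the separated products.\<close>

lemma triangular_span:
  fixes W :: "'a::field mpoly set"
  assumes W: "lin.subspace W" "W \<subseteq> forms m d"
    and h: "\<And>b. b \<in> lead_monoms W \<Longrightarrow> h b \<in> W \<and> is_largest_monom b (h b)"
    and "v \<in> W" "is_largest_monom c v"
  shows "v \<in> lin.span {h b | b. b \<in> lead_monoms W \<and> mle b c}"
  using assms(4,5)
proof (induction "monom_rank m c" arbitrary: v c rule: less_induct)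
  case less
  let ?S = "\<lambda>c. {h b | b. b \<in> lead_monoms W \<and> mle b c}"
  have c: "c \<in> lead_monoms W" using less by (auto simp: lead_monoms_def)
  note hc = h[OF c, THEN conjunct1] h[OF c, THEN conjunct2]
  define a where "a = lookup v c / lookup (h c) c"
  define v' where "v' = v - const a * h c"
  have "lookup (h c) c \<noteq> 0" using hc(2) by (auto simp: is_largest_monom_iff in_keys_iff)
  then have "lookup v' c = 0" by (simp add: v'_def a_def lookup_minus)
  have le: "mless s c" if "s \<in> keys v'" for s
  proof -
    have "s \<noteq> c" using that \<open>lookup v' c = 0\<close> by (auto simp: in_keys_iff)
    moreover have "lookup v s \<noteq> 0 \<or> lookup (h c) s \<noteq> 0"
      using that by (auto simp: v'_def lookup_minus in_keys_iff)
    then have "mle s c" using hc(2) less(3) by (auto simp: is_largest_monom_iff in_keys_iff)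
    ultimately show ?thesis by (simp add: mle_def)
  qed
  have v'W: "v' \<in> W"
    unfolding v'_def using hc(1) less(2) W(1) by (intro lin.subspace_diff lin.subspace_scale)
  have "v' \<in> lin.span (?S c)"
  proof (cases "v' = 0")
    case True
    then show ?thesis using lin.span_zero by simp
  next
    case False
    then obtain c' where c': "is_largest_monom c' v'" by (rule largest_monom_exists)
    then have "mless c' c" using le by (simp add: is_largest_monom_iff)
    moreover have "c' \<in> monoms m d" "c \<in> monoms m d"
      using c' v'W less(2,3) W(2) by (auto simp: forms_eq_monom_space monom_space_def is_largest_monom_iff)
    ultimately have "monom_rank m c' < monom_rank m c" by (rule monom_rank_less)
    then have "v' \<in> lin.span (?S c')" using v'W c' by (rule less(1))
    moreover have "?S c' \<subseteq> ?S c" using \<open>mless c' c\<close> ml.order_trans unfolding mle_def by blast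
    ultimately show ?thesis using lin.span_mono by blast
  qed
  moreover have "h c \<in> lin.span (?S c)" using c by (intro lin.span_base) auto
  ultimately have "v' + const a * h c \<in> lin.span (?S c)" by (intro lin.span_add lin.span_scale)
  then show ?case by (simp add: v'_def)
qed

subsection \<open>Infinitesimal stability\<close>

text \<open>The operator \<open>x\<^sub>i \<partial>/\<partial>x\<^sub>j\<close>. If \<open>x\<^sub>j\<close> does not divide \<open>t\<close>, then the subtraction is truncated, but
  the coefficient vanishes.\<close>

definition shift_deriv :: "nat \<Rightarrow> nat \<Rightarrow> 'a::comm_ring_1 mpoly \<Rightarrow> 'a mpoly" where
  "shift_deriv i j p =
     (\<Sum>t\<in>keys p. single (t - unit_exp j + unit_exp i) (of_nat (lookup t j) * lookup p t))"

lemma lookup_shift_deriv: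
  assumes "i \<noteq> j"
  shows "lookup (shift_deriv i j p) (t + unit_exp i) = of_nat (Suc (lookup t j)) * lookup p (t + unit_exp j)"
proof -
  have "lookup (shift_deriv i j p) (t + unit_exp i)
      = (\<Sum>s\<in>keys p. if s = t + unit_exp j then of_nat (Suc (lookup t j)) * lookup p (t + unit_exp j) else 0)"
    unfolding shift_deriv_def lookup_sum
  proof (intro sum.cong refl)
    fix s assume "s \<in> keys p"
    show "lookup (single (s - unit_exp j + unit_exp i) (of_nat (lookup s j) * lookup p s)) (t + unit_exp i) =
      (if s = t + unit_exp j then of_nat (Suc (lookup t j)) * lookup p (t + unit_exp j) else 0)"
    proof (cases "j \<in> keys s")
      case True
      then obtain r where r: "s = r + unit_exp j" by (rule divide_by_variable)
      then show ?thesis by (auto simp: lookup_single when_def lookup_add)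
    next
      case False
      then have "s \<noteq> t + unit_exp j" by (auto simp: keys_add_monom)
      then show ?thesis using False by (simp add: in_keys_iff)
    qed
  qed
  then show ?thesis by (simp add: in_keys_iff)
qed

lemma lookup_shift_deriv_0: "i \<notin> keys s \<Longrightarrow> lookup (shift_deriv i j p) s = 0"
  unfolding shift_deriv_def lookup_sum
  by (intro sum.neutral) (auto simp: lookup_single when_def keys_add_monom)

text \<open>A tangent condition: V is preserved by x_i d/dx_j modulo monomials not above the leading
  one. The comparison stops at \<open>b\<close> because maximal ranks are only exploited for
  elements vanishing above \<open>b\<close>.\<close>

definition infinitesimally_stable :: "nat \<Rightarrow> 'a::field mpoly set \<Rightarrow> bool" where
  "infinitesimally_stable n V \<longleftrightarrow> (\<forall>p\<in>V. \<forall>b i j. is_largest_monom b p \<longrightarrow> 1 \<le> i \<longrightarrow> i < j \<longrightarrow> j \<le> n \<longrightarrow>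
     (\<exists>q\<in>V. \<forall>s. mless b s \<longrightarrow> lookup q s = lookup (shift_deriv i j p) s))"

lemma infinitesimally_stableD:
  assumes "infinitesimally_stable n V" "p \<in> V" "is_largest_monom b p" "1 \<le> i" "i < j" "j \<le> n"
  obtains q where "q \<in> V" "\<And>s. mless b s \<Longrightarrow> lookup q s = lookup (shift_deriv i j p) s"
  using assms that unfolding infinitesimally_stable_def by blast

lemma keys_of_form: "p \<in> forms n d \<Longrightarrow> t \<in> keys p \<Longrightarrow> t \<in> monoms n d"
  by (auto simp: forms_def polys_def monoms_def)

lemma lead_monoms_subset: "V \<subseteq> forms n d \<Longrightarrow> lead_monoms V \<subseteq> monoms n d"
  by (auto simp: lead_monoms_def is_largest_monom_iff dest: keys_of_form)

text \<open>For a leading monomial t x_j, the derivative has at t x_i the leading coefficient times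
  a positive integer, nonzero in characteristic zero. A larger monomial r x_i of \<open>q\<close>
  would come from r x_j in \<open>p\<close>, above the leading monomial.\<close>

lemma strongly_stable_lead_monoms:
  fixes V :: "'a::field_char_0 mpoly set"
  assumes "V \<subseteq> forms n d" "infinitesimally_stable n V"
  shows "strongly_stable (lead_monoms V)"
  unfolding strongly_stable_def
proof (intro allI impI)
  fix t i j assume t: "t + unit_exp j \<in> lead_monoms V" and ij: "1 \<le> i" "i < j"
  let ?b = "t + unit_exp j"
  have "?b \<in> monoms n d" using t lead_monoms_subset[OF assms(1)] by blast
  then have "j \<le> n" by (simp add: monoms_def keys_add_monom)
  obtain p where p: "p \<in> V" "is_largest_monom ?b p" using t by (auto simp: lead_monoms_def)
  obtain q where q: "q \<in> V" "\<And>s. mless ?b s \<Longrightarrow> lookup q s = lookup (shift_deriv i j p) s"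
    using infinitesimally_stableD[OF assms(2) p ij \<open>j \<le> n\<close>] by blast
  have "mless ?b (t + unit_exp i)" using ij by (intro mless_add_unit_exp)
  then have "lookup q (t + unit_exp i) = of_nat (Suc (lookup t j)) * lookup p ?b"
    using q(2) ij by (simp add: lookup_shift_deriv del: of_nat_Suc)
  moreover have "lookup p ?b \<noteq> 0" using p(2) by (simp add: is_largest_monom_iff in_keys_iff)
  ultimately have "t + unit_exp i \<in> keys q" by (simp add: in_keys_iff del: of_nat_Suc)
  moreover have "mle s (t + unit_exp i)" if "s \<in> keys q" for s
  proof (rule ccontr)
    assume "\<not> mle s (t + unit_exp i)"
    then have gr: "mless (t + unit_exp i) s" by (simp add: ml.not_le)
    then have "mless ?b s" using \<open>mless ?b (t + unit_exp i)\<close> mless_trans by blast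
    then have D: "lookup (shift_deriv i j p) s \<noteq> 0" using q(2) that by (simp add: in_keys_iff)
    then have "i \<in> keys s" using lookup_shift_deriv_0 by blast
    then obtain r where r: "s = r + unit_exp i" by (rule divide_by_variable)
    have "lookup p (r + unit_exp j) \<noteq> 0" using D ij by (simp add: r lookup_shift_deriv del: of_nat_Suc)
    then have "r + unit_exp j \<in> keys p" by (simp add: in_keys_iff)
    then have "mle (r + unit_exp j) ?b" using p(2) unfolding is_largest_monom_iff by blast
    moreover have "mless t r" using gr by (simp add: r)
    ultimately show False by (simp add: ml.not_le)
  qed
  ultimately show "t + unit_exp i \<in> lead_monoms V"
    using q(1) by (auto simp: lead_monoms_def is_largest_monom_iff)
qed

subsection \<open>The initial ideal of the restricted ideal\<close>

text \<open>For \<open>p = p' x\<^sub>m + \<dots>\<close> modulo \<open>x\<^sub>m\<^sub>+\<^sub>1,\<dots>,x\<^sub>n\<close>, this is the part of \<open>p'\<close> without \<open>x\<^sub>m\<close>.\<close>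

definition linear_part :: "nat \<Rightarrow> nat \<Rightarrow> 'a::comm_ring_1 mpoly \<Rightarrow> 'a mpoly" where
  "linear_part m e p = (\<Sum>s\<in>monoms (m - 1) e. single s (lookup p (s + unit_exp m)))"

lemma lookup_linear_part:
  "lookup (linear_part m e p) s = (if s \<in> monoms (m - 1) e then lookup p (s + unit_exp m) else 0)"
proof -
  have "lookup (linear_part m e p) s
      = (\<Sum>t\<in>monoms (m - 1) e. if t = s then lookup p (s + unit_exp m) else 0)"
    unfolding linear_part_def lookup_sum by (intro sum.cong) (auto simp: lookup_single when_def)
  then show ?thesis by (simp add: finite_monoms)
qed

lemma largest_monom_linear_part:
  assumes "is_largest_monom (t + unit_exp m) p" "t \<in> monoms (m - 1) e"
  shows "is_largest_monom t (linear_part m e p)"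
proof -
  have "mle s t" if "s \<in> keys (linear_part m e p)" for s
  proof -
    have "s + unit_exp m \<in> keys p"
      using that by (auto simp: in_keys_iff lookup_linear_part split: if_splits)
    then have "mle (s + unit_exp m) (t + unit_exp m)" using assms(1) by (simp only: is_largest_monom_iff)
    then show ?thesis by simp
  qed
  moreover have "t \<in> keys (linear_part m e p)"
    using assms by (simp add: is_largest_monom_iff in_keys_iff lookup_linear_part)
  ultimately show ?thesis by (simp add: is_largest_monom_iff)
qed

text \<open>If some monomial of \<open>p\<close> survives the restriction, then by
  \<open>keys_of_larger\<close> the leading one does too, so taking leading monomials commutes with
  restriction.\<close>

lemma lead_monoms_restrict:
  assumes "V \<subseteq> forms n d" "1 \<le> m" "m \<le> n"
  shows "lead_monoms (restr {m..n} ` V) = {b \<in> lead_monoms V. keys b \<subseteq> {1..m-1}}"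
proof (intro subset_antisym subsetI)
  have in_monoms: "t \<in> monoms n d" if "p \<in> V" "t \<in> keys p" for p t
    using assms(1) that by (auto dest: keys_of_form)
  have small: "keys t \<subseteq> {1..m-1} \<longleftrightarrow> keys t \<inter> {m..n} = {}" if "t \<in> monoms n d" for t
  proof -
    have "{1..n} - {m..n} = {1..m-1}" using assms(2,3) by auto
    then show ?thesis using that by (auto simp: monoms_def)
  qed
  {
    fix b assume "b \<in> lead_monoms (restr {m..n} ` V)"
    then obtain p where p: "p \<in> V" "is_largest_monom b (restr {m..n} p)" by (auto simp: lead_monoms_def)
    have b: "b \<in> keys p" "keys b \<inter> {m..n} = {}" using p(2) by (auto simp: is_largest_monom_iff keys_restr)
    then have "p \<noteq> 0" by auto
    then obtain c where c: "is_largest_monom c p" by (rule largest_monom_exists)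
    then have "c \<in> keys p" "mle b c" using b by (auto simp: is_largest_monom_iff)
    moreover have "b \<in> monoms n d" "c \<in> monoms n d" using in_monoms p(1) b(1) \<open>c \<in> keys p\<close> by blast+
    moreover from this have "keys b \<subseteq> {1..m-1}" using small b by blast
    ultimately have "keys c \<subseteq> {1..m-1}" by (intro keys_of_larger[of b c]) (auto simp: monoms_def)
    then have "c \<in> keys (restr {m..n} p)"
      using small \<open>c \<in> keys p\<close> \<open>c \<in> monoms n d\<close> by (simp add: keys_restr)
    then have "mle c b" using p(2) by (simp only: is_largest_monom_iff)
    then have "c = b" using \<open>mle b c\<close> by (metis ml.order_antisym)
    then show "b \<in> {b \<in> lead_monoms V. keys b \<subseteq> {1..m-1}}"
      using c p(1) \<open>keys b \<subseteq> {1..m-1}\<close> by (auto simp: lead_monoms_def)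
  next
    fix b assume "b \<in> {b \<in> lead_monoms V. keys b \<subseteq> {1..m-1}}"
    then obtain p where p: "p \<in> V" "is_largest_monom b p" "keys b \<subseteq> {1..m-1}" by (auto simp: lead_monoms_def)
    then have "keys b \<inter> {m..n} = {}" using small in_monoms by (auto simp: is_largest_monom_iff)
    then have "is_largest_monom b (restr {m..n} p)" using p(2) by (simp add: is_largest_monom_iff keys_restr)
    then show "b \<in> lead_monoms (restr {m..n} ` V)" using p(1) by (auto simp: lead_monoms_def)
  }
qed

text \<open>Stability under \<open>x\<^sub>i \<partial>/\<partial>x\<^sub>m\<close> gives \<open>(V : x\<^sub>m)|\<^sub>x\<^sub>m \<cdot> x\<^sub>i \<subseteq> V|\<^sub>x\<^sub>m\<close>: for \<open>x\<^sub>m p' \<in> V\<close> the derivative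
  \<open>x\<^sub>i p' + x\<^sub>m x\<^sub>i \<partial>p'/\<partial>x\<^sub>m\<close> agrees with an element of \<open>V\<close> up to monomials below the leading
  monomial of \<open>x\<^sub>m p'\<close>, which in the reverse lexicographic order are all divisible by \<open>x\<^sub>m\<close>.\<close>

lemma linear_part_times_variable:
  fixes V :: "'a::field mpoly set"
  assumes "V \<subseteq> forms n d" "infinitesimally_stable n V" "m \<le> n"
    and p: "p \<in> V" "is_largest_monom (t + unit_exp m) p" and t: "t \<in> monoms (m - 1) e"
    and i: "i \<in> {1..m-1}"
  shows "monomial (unit_exp i) * linear_part m e p \<in> restr {m..n} ` V"
proof -
  have im: "1 \<le> i" "i < m" "i \<noteq> m" using i by auto
  obtain q where q: "q \<in> V" "\<And>s. mless (t + unit_exp m) s \<Longrightarrow> lookup q s = lookup (shift_deriv i m p) s"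
    using infinitesimally_stableD[OF assms(2) p im(1,2) assms(3)] by blast
  have "t + unit_exp m \<in> keys p" using p(2) by (simp add: is_largest_monom_iff)
  then have "t + unit_exp m \<in> monoms n d"
    using p(1) assms(1) by (auto dest: keys_of_form)
  then have d: "d = Suc e" using t by (simp add: monoms_def)
  have "lookup (restr {m..n} q) s = lookup (monomial (unit_exp i) * linear_part m e p) s" for s
  \<comment> \<open>Outside \<open>monoms (m - 1) d\<close> both coefficients are zero; inside, the
    monomial is free of x_m and hence above the leading monomial of \<open>p\<close>.\<close>
  proof (cases "s \<in> monoms (m - 1) d")
    case False
    have "lookup (restr {m..n} q) s = 0"
    proof (cases "s \<in> keys q")
      case True
      then have sn: "s \<in> monoms n d"
        using q(1) assms(1) by (auto dest: keys_of_form)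
      have "keys s \<inter> {m..n} \<noteq> {}"
      proof
        assume "keys s \<inter> {m..n} = {}"
        moreover have "{1..n} - {m..n} \<subseteq> {1..m-1}" by auto
        ultimately have "keys s \<subseteq> {1..m-1}" using sn by (auto simp: monoms_def)
        then show False using False sn by (simp add: monoms_def)
      qed
      then show ?thesis by (simp add: lookup_restr)
    qed (simp add: lookup_restr in_keys_iff)
    moreover have "lookup (monomial (unit_exp i) * linear_part m e p) s = 0"
    proof (rule ccontr)
      assume "lookup (monomial (unit_exp i) * linear_part m e p) s \<noteq> 0"
      then have "s \<in> keys (monomial (unit_exp i) * linear_part m e p)" by (simp add: in_keys_iff)
      then obtain r where r: "s = unit_exp i + r" "r \<in> keys (linear_part m e p)"
        by (auto simp: keys_monomial_mult)
      then have "r \<in> monoms (m - 1) e" by (auto simp: in_keys_iff lookup_linear_part split: if_splits)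
      then have "s \<in> monoms (m - 1) d" using i by (auto simp: r d monoms_def keys_add_monom)
      then show False using False by blast
    qed
    ultimately show ?thesis by simp
  next
    case True
    have "m \<notin> {1..m-1}" using i by auto
    then have m: "m \<notin> keys s" using True by (auto simp: monoms_def)
    have "keys s \<inter> {m..n} = {}" using True by (fastforce simp: monoms_def)
    then have 1: "lookup (restr {m..n} q) s = lookup q s" by (simp add: lookup_restr)
    have "{1..m-1} \<subseteq> {1..m}" by auto
    then have "keys s \<subseteq> {1..m}" "keys t \<subseteq> {1..m}" using True t unfolding monoms_def by blast+
    moreover have "mdeg s = Suc (mdeg t)" using True t by (simp add: monoms_def d)
    ultimately have "\<not> mle s (t + unit_exp m)" using smaller_involves_last[of s t m] m by blast
    then have 2: "lookup q s = lookup (shift_deriv i m p) s" using q(2) by (simp add: ml.not_le)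
    show ?thesis
    proof (cases "i \<in> keys s")
      case False
      then have "\<And>r. s \<noteq> unit_exp i + r" by (auto simp: keys_add_monom)
      then show ?thesis using 1 2 False by (simp add: lookup_shift_deriv_0 lookup_monomial_mult_not)
    next
      case i': True
      then obtain r where r: "s = r + unit_exp i" by (rule divide_by_variable)
      \<comment> \<open>The factor \<open>Suc (lookup r m)\<close> from the derivative is therefore
        1.\<close>
      have "lookup r m = 0" using m by (simp add: r keys_add_monom in_keys_iff)
      moreover have "r \<in> monoms (m - 1) e" using True by (auto simp: r d monoms_def keys_add_monom)
      ultimately have "lookup (monomial (unit_exp i) * linear_part m e p) s = lookup p (r + unit_exp m)"
        unfolding r add.commute[of r "unit_exp i"] lookup_monomial_mult lookup_linear_part by simp
      moreover have "lookup (shift_deriv i m p) s = lookup p (r + unit_exp m)"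
        using lookup_shift_deriv[OF im(3), of p r] \<open>lookup r m = 0\<close> by (simp add: r)
      ultimately show ?thesis using 1 2 by simp
    qed
  qed
  then have "restr {m..n} q = monomial (unit_exp i) * linear_part m e p" by (rule poly_mapping_eqI)
  then show ?thesis using q(1) by (metis imageI)
qed

text \<open>The hypothesis splits off some variable x_i, but separation needs the last variable x_M
  of \<open>b\<close>. If they differ, x_M divides \<open>s\<close>; strong stability replaces it
  there by x_i, and x_M is split off instead.\<close>

lemma separated_factorization:
  assumes "strongly_stable B" "B \<subseteq> monoms n d" "generated_below m {b \<in> B. keys b \<subseteq> {1..m}}"
    and b: "b \<in> B" "keys b \<subseteq> {1..m-1}" and m: "1 \<le> m"
  obtains s j where "b = unit_exp j + s" "s + unit_exp m \<in> B" "keys s \<subseteq> {1..m-1}" "j \<in> {1..m-1}"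
    "separated s (unit_exp j)"
proof -
  have "m \<notin> {1..m-1}" using m by auto
  then have "m \<notin> keys b" using b by blast
  moreover have "{1..m-1} \<subseteq> {1..m}" by auto
  ultimately obtain s i where si: "b = s + unit_exp i" "s + unit_exp m \<in> B"
    using assms(3) b unfolding generated_below_def by blast
  define M where "M = Max (keys b)"
  have ne: "keys b \<noteq> {}" by (simp add: si(1) keys_add_monom)
  have M: "M \<in> keys b" "\<And>k. k \<in> keys b \<Longrightarrow> k \<le> M" using ne by (auto simp: M_def)
  show ?thesis
  proof (cases "i = M")
    case True
    show ?thesis
    proof (rule that[of M s])
      show "b = unit_exp M + s" by (simp add: si(1) True add.commute)
      show "separated s (unit_exp M)" using M(2) by (auto simp: separated_def si(1) keys_add_monom)
      show "M \<in> {1..m-1}" using M(1) b(2) by blast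
      show "keys s \<subseteq> {1..m-1}" using b(2) by (simp add: si(1) keys_add_monom)
    qed (rule si(2))
  next
    case False
    then have "i < M" using M(2)[of i] by (simp add: si(1) keys_add_monom)
    have "M \<in> keys s" using M(1) False by (simp add: si(1) keys_add_monom)
    then obtain r where r: "s = r + unit_exp M" by (rule divide_by_variable)
    have i: "i \<in> {1..m-1}" using b(2) by (simp add: si(1) keys_add_monom)
    show ?thesis
    proof (rule that[of M "r + unit_exp i"])
      show "b = unit_exp M + (r + unit_exp i)" by (simp only: si(1) r ac_simps)
      show "separated (r + unit_exp i) (unit_exp M)"
        using M(2) by (auto simp: separated_def si(1) r keys_add_monom)
      show "M \<in> {1..m-1}" using M(1) b(2) by blast
      show "keys (r + unit_exp i) \<subseteq> {1..m-1}" using b(2) by (simp add: si(1) r keys_add_monom)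
      have "(r + unit_exp m) + unit_exp M \<in> B" using si(2) by (simp only: r ac_simps)
      then have "(r + unit_exp m) + unit_exp i \<in> B"
        using i \<open>i < M\<close> by (auto intro: strongly_stableD[OF assms(1) \<open>(r + unit_exp m) + unit_exp M \<in> B\<close>])
      then show "(r + unit_exp i) + unit_exp m \<in> B" by (simp only: ac_simps)
    qed
  qed
qed

lemma restrict_ideal_gen:
  fixes V :: "'a::field mpoly set"
  assumes "1 \<le> m" "m \<le> n"
  shows "restr {m..n} ` ideal_gen n V
    = lin.span {monomial u * v | u v. keys u \<subseteq> {1..m-1} \<and> v \<in> restr {m..n} ` V}" (is "?L = ?R")
proof
  have rm: "restr {m..n} (monomial u) = (if keys u \<inter> {m..n} = {} then monomial u else 0 :: 'a mpoly)" for u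
    by (rule poly_mapping_eqI) (auto simp: lookup_restr monomial_def lookup_single when_def)
  have small: "keys u \<subseteq> {1..m-1} \<longleftrightarrow> keys u \<inter> {m..n} = {}" if "keys u \<subseteq> {1..n}" for u :: monom
  proof -
    have "{1..n} - {m..n} = {1..m-1}" using assms by auto
    then show ?thesis using that by auto
  qed
  show "?L \<subseteq> ?R"
  proof
    fix f assume "f \<in> ?L"
    then obtain g where g: "g \<in> ideal_gen n V" "f = restr {m..n} g" by blast
    have "restr {m..n} g \<in> ?R"
      using g(1) unfolding ideal_gen_span
    proof (induction rule: lin.span_induct_alt)
      case base
      then show ?case using lin.span_zero by (simp add: restr_zero)
    next
      case (step c x y)
      then obtain u v where x: "x = monomial u * v" "keys u \<subseteq> {1..n}" "v \<in> V" by blast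
      have "restr {m..n} x \<in> ?R"
      proof (cases "keys u \<inter> {m..n} = {}")
        case True
        then have "restr {m..n} x = monomial u * restr {m..n} v" by (simp add: x restr_mult rm)
        then show ?thesis using x True small[OF x(2)] by (intro lin.span_base) auto
      next
        case False
        then have "restr {m..n} x = 0" by (simp add: x restr_mult rm)
        then show ?thesis using lin.span_zero by simp
      qed
      then show ?case
        using step by (simp add: restr_add restr_const_mult) (intro lin.span_add lin.span_scale)
    qed
    then show "f \<in> ?R" by (simp add: g)
  qed
  show "?R \<subseteq> ?L"
  proof (rule lin.span_minimal)
    show "lin.subspace ?L" unfolding restr_def by (intro subspace_eval_image subspace_ideal_gen)
    show "{monomial u * v | u v. keys u \<subseteq> {1..m-1} \<and> v \<in> restr {m..n} ` V} \<subseteq> ?L"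
    proof
      fix f assume "f \<in> {monomial u * v | u v. keys u \<subseteq> {1..m-1} \<and> v \<in> restr {m..n} ` V}"
      then obtain u p where f: "f = monomial u * restr {m..n} p" "keys u \<subseteq> {1..m-1}" "p \<in> V" by blast
      have "{1..m-1} \<subseteq> {1..n}" using assms by auto
      then have un: "keys u \<subseteq> {1..n}" using f(2) by blast
      then have "f = restr {m..n} (monomial u * p)" using f(2) small by (simp add: f(1) restr_mult rm)
      moreover have "monomial u * p \<in> ideal_gen n V"
        using un f(3) ideal_gen_base[of V n] by (intro ideal_gen_mult) auto
      ultimately show "f \<in> ?L" by blast
    qed
  qed
qed

text \<open>The hard inclusion shows that the restricted ideal lies in the span of separated
  products v w_s with nontrivial v. Their leading monomials are distinct, so every leading monomial
  of the ideal is some v s, and one variable of v already carries s into the degree \<open>d\<close>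
  part.\<close>

lemma lead_monoms_restricted_ideal:
  fixes V :: "'a::field_char_0 mpoly set"
  assumes V: "lin.subspace V" "V \<subseteq> forms n d" "infinitesimally_stable n V" and m: "1 \<le> m" "m \<le> n"
    and gen: "generated_below m {b \<in> lead_monoms V. keys b \<subseteq> {1..m}}"
  shows "lead_monoms (restr {m..n} ` ideal_gen n V) = up (m - 1) {b \<in> lead_monoms V. keys b \<subseteq> {1..m-1}}"
proof
  let ?B = "lead_monoms V" and ?W = "restr {m..n} ` V"
  let ?B' = "{b \<in> ?B. keys b \<subseteq> {1..m-1}}"
  have st: "strongly_stable ?B" using V by (intro strongly_stable_lead_monoms)
  have Bn: "?B \<subseteq> monoms n d" using V(2) by (rule lead_monoms_subset)
  have leadW: "lead_monoms ?W = ?B'" using V(2) m by (rule lead_monoms_restrict)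
  note ideal = restrict_ideal_gen[OF m, of V]
  show "up (m - 1) ?B' \<subseteq> lead_monoms (restr {m..n} ` ideal_gen n V)"
  proof
    fix c assume "c \<in> up (m - 1) ?B'"
    then obtain u b where c: "c = u + b" "keys u \<subseteq> {1..m-1}" "b \<in> lead_monoms ?W"
      unfolding leadW up_def by blast
    then obtain v where v: "v \<in> ?W" "is_largest_monom b v" by (auto simp: lead_monoms_def)
    have "monomial u * v \<in> restr {m..n} ` ideal_gen n V"
      unfolding ideal using c v by (intro lin.span_base) blast
    moreover have "is_largest_monom c (monomial u * v)" unfolding c(1) using v(2) by (rule largest_monom_mult)
    ultimately show "c \<in> lead_monoms (restr {m..n} ` ideal_gen n V)" unfolding lead_monoms_def by blast
  qed
  show "lead_monoms (restr {m..n} ` ideal_gen n V) \<subseteq> up (m - 1) ?B'"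
  proof
    fix c assume "c \<in> lead_monoms (restr {m..n} ` ideal_gen n V)"
    then obtain f where f: "f \<in> lin.span {monomial u * v | u v. keys u \<subseteq> {1..m-1} \<and> v \<in> ?W}"
      "is_largest_monom c f"
      unfolding lead_monoms_def ideal by blast
    \<comment> \<open>For d = 0 the subtraction is truncated, but then \<open>A\<close> is empty;
      any element of \<open>A\<close> gives \<open>d = Suc e\<close>.\<close>
    define e where "e = d - 1"
    \<comment> \<open>The leading monomials of the quotients by x_m, of degree d - 1.\<close>
    define A where "A = {s. s + unit_exp m \<in> ?B \<and> keys s \<subseteq> {1..m-1}}"
    have deg: "d = Suc e" if "s \<in> A" for s
      using that Bn by (auto simp: A_def monoms_def e_def)
    have A: "A \<subseteq> monoms (m - 1) e"
      using deg Bn by (fastforce simp: A_def monoms_def)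
    define P where "P = (\<lambda>t. SOME p. p \<in> V \<and> is_largest_monom (t + unit_exp m) p)"
    have P: "P t \<in> V" "is_largest_monom (t + unit_exp m) (P t)" if "t \<in> A" for t
    proof -
      have "\<exists>p. p \<in> V \<and> is_largest_monom (t + unit_exp m) p" using that by (auto simp: A_def lead_monoms_def)
      then have "P t \<in> V \<and> is_largest_monom (t + unit_exp m) (P t)" unfolding P_def by (rule someI_ex)
      then show "P t \<in> V" "is_largest_monom (t + unit_exp m) (P t)" by auto
    qed
    define w where "w = (\<lambda>t. linear_part m e (P t))"
    have lead_w: "is_largest_monom t (w t)" if "t \<in> A" for t
      unfolding w_def using P(2)[OF that] that A by (intro largest_monom_linear_part) auto
    have xw: "monomial (unit_exp i) * w t \<in> ?W" if "t \<in> A" "i \<in> {1..m-1}" for t i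
      unfolding w_def using V m P that A by (intro linear_part_times_variable) auto
    have W: "lin.subspace ?W"
      unfolding restr_def by (intro subspace_eval_image V)
    have Wn: "?W \<subseteq> forms n d"
    proof
      fix q assume "q \<in> ?W"
      then obtain p where "p \<in> forms n d" "q = restr {m..n} p" using V(2) by blast
      then show "q \<in> forms n d"
        by (auto simp: forms_eq_monom_space monom_space_def keys_restr)
    qed
    \<comment> \<open>A triangular basis of the restricted space made of separated products with a
      single variable as multiplier.\<close>
    define h where "h = (\<lambda>b. SOME p. \<exists>s j. p = monomial (unit_exp j) * w s \<and> b = unit_exp j + s
      \<and> s \<in> A \<and> j \<in> {1..m-1} \<and> separated s (unit_exp j))"
    have h: "\<exists>s j. h b = monomial (unit_exp j) * w s \<and> b = unit_exp j + s
      \<and> s \<in> A \<and> j \<in> {1..m-1} \<and> separated s (unit_exp j)" if "b \<in> ?B'" for b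
    proof -
      have "b \<in> ?B" "keys b \<subseteq> {1..m-1}" using that by auto
      from separated_factorization[OF st Bn gen this m(1)]
      obtain s j where "b = unit_exp j + s" "s \<in> A" "j \<in> {1..m-1}" "separated s (unit_exp j)"
        unfolding A_def by blast
      then have "\<exists>p s j. p = monomial (unit_exp j) * w s \<and> b = unit_exp j + s
        \<and> s \<in> A \<and> j \<in> {1..m-1} \<and> separated s (unit_exp j)" by blast
      then show ?thesis unfolding h_def by (rule someI_ex)
    qed
    have hW: "h b \<in> ?W \<and> is_largest_monom b (h b)" if b: "b \<in> lead_monoms ?W" for b
    proof -
      obtain s j where sj: "h b = monomial (unit_exp j) * w s" "b = unit_exp j + s" "s \<in> A" "j \<in> {1..m-1}"
        using h[of b] b unfolding leadW by blast
      show ?thesis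
        using xw[OF sj(3,4)] largest_monom_mult[OF lead_w[OF sj(3)], of "unit_exp j"] sj(1,2) by simp
    qed
    have W_span: "v \<in> lin.span (separated_products (m - 1) A w 1 b)" if "v \<in> ?W" "is_largest_monom b v" for v b
    proof -
      have "{h c | c. c \<in> lead_monoms ?W \<and> mle c b} \<subseteq> separated_products (m - 1) A w 1 b"
      proof
        fix g assume "g \<in> {h c | c. c \<in> lead_monoms ?W \<and> mle c b}"
        then obtain a where a: "g = h a" "a \<in> ?B'" "mle a b" unfolding leadW by blast
        obtain s j where sj: "h a = monomial (unit_exp j) * w s" "a = unit_exp j + s"
          "s \<in> A" "j \<in> {1..m-1}" "separated s (unit_exp j)" using h[OF a(2)] by blast
        have "unit_exp j \<in> monoms (m - 1) 1" using sj(4) by (simp add: monoms_def)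
        then show "g \<in> separated_products (m - 1) A w 1 b"
          using a sj unfolding separated_products_def by blast
      qed
      moreover have "v \<in> lin.span {h c | c. c \<in> lead_monoms ?W \<and> mle c b}"
        using triangular_span[OF W Wn hW that] .
      ultimately show ?thesis using lin.span_mono by blast
    qed
    \<comment> \<open>These are the linear syzygies: x_i w_t lies in the restricted space, so it can
      be rewritten by separated products without raising the leading monomial.\<close>
    have lin: "monomial (unit_exp i) * w t \<in> lin.span (separated_products (m - 1) A w 1 (unit_exp i + t))"
      if "t \<in> A" "i \<in> {1..m-1}" for t i
      using xw[OF that] largest_monom_mult[OF lead_w[OF that(1)]] by (rule W_span)
    \<comment> \<open>The multiplier 1 is excluded, since w_s itself has degree d - 1, too low for
      the ideal.\<close>
    define S where "S = {monomial v * w s | v s. s \<in> A \<and> keys v \<subseteq> {1..m-1} \<and> v \<noteq> 0 \<and> separated s v}"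
    have products: "monomial u * v \<in> lin.span S" if u: "keys u \<subseteq> {1..m-1}" and v: "v \<in> ?W" for u v
    proof (cases "v = 0")
      case True
      then show ?thesis using lin.span_zero by simp
    next
      case False
      then obtain b where "is_largest_monom b v" by (rule largest_monom_exists)
      then have "v \<in> lin.span (separated_products (m - 1) A w 1 b)" by (rule W_span[OF v])
      then show ?thesis
      proof (induction rule: lin.span_induct_alt)
        case base
        then show ?case using lin.span_zero by simp
      next
        case (step c x y)
        then obtain v s where x: "x = monomial v * w s" "s \<in> A" "v \<in> monoms (m - 1) 1"
          unfolding separated_products_def by blast
        have "u \<in> monoms (m - 1) (mdeg u)" using u by (simp add: monoms_def)
        then have uv: "u + v \<in> monoms (m - 1) (mdeg u + 1)" using x(3) by (rule monoms_add)
        have "monomial (u + v) * w s \<in> lin.span (separated_products (m - 1) A w (mdeg u + 1) ((u + v) + s))"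
          using span_separated_products[OF A lin x(2) uv] .
        moreover have "separated_products (m - 1) A w (mdeg u + 1) ((u + v) + s) \<subseteq> S"
        proof
          fix g assume "g \<in> separated_products (m - 1) A w (mdeg u + 1) ((u + v) + s)"
          then obtain a b where ab: "g = monomial a * w b" "b \<in> A" "a \<in> monoms (m - 1) (mdeg u + 1)" "separated b a"
            unfolding separated_products_def by blast
          then have "keys a \<subseteq> {1..m-1}" "a \<noteq> 0" by (auto simp: monoms_def)
          then show "g \<in> S" using ab unfolding S_def by blast
        qed
        ultimately have "monomial (u + v) * w s \<in> lin.span S" using lin.span_mono by blast
        then have "monomial u * x \<in> lin.span S" by (simp only: x(1) monomial_add mult.assoc)
        then have "const c * (monomial u * x) + monomial u * y \<in> lin.span S"
          using step by (intro lin.span_add lin.span_scale)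
        then show ?case by (simp add: algebra_simps)
      qed
    qed
    have "lin.span {monomial u * v | u v. keys u \<subseteq> {1..m-1} \<and> v \<in> ?W} \<subseteq> lin.span S"
      using products by (intro lin.span_minimal lin.subspace_span) blast
    then have "f \<in> lin.span S" using f(1) by blast
    define l where "l = (\<lambda>g :: 'a mpoly. SOME t. is_largest_monom t g)"
    have lS: "l (monomial v * w s) = v + s" "is_largest_monom (v + s) (monomial v * w s)" if "s \<in> A" for v s
    proof -
      show 1: "is_largest_monom (v + s) (monomial v * w s)" by (rule largest_monom_mult[OF lead_w[OF that]])
      then have "is_largest_monom (l (monomial v * w s)) (monomial v * w s)" unfolding l_def by (rule someI)
      then show "l (monomial v * w s) = v + s" using 1 by (rule largest_monom_unique)
    qed
    have "is_largest_monom (l g) g" if "g \<in> S" for g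
      using that lS by (auto simp: S_def)
    moreover have "inj_on l S"
    proof (rule inj_onI)
      fix g g' assume "g \<in> S" "g' \<in> S" and eq: "l g = l g'"
      then obtain v s v' s' where g: "g = monomial v * w s" "s \<in> A" "separated s v"
        "g' = monomial v' * w s'" "s' \<in> A" "separated s' v'" unfolding S_def by blast
      have "v + s = v' + s'" using eq lS(1)[OF g(2), of v] lS(1)[OF g(5), of v'] by (simp only: g)
      moreover have "s \<in> monoms (m - 1) e" "s' \<in> monoms (m - 1) e" using g A by blast+
      then have "mdeg s = mdeg s'" by (simp add: monoms_def)
      ultimately have "s = s'" by (rule separated_unique[OF g(3,6)])
      then show "g = g'" using \<open>v + s = v' + s'\<close> g by simp
    qed
    ultimately obtain g where "g \<in> S" "l g = c"
      using largest_monom_span[OF \<open>f \<in> lin.span S\<close> f(2), of l] by blast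
    then obtain v s where vs: "g = monomial v * w s" "s \<in> A" "keys v \<subseteq> {1..m-1}" "v \<noteq> 0"
      unfolding S_def by blast
    then have c: "c = v + s" "s \<in> A" "keys v \<subseteq> {1..m-1}" "v \<noteq> 0"
      using lS(1)[OF vs(2), of v] \<open>l g = c\<close> by simp_all
    then have "keys v \<noteq> {}" by simp
    then obtain j where j: "j \<in> keys v" by blast
    then obtain v' where v': "v = v' + unit_exp j" by (rule divide_by_variable)
    have "j \<in> {1..m-1}" using j c(3) by blast
    \<comment> \<open>By strong stability s x_m in \<open>?B\<close> gives s x_j in
      \<open>?B\<close>, and the rest of v is a multiplier.\<close>
    then have "s + unit_exp j \<in> ?B"
      using c(2) by (auto simp: A_def intro: strongly_stableD[OF st, of s m j])
    moreover have "keys (s + unit_exp j) \<subseteq> {1..m-1}"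
      using \<open>j \<in> {1..m-1}\<close> c(2) by (auto simp: A_def keys_add_monom)
    moreover have "c = v' + (s + unit_exp j)" by (simp only: c(1) v' ac_simps)
    moreover have "keys v' \<subseteq> {1..m-1}" using c(3) by (simp add: v' keys_add_monom)
    ultimately show "c \<in> up (m - 1) ?B'" unfolding up_def by blast
  qed
qed

lemma up_up: "up m (up m B) = up m B"
proof
  show "up m (up m B) \<subseteq> up m B"
  proof
    fix c assume "c \<in> up m (up m B)"
    then obtain u v b where c: "c = u + (v + b)" "keys u \<subseteq> {1..m}" "keys v \<subseteq> {1..m}" "b \<in> B"
      unfolding up_def by blast
    then have "c = (u + v) + b" "keys (u + v) \<subseteq> {1..m}" by (simp_all add: keys_add_monom add.assoc)
    then show "c \<in> up m B" using c(4) unfolding up_def by blast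
  qed
qed (use up_base in blast)

lemma initial_restricted_ideal:
  fixes V :: "'a::field_char_0 mpoly set"
  assumes V: "lin.subspace V" "V \<subseteq> forms n d" "infinitesimally_stable n V" and m: "1 \<le> m" "m \<le> n"
    and gen: "generated_below m {b \<in> lead_monoms V. keys b \<subseteq> {1..m}}"
  shows "agree_from (m - 1) d (in_ideal (m - 1) (restrict_space {m..n} (ideal_gen n V)))
    (J_ideal m d (monom_space {b \<in> lead_monoms V. keys b \<subseteq> {1..m}}))"
proof -
  let ?B = "{b \<in> lead_monoms V. keys b \<subseteq> {1..m}}" and ?B' = "{b \<in> lead_monoms V. keys b \<subseteq> {1..m-1}}"
  have "keys t \<subseteq> {1..m} \<and> m \<notin> keys t \<longleftrightarrow> keys t \<subseteq> {1..m-1}" for t :: monom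
  proof -
    have "{1..m} - {m} = {1..m-1}" by auto
    then show ?thesis by blast
  qed
  then have B': "{t \<in> ?B. m \<notin> keys t} = ?B'" by blast
  have B: "?B \<subseteq> monoms m d" using lead_monoms_subset[OF V(2)] by (auto simp: monoms_def)
  have "up (m - 1) ?B' \<inter> monoms (m - 1) e = J_set m d ?B \<inter> monoms (m - 1) e" if "d \<le> e" for e
    using J_set_degree_above[OF B _ m(1)] that unfolding B' by (auto simp: monoms_def)
  then show ?thesis
    unfolding agree_from_def in_ideal_alt restrict_space_alt lead_monoms_restricted_ideal[OF assms]
      J_ideal_monom_space forms_eq_monom_space monom_space_Int up_up by simp
qed

subsection \<open>Algebras of functions\<close>

text \<open>Finite sums of a scalar function times a fixed polynomial. The fixed polynomials bound
  the support independently of the parameter, so closure properties follow by plain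
  induction.\<close>

inductive poly_family :: "(('g \<Rightarrow> 'a::comm_ring_1) \<Rightarrow> bool) \<Rightarrow> ('g \<Rightarrow> 'a mpoly) \<Rightarrow> bool" for P where
  scale: "P f \<Longrightarrow> poly_family P (\<lambda>g. const (f g) * b)"
| add: "poly_family P h \<Longrightarrow> poly_family P h' \<Longrightarrow> poly_family P (\<lambda>g. h g + h' g)"

text \<open>Used for polynomial functions of eps and for polynomial functions of matrix
  entries.\<close>

locale function_algebra =
  fixes P :: "('g \<Rightarrow> 'a::comm_ring_1) \<Rightarrow> bool"
  assumes P_const: "P (\<lambda>_. c)"
    and P_add: "P f \<Longrightarrow> P f' \<Longrightarrow> P (\<lambda>g. f g + f' g)"
    and P_mult: "P f \<Longrightarrow> P f' \<Longrightarrow> P (\<lambda>g. f g * f' g)"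
begin

lemma P_sum: "(\<And>x. x \<in> A \<Longrightarrow> P (f x)) \<Longrightarrow> P (\<lambda>g. \<Sum>x\<in>A. f x g)"
  by (induction A rule: infinite_finite_induct) (auto intro: P_const P_add)

lemma P_prod: "(\<And>x. x \<in> A \<Longrightarrow> P (f x)) \<Longrightarrow> P (\<lambda>g. \<Prod>x\<in>A. f x g)"
  by (induction A rule: infinite_finite_induct) (auto intro: P_const P_mult)

lemma P_power: "P f \<Longrightarrow> P (\<lambda>g. f g ^ k)"
  by (induction k) (auto intro: P_const P_mult)

lemma P_det:
  assumes "\<And>i j. i < r \<Longrightarrow> j < r \<Longrightarrow> P (E i j)"
  shows "P (\<lambda>g. det (mat r r (\<lambda>(i, j). E i j g)))"
proof -
  have less: "p i < r" if "p permutes {0..<r}" "i < r" for p i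
    using permutes_in_image[OF that(1), of i] that(2) by simp
  have "det (mat r r (\<lambda>(i, j). E i j g))
      = (\<Sum>p\<in>{p. p permutes {0..<r}}. signof p * (\<Prod>i=0..<r. E i (p i) g))" for g
    by (subst det_def'[of _ r]) (auto intro!: sum.cong prod.cong simp: less)
  moreover have "P (\<lambda>g. \<Sum>p\<in>{p. p permutes {0..<r}}. signof p * (\<Prod>i=0..<r. E i (p i) g))"
    by (intro P_sum P_mult P_const P_prod assms) (auto simp: less)
  ultimately show ?thesis by simp
qed

lemma family_lookup: "poly_family P h \<Longrightarrow> P (\<lambda>g. lookup (h g) s)"
proof (induction rule: poly_family.induct)
  case (scale f b)
  then show ?case using P_mult[OF scale P_const[of "lookup b s"]] by simp
next
  case (add h h')
  then show ?case by (simp add: lookup_add P_add)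
qed

lemma family_const: "poly_family P (\<lambda>_. b)"
  using poly_family.scale[of P "\<lambda>_. 1" b] P_const by simp

lemma family_scale:
  assumes "P f" "poly_family P h"
  shows "poly_family P (\<lambda>g. const (f g) * h g)"
  using assms(2)
proof (induction rule: poly_family.induct)
  case (scale f' b)
  then show ?case using poly_family.scale[of P "\<lambda>g. f g * f' g" b] P_mult[OF assms(1)]
    by (simp add: const_mult mult.assoc)
next
  case (add h h')
  then show ?case by (simp add: distrib_left poly_family.add)
qed

lemma family_mult_fixed:
  assumes "poly_family P h"
  shows "poly_family P (\<lambda>g. b * h g)"
  using assms
proof (induction rule: poly_family.induct)
  case (scale f c)
  then show ?case using poly_family.scale[of P f "b * c"] by (simp add: mult.left_commute)
next
  case (add h h')
  then show ?case by (simp add: distrib_left poly_family.add)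
qed

lemma family_mult:
  assumes "poly_family P h" "poly_family P h'"
  shows "poly_family P (\<lambda>g. h g * h' g)"
  using assms(1)
proof (induction rule: poly_family.induct)
  case (scale f b)
  then show ?case using family_scale[OF scale family_mult_fixed[OF assms(2), of b]] by (simp add: mult.assoc)
next
  case (add k k')
  then show ?case by (simp add: distrib_right poly_family.add)
qed

lemma family_sum: "(\<And>x. x \<in> A \<Longrightarrow> poly_family P (h x)) \<Longrightarrow> poly_family P (\<lambda>g. \<Sum>x\<in>A. h x g)"
  by (induction A rule: infinite_finite_induct) (auto intro: family_const poly_family.add)

lemma family_prod: "(\<And>x. x \<in> A \<Longrightarrow> poly_family P (h x)) \<Longrightarrow> poly_family P (\<lambda>g. \<Prod>x\<in>A. h x g)"
  by (induction A rule: infinite_finite_induct) (auto intro: family_const family_mult)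

lemma family_power: "poly_family P h \<Longrightarrow> poly_family P (\<lambda>g. h g ^ k)"
  by (induction k) (auto intro: family_const family_mult)

lemma family_eval:
  assumes "\<And>t i. t \<in> keys p \<Longrightarrow> i \<in> keys t \<Longrightarrow> poly_family P (\<lambda>g. \<sigma> g i)"
  shows "poly_family P (\<lambda>g. eval_at const (\<sigma> g) p)"
  unfolding eval_at_def using assms
  by (intro family_sum family_mult_fixed family_prod family_power)

end

definition univariate :: "('a::comm_ring_1 \<Rightarrow> 'a) \<Rightarrow> bool" where
  "univariate f \<longleftrightarrow> (\<exists>q. \<forall>x. f x = poly q x)"

global_interpretation uni: function_algebra univariate
proof
  show "univariate (\<lambda>_. c)" for c :: 'a
    unfolding univariate_def by (rule exI[of _ "[:c:]"]) simp
  fix f f' :: "'a \<Rightarrow> 'a" assume "univariate f" "univariate f'"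
  then obtain q q' where q: "\<forall>x. f x = poly q x" "\<forall>x. f' x = poly q' x" unfolding univariate_def by blast
  show "univariate (\<lambda>x. f x + f' x)"
    unfolding univariate_def using q by (intro exI[of _ "q + q'"]) simp
  show "univariate (\<lambda>x. f x * f' x)"
    unfolding univariate_def using q by (intro exI[of _ "q * q'"]) simp
qed

lemma univariate_id: "univariate (\<lambda>x. x)"
  unfolding univariate_def by (rule exI[of _ "[:0, 1:]"]) simp

lemma univariate_finite_zeros:
  assumes "univariate (f :: 'a::field_char_0 \<Rightarrow> 'a)" "f x\<^sub>0 \<noteq> 0"
  shows "finite {x. f x = 0}"
proof -
  obtain q where q: "\<forall>x. f x = poly q x" using assms(1) unfolding univariate_def by blast
  then have "q \<noteq> 0" using assms(2) by auto
  then show ?thesis using poly_roots_finite[of q] q by simp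
qed

text \<open>The algebraic substitute for letting eps tend to 0: a polynomial nonzero at 0 would have
  infinitely many roots.\<close>

lemma univariate_zero:
  assumes "univariate (f :: 'a::field_char_0 \<Rightarrow> 'a)" "\<And>x. x \<noteq> 0 \<Longrightarrow> f x = 0"
  shows "f 0 = 0"
proof (rule ccontr)
  assume "f 0 \<noteq> 0"
  then have "finite {x. f x = 0}" by (rule univariate_finite_zeros[OF assms(1)])
  moreover have "UNIV = insert 0 {x. f x = 0}" using assms(2) by auto
  ultimately have "finite (UNIV :: 'a set)" by (metis finite_insert)
  then show False using infinite_UNIV_char_0 by blast
qed

subsection \<open>Polynomial functions on matrices\<close>

definition matrix_poly :: "nat \<Rightarrow> ('a::field mat \<Rightarrow> 'a) \<Rightarrow> bool" where
  "matrix_poly n f \<longleftrightarrow> (\<exists>F. (\<forall>t\<in>keys F. keys t \<subseteq> {..<n} \<times> {..<n}) \<and>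
     (\<forall>g. f g = eval_at id (\<lambda>ij. g $$ ij) F))"

global_interpretation evid: eval_hom "id :: 'a::comm_ring_1 \<Rightarrow> 'a" \<sigma> for \<sigma>
  by unfold_locales simp_all

global_interpretation mp: function_algebra "matrix_poly n" for n
proof
  show "matrix_poly n (\<lambda>_. c)" for c :: 'a
    unfolding matrix_poly_def by (rule exI[of _ "single 0 c"]) (simp add: evid.eval_single)
  fix f f' :: "'a mat \<Rightarrow> 'a" assume "matrix_poly n f" "matrix_poly n f'"
  then obtain F F' where F: "\<forall>t\<in>keys F. keys t \<subseteq> {..<n} \<times> {..<n}" "\<forall>g. f g = eval_at id (\<lambda>ij. g $$ ij) F"
    and F': "\<forall>t\<in>keys F'. keys t \<subseteq> {..<n} \<times> {..<n}" "\<forall>g. f' g = eval_at id (\<lambda>ij. g $$ ij) F'"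
    unfolding matrix_poly_def by blast
  have "\<forall>t\<in>keys (F + F'). keys t \<subseteq> {..<n} \<times> {..<n}" using F(1) F'(1) keys_add[of F F'] by blast
  then show "matrix_poly n (\<lambda>g. f g + f' g)"
    unfolding matrix_poly_def using F(2) F'(2) by (intro exI[of _ "F + F'"]) (simp add: evid.eval_add)
  have "\<forall>t\<in>keys (F * F'). keys t \<subseteq> {..<n} \<times> {..<n}"
  proof
    fix t assume "t \<in> keys (F * F')"
    then obtain a b where "t = a + b" "a \<in> keys F" "b \<in> keys F'" using keys_mult[of F F'] by blast
    then show "keys t \<subseteq> {..<n} \<times> {..<n}" using F(1) F'(1) keys_add[of a b] by blast
  qed
  then show "matrix_poly n (\<lambda>g. f g * f' g)"
    unfolding matrix_poly_def using F(2) F'(2) by (intro exI[of _ "F * F'"]) (simp add: evid.eval_mult)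
qed

lemma matrix_poly_entry: "i < n \<Longrightarrow> j < n \<Longrightarrow> matrix_poly n (\<lambda>g. g $$ (i, j))"
  unfolding matrix_poly_def
  by (rule exI[of _ "single (single (i, j) 1) 1"]) (simp add: evid.eval_single monom_val_single)

lemma matrix_poly_line:
  assumes "matrix_poly n f" "A \<in> carrier_mat n n" "B \<in> carrier_mat n n"
  shows "univariate (\<lambda>x. f (A + x \<cdot>\<^sub>m B))"
proof -
  obtain F where F: "\<forall>t\<in>keys F. keys t \<subseteq> {..<n} \<times> {..<n}" "\<forall>g. f g = eval_at id (\<lambda>ij. g $$ ij) F"
    using assms(1) unfolding matrix_poly_def by blast
  have "univariate (\<lambda>x. (A + x \<cdot>\<^sub>m B) $$ ij)" if "ij \<in> {..<n} \<times> {..<n}" for ij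
  proof -
    have "(A + x \<cdot>\<^sub>m B) $$ ij = A $$ ij + x * B $$ ij" for x
      using that assms(2,3) by (cases ij) auto
    then show ?thesis using uni.P_add[OF uni.P_const uni.P_mult[OF univariate_id uni.P_const]] by simp
  qed
  then show ?thesis
    unfolding F(2)[rule_format] eval_at_def using F(1)
    by (intro uni.P_sum uni.P_mult uni.P_prod uni.P_power) (auto intro: uni.P_const)
qed

text \<open>Join a point good for the earlier functions to one good for \<open>f\<close> by a line.
  On it each function is a nonzero polynomial, as seen at parameter 0 or 1, and finitely many finite
  zero sets do not exhaust an infinite field.\<close>

lemma common_nonzero:
  fixes \<F> :: "('a::field_char_0 mat \<Rightarrow> 'a) set"
  assumes "finite \<F>" "\<And>f. f \<in> \<F> \<Longrightarrow> matrix_poly n f \<and> (\<exists>g\<in>carrier_mat n n. f g \<noteq> 0)"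
  shows "\<exists>g\<in>carrier_mat n n. \<forall>f\<in>\<F>. f g \<noteq> 0"
  using assms
proof (induction \<F> rule: finite_induct)
  case empty
  show ?case by (rule bexI[of _ "0\<^sub>m n n"]) auto
next
  case (insert f \<F>)
  obtain A where A: "A \<in> carrier_mat n n" "\<forall>h\<in>\<F>. h A \<noteq> 0" using insert by auto
  obtain B where B: "B \<in> carrier_mat n n" "f B \<noteq> 0" using insert(4)[of f] by auto
  let ?L = "\<lambda>x. A + x \<cdot>\<^sub>m (B - A)"
  have "?L 0 = A" "?L 1 = B" using A(1) B(1) by (auto intro!: eq_matI)
  then have "\<exists>x. h (?L x) \<noteq> 0" if "h \<in> insert f \<F>" for h using that A(2) B(2) by (metis insertE)
  moreover have "univariate (\<lambda>x. h (?L x))" if "h \<in> insert f \<F>" for h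
    using insert(4)[OF that] A(1) B(1) by (intro matrix_poly_line[where n = n]) auto
  ultimately have "finite {x. h (?L x) = 0}" if "h \<in> insert f \<F>" for h
    using that univariate_finite_zeros by blast
  then have "finite (\<Union>h\<in>insert f \<F>. {x. h (?L x) = 0})" using insert(1) by blast
  then obtain x where "x \<notin> (\<Union>h\<in>insert f \<F>. {x. h (?L x) = 0})"
    using ex_new_if_finite[OF infinite_UNIV_char_0] by blast
  moreover have "?L x \<in> carrier_mat n n" using A(1) B(1) by auto
  ultimately show ?case by blast
qed

lemma GL_iff: "g \<in> GL n \<longleftrightarrow> g \<in> carrier_mat n n \<and> det g \<noteq> (0 :: 'a::field)"
proof
  assume "g \<in> GL n"
  then have g: "g \<in> carrier_mat n n" and "invertible_mat g" by (auto simp: GL_def)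
  then obtain h where h: "g * h = 1\<^sub>m n" "h * g = 1\<^sub>m (dim_row h)"
    unfolding invertible_mat_def inverts_mat_def by auto
  have "dim_col (g * h) = n" "dim_col (h * g) = n" using h(1) g by simp_all
  then have "h \<in> carrier_mat n n" using h by (metis carrier_matI index_mult_mat(3) index_one_mat(3))
  then have "det g * det h = 1" using det_mult[OF g] h(1) by (metis det_one)
  then show "g \<in> carrier_mat n n \<and> det g \<noteq> 0" using g by auto
next
  assume g: "g \<in> carrier_mat n n \<and> det g \<noteq> 0"
  then have "g \<in> Units (ring_mat TYPE('a) n ())" by (intro det_non_zero_imp_unit) auto
  then obtain h where h: "h \<in> carrier_mat n n" "h * g = 1\<^sub>m n" "g * h = 1\<^sub>m n"
    by (auto simp: Units_def ring_mat_def)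
  then show "g \<in> GL n"
    using g unfolding GL_def invertible_mat_def inverts_mat_def
    by (auto intro!: exI[of _ h])
qed

lemma GL_mult: "g \<in> GL n \<Longrightarrow> h \<in> GL n \<Longrightarrow> g * h \<in> GL (n :: nat)" for g :: "'a::field mat"
  by (auto simp: GL_iff det_mult)

lemma one_in_GL: "(1\<^sub>m n :: 'a::field mat) \<in> GL n"
  by (simp add: GL_iff)

text \<open>\<open>matrix_poly\<close> demands its identity for matrices of every shape, so the
  determinant is taken of the rebuilt square matrix.\<close>

lemma matrix_poly_det: "matrix_poly n (\<lambda>g. det (mat n n (\<lambda>(i, j). g $$ (i, j))))"
  by (intro mp.P_det matrix_poly_entry)

subsection \<open>Bordered determinants\<close>

lemma sum_mat_vec:
  assumes "v \<in> carrier_vec r"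
  shows "mat r r (\<lambda>(i, j). \<beta> i j) *\<^sub>v v = vec r (\<lambda>i. \<Sum>k<r. \<beta> i k * v $ k)"
  using assms by (intro eq_vecI) (auto simp: scalar_prod_def atLeast0LessThan intro!: sum.cong)

lemma det_zero_iff:
  "det (mat r r (\<lambda>(i, j). \<beta> i j)) = (0 :: 'a::field)
    \<longleftrightarrow> (\<exists>v. (\<exists>k<r. v k \<noteq> 0) \<and> (\<forall>i<r. (\<Sum>k<r. \<beta> i k * v k) = 0))" (is "_ \<longleftrightarrow> ?R")
proof -
  let ?M = "mat r r (\<lambda>(i, j). \<beta> i j)"
  have "det ?M = 0 \<longleftrightarrow> (\<exists>v. v \<in> carrier_vec r \<and> v \<noteq> 0\<^sub>v r \<and> ?M *\<^sub>v v = 0\<^sub>v r)"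
    by (rule det_0_iff_vec_prod_zero_field) simp
  also have "\<dots> \<longleftrightarrow> ?R"
  proof
    assume "\<exists>v. v \<in> carrier_vec r \<and> v \<noteq> 0\<^sub>v r \<and> ?M *\<^sub>v v = 0\<^sub>v r"
    then obtain v where v: "v \<in> carrier_vec r" "v \<noteq> 0\<^sub>v r" "?M *\<^sub>v v = 0\<^sub>v r" by blast
    have "\<exists>k<r. v $ k \<noteq> 0"
    proof (rule ccontr)
      assume "\<not> (\<exists>k<r. v $ k \<noteq> 0)"
      then have "v = 0\<^sub>v r" using v(1) by (intro eq_vecI) auto
      then show False using v(2) by blast
    qed
    moreover have "(\<Sum>k<r. \<beta> i k * v $ k) = 0" if "i < r" for i
      using arg_cong[OF v(3)[unfolded sum_mat_vec[OF v(1)]], of "\<lambda>w. w $ i"] that by simp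
    ultimately show ?R by blast
  next
    assume ?R
    then obtain v where v: "\<exists>k<r. v k \<noteq> 0" "\<forall>i<r. (\<Sum>k<r. \<beta> i k * v k) = 0" by blast
    have "?M *\<^sub>v vec r v = 0\<^sub>v r" using v(2) by (subst sum_mat_vec) (auto intro!: eq_vecI)
    moreover have "vec r v \<noteq> 0\<^sub>v r" using v(1) by (metis index_vec index_zero_vec(1))
    ultimately show "\<exists>v. v \<in> carrier_vec r \<and> v \<noteq> 0\<^sub>v r \<and> ?M *\<^sub>v v = 0\<^sub>v r"
      by (intro exI[of _ "vec r v"]) auto
  qed
  finally show ?thesis .
qed

lemma det_nonzero_solve:
  assumes "det (mat r r (\<lambda>(i, j). \<beta> i j)) \<noteq> (0 :: 'a::field)"
  obtains x where "\<And>i. i < r \<Longrightarrow> (\<Sum>k<r. \<beta> i k * x k) = y i"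
proof -
  let ?M = "mat r r (\<lambda>(i, j). \<beta> i j)"
  have "?M \<in> Units (ring_mat TYPE('a) r ())" using assms by (intro det_non_zero_imp_unit) auto
  then obtain N where N: "N \<in> carrier_mat r r" "?M * N = 1\<^sub>m r"
    by (auto simp: Units_def ring_mat_def)
  have M: "?M \<in> carrier_mat r r" by simp
  let ?x = "N *\<^sub>v vec r y"
  have x: "?x \<in> carrier_vec r" using N by simp
  have "?M *\<^sub>v ?x = (?M * N) *\<^sub>v vec r y" using assoc_mult_mat_vec[OF M N(1)] by simp
  then have "?M *\<^sub>v ?x = vec r y" by (simp add: N(2))
  then have eq: "vec r (\<lambda>i. \<Sum>k<r. \<beta> i k * ?x $ k) = vec r y" unfolding sum_mat_vec[OF x] .
  have "(\<Sum>k<r. \<beta> i k * ?x $ k) = y i" if "i < r" for i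
    using arg_cong[OF eq, of "\<lambda>w. w $ i"] that by simp
  then show ?thesis by (rule that)
qed

text \<open>The singular bordered matrix has a kernel vector \<open>v\<close>. As the upper left
  block is regular, its first \<open>r\<close> rows make \<open>v\<close> a nonzero multiple of (x,
  -1); the last row then gives the claim.\<close>

lemma bordered_det:
  assumes "det (mat r r (\<lambda>(i, j). \<beta> i j)) \<noteq> (0 :: 'a::field)"
    and "det (mat (Suc r) (Suc r) (\<lambda>(i, j). \<beta> i j)) = 0"
    and x: "\<And>i. i < r \<Longrightarrow> (\<Sum>k<r. \<beta> i k * x k) = \<beta> i r"
  shows "(\<Sum>k<r. \<beta> r k * x k) = \<beta> r r"
proof -
  obtain v where v: "\<exists>k<Suc r. v k \<noteq> 0" "\<forall>i<Suc r. (\<Sum>k<Suc r. \<beta> i k * v k) = 0"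
    using assms(2) unfolding det_zero_iff by blast
  have zero: "(\<Sum>k<r. \<beta> i k * (v k + v r * x k)) = 0" if "i < r" for i
  proof -
    have "(\<Sum>k<r. \<beta> i k * (v k + v r * x k)) = (\<Sum>k<r. \<beta> i k * v k) + v r * (\<Sum>k<r. \<beta> i k * x k)"
      unfolding sum_distrib_left sum.distrib[symmetric] by (intro sum.cong) (auto simp: algebra_simps)
    also have "\<dots> = (\<Sum>k<Suc r. \<beta> i k * v k)" using x[OF that] by simp
    also have "\<dots> = 0" using v(2) that by (meson less_SucI)
    finally show ?thesis .
  qed
  have vk: "v k + v r * x k = 0" if "k < r" for k
  proof (rule ccontr)
    assume "v k + v r * x k \<noteq> 0"
    then have "\<exists>w. (\<exists>k<r. w k \<noteq> 0) \<and> (\<forall>i<r. (\<Sum>k<r. \<beta> i k * w k) = 0)"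
      using that zero by (intro exI[of _ "\<lambda>k. v k + v r * x k"] conjI exI[of _ k]) auto
    then show False using assms(1) unfolding det_zero_iff by (rule notE[rotated])
  qed
  have "v r \<noteq> 0"
  proof
    assume "v r = 0"
    then have "v k = 0" if "k < Suc r" for k using vk that by (cases "k = r") auto
    then show False using v(1) by blast
  qed
  have "0 = (\<Sum>k<r. \<beta> r k * v k) + \<beta> r r * v r"
    using v(2)[rule_format, of r] by simp
  also have "(\<Sum>k<r. \<beta> r k * v k) = (\<Sum>k<r. \<beta> r k * (- (v r * x k)))"
  proof (intro sum.cong refl)
    fix k assume "k \<in> {..<r}"
    then have "v k = - (v r * x k)" using vk by (simp add: eq_neg_iff_add_eq_0)
    then show "\<beta> r k * v k = \<beta> r k * (- (v r * x k))" by (simp only:)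
  qed
  also have "\<dots> = - v r * (\<Sum>k<r. \<beta> r k * x k)"
    unfolding sum_distrib_left by (intro sum.cong) (auto simp: algebra_simps)
  finally have "v r * (\<Sum>k<r. \<beta> r k * x k) = v r * \<beta> r r" by (simp add: algebra_simps)
  then show ?thesis using \<open>v r \<noteq> 0\<close> by simp
qed

subsection \<open>The action of the general linear group\<close>

definition act_var :: "nat \<Rightarrow> 'a::field mat \<Rightarrow> nat \<Rightarrow> 'a mpoly" where
  "act_var n g j = (\<Sum>i\<in>{1..n}. const (g $$ (i - 1, j - 1)) * X i)"

lemma act_alt: "act n g = eval_at const (act_var n g)"
  by (rule ext) (simp only: act_def act_var_def[abs_def])

lemma eval_at_cong:
  assumes "\<And>t i. t \<in> keys p \<Longrightarrow> i \<in> keys t \<Longrightarrow> \<sigma> i = \<tau> i"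
  shows "eval_at const \<sigma> p = eval_at const \<tau> p"
  unfolding eval_at_def using assms by (intro sum.cong prod.cong arg_cong2[of _ _ _ _ "(*)"]) auto

lemma eval_at_comp: "eval_at const \<sigma> (eval_at const \<tau> p) = eval_at const (\<lambda>j. eval_at const \<sigma> (\<tau> j)) p"
  unfolding eval_at_def[of const \<tau>] eval_at_def[of const "\<lambda>j. eval_at const \<sigma> (\<tau> j)"]
  by (simp add: ev.eval_sum ev.eval_mult ev_const ev.eval_prod ev.eval_power)

lemma keys_in_polys: "p \<in> forms n d \<Longrightarrow> t \<in> keys p \<Longrightarrow> i \<in> keys t \<Longrightarrow> i \<in> {1..n}"
  unfolding forms_def polys_def by blast

lemma const_sum: "const (\<Sum>x\<in>A. f x) = (\<Sum>x\<in>A. const (f x))"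
  by (induction A rule: infinite_finite_induct) (auto simp: const_add)

lemma act_mult:
  assumes "A \<in> carrier_mat n n" "B \<in> carrier_mat n n" "p \<in> forms n d"
  shows "act n (A * B) p = act n A (act n B p)"
  unfolding act_alt eval_at_comp
proof (rule eval_at_cong)
  fix t j assume "t \<in> keys p" "j \<in> keys t"
  then have j: "j \<in> {1..n}" using keys_in_polys[OF assms(3)] by blast
  have "act_var n (A * B) j
      = (\<Sum>i\<in>{1..n}. \<Sum>k\<in>{1..n}. const (A $$ (i - 1, k - 1)) * const (B $$ (k - 1, j - 1)) * X i)"
    unfolding act_var_def
  proof (intro sum.cong refl)
    fix i assume i: "i \<in> {1..n}"
    have "(A * B) $$ (i - 1, j - 1) = (\<Sum>k<n. A $$ (i - 1, k) * B $$ (k, j - 1))"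
      using assms(1,2) i j by (auto simp: scalar_prod_def atLeast0LessThan intro!: sum.cong)
    also have "\<dots> = (\<Sum>k\<in>{1..n}. A $$ (i - 1, k - 1) * B $$ (k - 1, j - 1))"
      by (simp add: sum.atLeast1_atMost_eq)
    finally have "const ((A * B) $$ (i - 1, j - 1))
        = (\<Sum>k\<in>{1..n}. const (A $$ (i - 1, k - 1)) * const (B $$ (k - 1, j - 1)))"
      by (simp add: const_sum const_mult)
    then show "const ((A * B) $$ (i - 1, j - 1)) * X i
        = (\<Sum>k\<in>{1..n}. const (A $$ (i - 1, k - 1)) * const (B $$ (k - 1, j - 1)) * X i)"
      by (simp add: sum_distrib_right)
  qed
  also have "\<dots> = (\<Sum>k\<in>{1..n}. \<Sum>i\<in>{1..n}. const (A $$ (i - 1, k - 1)) * const (B $$ (k - 1, j - 1)) * X i)"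
    by (rule sum.swap)
  also have "\<dots> = eval_at const (act_var n A) (act_var n B j)"
    unfolding act_var_def[of n B] ev.eval_sum ev_const_mult ev_X unfolding act_var_def sum_distrib_left
    by (intro sum.cong refl) (simp only: mult_ac)
  finally show "act_var n (A * B) j = eval_at const (act_var n A) (act_var n B j)" .
qed

lemma forms_mult: "p \<in> forms n d \<Longrightarrow> q \<in> forms n e \<Longrightarrow> p * q \<in> forms n (d + e)"
  for p q :: "'a::field mpoly"
  using keys_mult[of p q] by (fastforce simp: forms_eq_monom_space monom_space_def dest: monoms_add)

lemma subspace_forms: "lin.subspace (forms n d)"
  by (simp add: forms_eq_monom_space subspace_monom_space)

lemma one_form: "(1 :: 'a::field mpoly) \<in> forms n 0"
  by (simp add: forms_eq_monom_space monom_space_def monoms_def)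

lemma forms_power: "p \<in> forms n d \<Longrightarrow> p ^ k \<in> forms n (k * d)" for p :: "'a::field mpoly"
  by (induction k) (auto intro: one_form forms_mult)

lemma forms_prod:
  "(\<And>x. x \<in> A \<Longrightarrow> f x \<in> forms n (e x)) \<Longrightarrow> (\<Prod>x\<in>A. f x) \<in> forms n (\<Sum>x\<in>A. e x)" for f :: "'x \<Rightarrow> 'a::field mpoly"
  by (induction A rule: infinite_finite_induct) (auto intro: one_form forms_mult)

lemma act_forms:
  fixes p :: "'a::field mpoly"
  assumes "p \<in> forms n d"
  shows "act n g p \<in> forms n d"
proof -
  have "(X i :: 'a mpoly) \<in> forms n 1" if "i \<in> {1..n}" for i
    using that by (auto simp: X_alt forms_eq_monom_space monoms_def)
  then have "act_var n g j \<in> forms n 1" for j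
    unfolding act_var_def by (intro lin.subspace_sum lin.subspace_scale subspace_forms) auto
  then have "monom_val (act_var n g) t \<in> forms n (\<Sum>j\<in>keys t. lookup t j * 1)" for t
    unfolding monom_val_def by (intro forms_prod forms_power)
  then have "monom_val (act_var n g) t \<in> forms n d" if "t \<in> keys p" for t
    using that assms by (auto simp: forms_def mdeg_def)
  then show ?thesis
    unfolding act_alt eval_eq_sum by (intro lin.subspace_sum lin.subspace_scale subspace_forms)
qed

lemma subspace_act: "lin.subspace V \<Longrightarrow> lin.subspace (act n g ` V)"
  unfolding act_alt by (rule subspace_eval_image)

lemma act_family:
  assumes "p \<in> forms n d"
  shows "poly_family (matrix_poly n) (\<lambda>g. act n g p)"
  unfolding act_alt
proof (rule mp.family_eval)
  fix t j assume "t \<in> keys p" "j \<in> keys t"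
  then have "j \<in> {1..n}" using keys_in_polys[OF assms] by blast
  then show "poly_family (matrix_poly n) (\<lambda>g. act_var n g j)"
    unfolding act_var_def by (intro mp.family_sum poly_family.scale matrix_poly_entry) auto
qed

subsection \<open>Shears and their derivative\<close>

definition shear :: "nat \<Rightarrow> nat \<Rightarrow> 'a::comm_ring_1 \<Rightarrow> 'a mpoly \<Rightarrow> 'a mpoly" where
  "shear i j \<epsilon> = eval_at const (\<lambda>k. if k = j then X j + const \<epsilon> * X i else X k)"

text \<open>Shears come from elementary matrices, so maximality over all of \<open>GL n\<close> also
  applies after a shear.\<close>

lemma act_addrow:
  fixes p :: "'a::field mpoly"
  assumes "p \<in> forms n d" "i \<in> {1..n}" "j \<in> {1..n}" "i \<noteq> j"
  shows "act n (addrow_mat n \<epsilon> (i - 1) (j - 1)) p = shear i j \<epsilon> p"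
  unfolding act_alt shear_def
proof (rule eval_at_cong)
  fix t k assume "t \<in> keys p" "k \<in> keys t"
  then have k: "k \<in> {1..n}" using keys_in_polys[OF assms(1)] by blast
  have "act_var n (addrow_mat n \<epsilon> (i - 1) (j - 1)) k
      = (\<Sum>l\<in>{1..n}. (if l = k then X k else 0) + (if l = i then if k = j then const \<epsilon> * X i else 0 else 0))"
    unfolding act_var_def
  proof (intro sum.cong refl)
    fix l assume l: "l \<in> {1..n}"
    have "(i - 1 = l - 1 \<and> j - 1 = k - 1) = (l = i \<and> k = j)" "(l - 1 = k - 1) = (l = k)"
      using k l assms(2,3) by auto
    moreover have "l - 1 < n" "k - 1 < n" using k l by auto
    ultimately have "addrow_mat n \<epsilon> (i - 1) (j - 1) $$ (l - 1, k - 1)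
        = (if l = i \<and> k = j then \<epsilon> else 0) + (if l = k then 1 else 0)"
      unfolding addrow_mat_def by simp
    then show "const (addrow_mat n \<epsilon> (i - 1) (j - 1) $$ (l - 1, k - 1)) * X l
        = (if l = k then X k else 0) + (if l = i then if k = j then const \<epsilon> * X i else 0 else 0)"
      using assms(4) by (auto simp: const_add)
  qed
  also have "\<dots> = (if k = j then X j + const \<epsilon> * X i else X k)"
    using k assms(2) by (simp add: sum.distrib)
  finally show "act_var n (addrow_mat n \<epsilon> (i - 1) (j - 1)) k = (if k = j then X j + const \<epsilon> * X i else X k)" .
qed

text \<open>Expansion modulo eps^2. The explicit remainder, polynomial in eps, allows one eps to be
  divided out before eps is set to 0.\<close>

definition first_order :: "nat \<Rightarrow> nat \<Rightarrow> 'a::comm_ring_1 mpoly \<Rightarrow> 'a mpoly \<Rightarrow> bool" where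
  "first_order i j q q' \<longleftrightarrow> (\<exists>R. poly_family univariate R \<and>
     (\<forall>\<epsilon>. shear i j \<epsilon> q = q + const \<epsilon> * q' + const \<epsilon> * const \<epsilon> * R \<epsilon>))"

lemma first_order_const: "first_order i j (const c) 0"
  unfolding first_order_def shear_def
  by (intro exI[of _ "\<lambda>_. 0"]) (simp add: ev_const uni.family_const)

lemma first_order_X: "first_order i j (X k) (if k = j then X i else 0)"
  unfolding first_order_def shear_def
  by (intro exI[of _ "\<lambda>_. 0"]) (simp add: ev_X uni.family_const)

lemma first_order_add:
  assumes "first_order i j p p'" "first_order i j q q'"
  shows "first_order i j (p + q) (p' + q')"
proof -
  obtain R S where R: "poly_family univariate R"
    "\<forall>\<epsilon>. shear i j \<epsilon> p = p + const \<epsilon> * p' + const \<epsilon> * const \<epsilon> * R \<epsilon>"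
    and S: "poly_family univariate S"
    "\<forall>\<epsilon>. shear i j \<epsilon> q = q + const \<epsilon> * q' + const \<epsilon> * const \<epsilon> * S \<epsilon>"
    using assms unfolding first_order_def by blast
  have "shear i j \<epsilon> (p + q) = (p + q) + const \<epsilon> * (p' + q') + const \<epsilon> * const \<epsilon> * (R \<epsilon> + S \<epsilon>)" for \<epsilon>
  proof -
    have "shear i j \<epsilon> (p + q) = shear i j \<epsilon> p + shear i j \<epsilon> q" by (simp add: shear_def ev.eval_add)
    then show ?thesis using R(2) S(2) by (simp add: algebra_simps)
  qed
  then show ?thesis
    unfolding first_order_def using poly_family.add[OF R(1) S(1)] by blast
qed

lemma first_order_mult:
  assumes "first_order i j p p'" "first_order i j q q'"
  shows "first_order i j (p * q) (p * q' + p' * q)"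
proof -
  obtain R S where R: "poly_family univariate R"
    "\<forall>\<epsilon>. shear i j \<epsilon> p = p + const \<epsilon> * p' + const \<epsilon> * const \<epsilon> * R \<epsilon>"
    and S: "poly_family univariate S"
    "\<forall>\<epsilon>. shear i j \<epsilon> q = q + const \<epsilon> * q' + const \<epsilon> * const \<epsilon> * S \<epsilon>"
    using assms unfolding first_order_def by blast
  let ?T = "\<lambda>\<epsilon>. (p * S \<epsilon> + q * R \<epsilon> + p' * q') +
    const \<epsilon> * (p' * S \<epsilon> + q' * R \<epsilon> + const \<epsilon> * (R \<epsilon> * S \<epsilon>))"
  have "shear i j \<epsilon> (p * q) = p * q + const \<epsilon> * (p * q' + p' * q) + const \<epsilon> * const \<epsilon> * ?T \<epsilon>" for \<epsilon>
  proof -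
    have "shear i j \<epsilon> (p * q) = shear i j \<epsilon> p * shear i j \<epsilon> q" by (simp add: shear_def ev.eval_mult)
    then show ?thesis using R(2) S(2) by (simp add: algebra_simps)
  qed
  moreover have "poly_family univariate ?T"
    by (intro poly_family.add uni.family_scale uni.family_mult uni.family_mult_fixed uni.family_const
        univariate_id R(1) S(1))
  ultimately show ?thesis unfolding first_order_def by blast
qed

lemma first_order_sum:
  "(\<And>x. x \<in> A \<Longrightarrow> first_order i j (f x) (f' x)) \<Longrightarrow> first_order i j (\<Sum>x\<in>A. f x) (\<Sum>x\<in>A. f' x)"
proof (induction A rule: infinite_finite_induct)
  case (insert x A)
  then show ?case by (simp add: first_order_add)
qed (use first_order_const[of i j 0] in simp_all)

lemma first_order_monomial:
  "first_order i j (monomial t :: 'a::comm_ring_1 mpoly) (single (t - unit_exp j + unit_exp i) (of_nat (lookup t j)))"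
proof (induction "mdeg t" arbitrary: t)
  case 0
  then have "t = 0" by (simp add: mdeg_eq_0_iff)
  then show ?case using first_order_const[of i j "1 :: 'a"] by simp
next
  case (Suc d)
  then have "keys t \<noteq> {}" by auto
  then obtain k where "k \<in> keys t" by blast
  then obtain r where r: "t = r + unit_exp k" by (rule divide_by_variable)
  let ?D = "\<lambda>t. single (t - unit_exp j + unit_exp i) (of_nat (lookup t j)) :: 'a mpoly"
  have "first_order i j (monomial r) (?D r)" using Suc r by (intro Suc(1)) simp
  then have "first_order i j (monomial r * X k) (monomial r * (if k = j then X i else 0) + ?D r * X k)"
    using first_order_X by (rule first_order_mult)
  \<comment> \<open>The product rule on exponents; the cases separate where the subtraction is exact
    from where the coefficient vanishes.\<close>
  moreover have "monomial r * (if k = j then X i else 0) + ?D r * X k = ?D t"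
  proof (cases "j \<in> keys r")
    case True
    then obtain u where u: "r = u + unit_exp j" by (rule divide_by_variable)
    have t: "t - unit_exp j = u + unit_exp k"
    proof -
      have "t = (u + unit_exp k) + unit_exp j" by (simp only: r u ac_simps)
      then show ?thesis by simp
    qed
    have sh: "u + unit_exp i + unit_exp k = u + unit_exp k + unit_exp i" by (simp only: ac_simps)
    show ?thesis
    proof (cases "k = j")
      case True
      have "monomial r * X i = (single (u + unit_exp k + unit_exp i) 1 :: 'a mpoly)"
        by (simp add: X_alt monomial_def mult_single u True)
      moreover have "?D r * X k = single (u + unit_exp k + unit_exp i) (of_nat (lookup r j))"
        by (simp add: X_alt monomial_def mult_single u sh)
      moreover have "lookup t j = Suc (lookup r j)" by (simp add: r True lookup_add)
      ultimately show ?thesis using True by (simp add: t flip: single_add)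
    next
      case False
      have "?D r * X k = single (u + unit_exp k + unit_exp i) (of_nat (lookup r j))"
        by (simp add: X_alt monomial_def mult_single u sh)
      moreover have "lookup t j = lookup r j" using False by (simp add: r lookup_add lookup_single)
      ultimately show ?thesis using False by (simp add: t)
    qed
  next
    case False
    then have r0: "lookup r j = 0" by (simp add: in_keys_iff)
    show ?thesis
    proof (cases "k = j")
      case True
      then show ?thesis using r0 by (simp add: r lookup_add X_alt monomial_def mult_single)
    next
      case False
      then show ?thesis using r0 by (simp add: r lookup_add lookup_single)
    qed
  qed
  ultimately show ?case by (simp add: r monomial_add X_alt)
qed

lemma first_order_shift_deriv: "first_order i j p (shift_deriv i j p)"
proof -
  have "first_order i j (const (lookup p t) * monomial t)
      (single (t - unit_exp j + unit_exp i) (of_nat (lookup t j) * lookup p t))" for t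
    using first_order_mult[OF first_order_const[of i j "lookup p t"] first_order_monomial[of i j t]]
    by (simp add: const_mult_single mult.commute)
  then have "first_order i j (\<Sum>t\<in>keys p. const (lookup p t) * monomial t) (shift_deriv i j p)"
    unfolding shift_deriv_def by (intro first_order_sum)
  then show ?thesis by (simp flip: expand_monomials)
qed

lemma shift_deriv_forms:
  fixes p :: "'a::field mpoly"
  assumes "p \<in> forms n d" "i \<in> {1..n}" "i \<noteq> j"
  shows "shift_deriv i j p \<in> forms n d"
proof -
  have "s \<in> monoms n d" if "s \<in> keys (shift_deriv i j p)" for s
  proof -
    have "i \<in> keys s" using that lookup_shift_deriv_0[of i s j p] by (auto simp: in_keys_iff)
    then obtain r where r: "s = r + unit_exp i" by (rule divide_by_variable)
    then have "r + unit_exp j \<in> keys p"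
      using that lookup_shift_deriv[OF assms(3), of p r] by (auto simp: in_keys_iff)
    then have "r + unit_exp j \<in> monoms n d" using assms(1) by (intro keys_of_form)
    then show ?thesis using assms(2) by (auto simp: r monoms_def keys_add_monom)
  qed
  then show ?thesis by (auto simp: forms_eq_monom_space monom_space_def)
qed

subsection \<open>General coordinates\<close>

definition minor :: "nat \<Rightarrow> nat \<Rightarrow> (nat \<Rightarrow> 'a::field mpoly) \<Rightarrow> (nat \<Rightarrow> monom) \<Rightarrow> 'a mat \<Rightarrow> 'a" where
  "minor n r p s g = det (mat r r (\<lambda>(i, k). lookup (act n g (p k)) (s i)))"

definition minor_data :: "'a::field mpoly set \<Rightarrow> monom set \<Rightarrow> nat \<Rightarrow> (nat \<Rightarrow> 'a mpoly) \<Rightarrow> (nat \<Rightarrow> monom) \<Rightarrow> bool" where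
  "minor_data V S r p s \<longleftrightarrow> (\<forall>k<r. p k \<in> V) \<and> (\<forall>i<r. s i \<in> S)"

text \<open>The group element is quantified here, so the largest such \<open>r\<close> is the rank
  of the projection to \<open>S\<close> in general coordinates.\<close>

definition has_minor :: "nat \<Rightarrow> 'a::field mpoly set \<Rightarrow> monom set \<Rightarrow> nat \<Rightarrow> bool" where
  "has_minor n V S r \<longleftrightarrow> (\<exists>g\<in>GL n. \<exists>p s. minor_data V S r p s \<and> minor n r p s g \<noteq> 0)"

lemma matrix_poly_minor:
  assumes "V \<subseteq> forms n d" "minor_data V S r p s"
  shows "matrix_poly n (minor n r p s)"
proof -
  have "matrix_poly n (\<lambda>g. lookup (act n g (p k)) (s i))" if "k < r" for i k
    using assms that by (intro mp.family_lookup act_family[where d = d]) (auto simp: minor_data_def)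
  then show ?thesis unfolding minor_def by (intro mp.P_det)
qed

lemma has_minor_bound:
  assumes "finite S" "has_minor n V S r"
  shows "r \<le> card S"
proof -
  obtain g p s where ms: "minor_data V S r p s" "minor n r p s g \<noteq> 0"
    using assms(2) unfolding has_minor_def by blast
  have "inj_on s {..<r}"
  proof (rule inj_onI, rule ccontr)
    fix i j assume ij: "i \<in> {..<r}" "j \<in> {..<r}" "s i = s j" "i \<noteq> j"
    let ?M = "mat r r (\<lambda>(i, k). lookup (act n g (p k)) (s i))"
    have "row ?M i = row ?M j" using ij by (intro eq_vecI) auto
    then have "det ?M = 0" using ij by (intro det_identical_rows[of ?M r i j]) auto
    then show False using ms(2) by (simp add: minor_def)
  qed
  moreover have "s ` {..<r} \<subseteq> S" using ms(1) by (auto simp: minor_data_def)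
  ultimately show ?thesis using card_inj_on_le[of s "{..<r}" S] assms(1) by simp
qed

lemma maximal_minor_exists:
  assumes "finite S"
  shows "\<exists>r p s. minor_data V S r p s \<and> (\<exists>g\<in>GL n. minor n r p s g \<noteq> 0)
    \<and> (\<forall>r'. has_minor n V S r' \<longrightarrow> r' \<le> r)"
proof -
  let ?R = "{r. has_minor n V S r}"
  \<comment> \<open>The empty determinant is 1, so size 0 always occurs.\<close>
  have "minor_data V S 0 (\<lambda>_. 0) (\<lambda>_. 0)" "minor n 0 (\<lambda>_. 0) (\<lambda>_. 0) (1\<^sub>m n) \<noteq> 0"
    by (simp_all add: minor_data_def minor_def)
  then have "0 \<in> ?R" using one_in_GL unfolding has_minor_def by blast
  moreover have fin: "finite ?R" using has_minor_bound[OF assms] by (intro finite_subset[of ?R "{..card S}"]) auto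
  ultimately have "Max ?R \<in> ?R" by (intro Max_in) auto
  moreover have "\<forall>r'. has_minor n V S r' \<longrightarrow> r' \<le> Max ?R" using fin by (auto intro: Max_ge)
  ultimately show ?thesis unfolding has_minor_def by blast
qed

lemma shear_family: "poly_family univariate (\<lambda>\<epsilon>. shear i j \<epsilon> p)"
  unfolding shear_def
proof (rule uni.family_eval)
  show "poly_family univariate (\<lambda>\<epsilon>. if k = j then X j + const \<epsilon> * X i else X k)" for k
  proof (cases "k = j")
    case True
    then show ?thesis
      using poly_family.add[OF uni.family_const[of "X j"] 
          poly_family.scale[of univariate "\<lambda>x. x" "X i", OF univariate_id]] by simp
  qed (simp add: uni.family_const)
qed

lemma shear_0: "shear i j 0 p = (p :: 'a::comm_ring_1 mpoly)"
proof -
  have "(\<lambda>k. if k = j then X j + const 0 * X i else X k) = (X :: nat \<Rightarrow> 'a mpoly)" by auto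
  then have "shear i j 0 p = eval_at const X p" by (simp only: shear_def)
  then show ?thesis by (simp add: eval_eq_sum monom_val_X flip: expand_monomials)
qed

text \<open>Border the maximal minor by a vector \<open>q \<in> V\<close> without coefficients in \<open>S\<close> and a further row.
  After the shear \<open>x\<^sub>j \<mapsto> x\<^sub>j + \<epsilon> x\<^sub>i\<close> the bordered determinant still vanishes, and dividing the last
  column by \<open>\<epsilon>\<close> and letting \<open>\<epsilon> = 0\<close> replaces \<open>q\<close> by \<open>x\<^sub>i \<partial>q/\<partial>x\<^sub>j\<close>.\<close>

lemma maximal_minor_shift_deriv:
  fixes V\<^sub>0 :: "'a::field_char_0 mpoly set"
  assumes V: "lin.subspace V\<^sub>0" "V\<^sub>0 \<subseteq> forms n d" and g: "g \<in> GL n"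
    and ms: "minor_data V\<^sub>0 S r p s" "minor n r p s g \<noteq> 0"
    and max: "\<And>r'. has_minor n V\<^sub>0 S r' \<Longrightarrow> r' \<le> r"
    and q: "q \<in> V\<^sub>0" "\<And>t. t \<in> S \<Longrightarrow> lookup (act n g q) t = 0"
    and ij: "i \<in> {1..n}" "j \<in> {1..n}" "i \<noteq> j"
  shows "\<exists>q'\<in>act n g ` V\<^sub>0. \<forall>t\<in>S. lookup q' t = lookup (shift_deriv i j (act n g q)) t"
proof -
  let ?q = "act n g q"
  obtain R where R: "poly_family univariate R"
    "\<forall>\<epsilon>. shear i j \<epsilon> ?q = ?q + const \<epsilon> * shift_deriv i j ?q + const \<epsilon> * const \<epsilon> * R \<epsilon>"
    using first_order_shift_deriv[of i j ?q] unfolding first_order_def by blast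
  \<comment> \<open>Entries of the bordered matrix. Column \<open>r\<close> is the sheared
    \<open>q\<close> divided by eps, a polynomial in eps because \<open>q\<close> has no
    coefficients in \<open>S\<close>.\<close>
  define e where "e = (\<lambda>k \<epsilon> t. if k < r then lookup (shear i j \<epsilon> (act n g (p k))) t
    else lookup (shift_deriv i j ?q) t + \<epsilon> * lookup (R \<epsilon>) t)"
  have gc: "g \<in> carrier_mat n n" using g by (simp add: GL_iff)
  have uni_e: "univariate (\<lambda>\<epsilon>. e k \<epsilon> t)" for k t
    unfolding e_def
    using uni.P_add[OF uni.P_const uni.P_mult[OF univariate_id uni.family_lookup[OF R(1)]]]
    by (cases "k < r") (simp_all add: uni.family_lookup[OF shear_family])
  have e0: "e k 0 t = (if k < r then lookup (act n g (p k)) t else lookup (shift_deriv i j ?q) t)" for k t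
    by (simp add: e_def shear_0)
  have bordered: "det (mat (Suc r) (Suc r) (\<lambda>(a, k). e k 0 ((s(r := t)) a))) = 0" if t: "t \<in> S" for t
  proof -
    let ?s = "s(r := t)"
    let ?f = "\<lambda>\<epsilon>. det (mat (Suc r) (Suc r) (\<lambda>(a, k). e k \<epsilon> (?s a)))"
    have "?f \<epsilon> = 0" if "\<epsilon> \<noteq> 0" for \<epsilon>
    proof (rule ccontr)
      assume nz: "?f \<epsilon> \<noteq> 0"
      \<comment> \<open>For nonzero eps, \<open>?f\<close> is a minor of size r + 1 for the sheared
        group element and the additional vector q / eps, contradicting maximality.\<close>
      let ?g = "addrow_mat n \<epsilon> (i - 1) (j - 1) * g"
      let ?p = "p(r := const (1 / \<epsilon>) * q)"
      have sS: "?s a \<in> S" if "a < Suc r" for a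
        using that t ms(1) by (auto simp: minor_data_def less_Suc_eq)
      have pV: "?p k \<in> V\<^sub>0" if "k < Suc r" for k
        using that ms(1) q(1) lin.subspace_scale[OF V(1)] by (auto simp: minor_data_def less_Suc_eq)
      have "i - 1 \<noteq> j - 1" using ij by auto
      then have "addrow_mat n \<epsilon> (i - 1) (j - 1) \<in> GL n" by (simp add: GL_iff det_addrow_mat)
      then have gGL: "?g \<in> GL n" using g by (rule GL_mult)
      have sh: "act n ?g v = shear i j \<epsilon> (act n g v)" if "v \<in> V\<^sub>0" for v
      proof -
        have v: "v \<in> forms n d" using that V(2) by blast
        have "act n ?g v = act n (addrow_mat n \<epsilon> (i - 1) (j - 1)) (act n g v)"
          by (rule act_mult[OF _ gc v]) simp
        then show ?thesis using act_addrow[OF act_forms[OF v] ij] by simp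
      qed
      have "lookup (act n ?g (?p k)) (?s a) = e k \<epsilon> (?s a)" if ak: "a < Suc r" "k < Suc r" for a k
      proof (cases "k < r")
        case True
        then show ?thesis using sh[OF pV[OF ak(2)]] by (simp add: e_def)
      next
        case False
        then have "k = r" using ak by simp
        have "act n ?g (const (1 / \<epsilon>) * q) = const (1 / \<epsilon>) * act n ?g q"
          by (simp add: act_alt ev_const_mult)
        then have "lookup (act n ?g (?p k)) (?s a) = 1 / \<epsilon> * lookup (shear i j \<epsilon> ?q) (?s a)"
          using sh[OF q(1)] \<open>k = r\<close> by simp
        also have "lookup (shear i j \<epsilon> ?q) (?s a) = \<epsilon> * e k \<epsilon> (?s a)"
          unfolding R(2)[rule_format, of \<epsilon>] lookup_add mult.assoc lookup_const_mult
            q(2)[OF sS[OF ak(1)]] e_def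
          using \<open>k = r\<close> by (simp add: distrib_left)
        also have "1 / \<epsilon> * (\<epsilon> * e k \<epsilon> (?s a)) = e k \<epsilon> (?s a)" using \<open>\<epsilon> \<noteq> 0\<close> by simp
        finally show ?thesis .
      qed
      then have "minor n (Suc r) ?p ?s ?g = ?f \<epsilon>"
        unfolding minor_def by (intro arg_cong[of _ _ det] cong_mat) auto
      then have "has_minor n V\<^sub>0 S (Suc r)"
        unfolding has_minor_def minor_data_def using nz gGL sS pV
        by (intro bexI[of _ ?g] exI[of _ ?p] exI[of _ ?s]) auto
      then show False using max[of "Suc r"] by simp
    qed
    moreover have "univariate ?f" by (intro uni.P_det uni_e)
    ultimately show ?thesis by (intro univariate_zero[of ?f])
  qed
  have "minor n r p s g = det (mat r r (\<lambda>(a, k). lookup (act n g (p k)) (s a)))" by (simp add: minor_def)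
  then obtain x where x: "\<And>a. a < r \<Longrightarrow>
      (\<Sum>k<r. lookup (act n g (p k)) (s a) * x k) = lookup (shift_deriv i j ?q) (s a)"
    using det_nonzero_solve[of r "\<lambda>a k. lookup (act n g (p k)) (s a)"
        "\<lambda>a. lookup (shift_deriv i j ?q) (s a)"] ms(2) by metis
  define q' where "q' = (\<Sum>k<r. const (x k) * act n g (p k))"
  have "q' \<in> act n g ` V\<^sub>0"
    unfolding q'_def using ms(1)
    by (intro lin.subspace_sum lin.subspace_scale subspace_act V) (auto simp: minor_data_def)
  moreover have "lookup q' t = lookup (shift_deriv i j ?q) t" if t: "t \<in> S" for t
  proof -
    let ?\<beta> = "\<lambda>a k. e k 0 ((s(r := t)) a)"
    have "det (mat r r (\<lambda>(a, k). ?\<beta> a k)) = minor n r p s g"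
      unfolding minor_def by (intro arg_cong[of _ _ det] cong_mat) (auto simp: e0)
    then have "det (mat r r (\<lambda>(a, k). ?\<beta> a k)) \<noteq> 0" using ms(2) by simp
    moreover have "det (mat (Suc r) (Suc r) (\<lambda>(a, k). ?\<beta> a k)) = 0" using t by (rule bordered)
    moreover have "(\<Sum>k<r. ?\<beta> a k * x k) = ?\<beta> a r" if "a < r" for a
      using x[OF that] that by (simp add: e0)
    ultimately have "(\<Sum>k<r. ?\<beta> r k * x k) = ?\<beta> r r" by (rule bordered_det)
    then show ?thesis by (simp add: q'_def lookup_sum e0 mult.commute)
  qed
  ultimately show ?thesis by blast
qed

text \<open>One maximal minor is fixed for each monomial \<open>b\<close> of degree
  \<open>d\<close>. There are finitely many, so their product defines a single open
  condition.\<close>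

lemma general_coordinates:
  fixes V\<^sub>0 :: "'a::field_char_0 mpoly set"
  assumes V: "lin.subspace V\<^sub>0" "V\<^sub>0 \<subseteq> forms n d"
  shows "\<exists>U. zariski_open_GL n U \<and> U \<noteq> {} \<and> (\<forall>g\<in>U. infinitesimally_stable n (act n g ` V\<^sub>0))"
proof -
  define S where "S = (\<lambda>b. {t \<in> monoms n d. mless b t})"
  have finS: "finite (S b)" for b by (simp add: S_def finite_monoms)
  have "\<forall>b. \<exists>r p s. minor_data V\<^sub>0 (S b) r p s \<and> (\<exists>g\<in>GL n. minor n r p s g \<noteq> 0)
      \<and> (\<forall>r'. has_minor n V\<^sub>0 (S b) r' \<longrightarrow> r' \<le> r)"
    using maximal_minor_exists[OF finS] by blast
  then obtain r p s where data: "\<And>b. minor_data V\<^sub>0 (S b) (r b) (p b) (s b)"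
    "\<And>b. \<exists>g\<in>GL n. minor n (r b) (p b) (s b) g \<noteq> 0"
    "\<And>b r'. has_minor n V\<^sub>0 (S b) r' \<Longrightarrow> r' \<le> r b"
    by metis
  define f where "f = (\<lambda>b. minor n (r b) (p b) (s b))"
  have fpoly: "matrix_poly n (f b)" for b
    unfolding f_def using V(2) data(1) by (rule matrix_poly_minor)
  let ?det = "\<lambda>g :: 'a mat. det (mat n n (\<lambda>(i, j). g $$ (i, j)))"
  have det: "?det g = det g" if "g \<in> carrier_mat n n" for g
    using that by (intro arg_cong[of _ _ det] eq_matI) auto
  define U where "U = {g \<in> GL n. (\<Prod>b\<in>monoms n d. f b g) \<noteq> 0}"
  have "matrix_poly n (\<lambda>g. \<Prod>b\<in>monoms n d. f b g)" by (intro mp.P_prod fpoly)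
  then obtain F where F: "\<forall>t\<in>keys F. keys t \<subseteq> {..<n} \<times> {..<n}"
    "\<forall>g. (\<Prod>b\<in>monoms n d. f b g) = eval_at id (\<lambda>ij. g $$ ij) F"
    unfolding matrix_poly_def by blast
  have "zariski_open_GL n U"
    unfolding zariski_open_GL_def U_def using F by (intro exI[of _ "{F}"]) auto
  moreover have "U \<noteq> {}"
  proof -
    \<comment> \<open>The determinant joins the family so that the common nonvanishing point is
      invertible.\<close>
    have "matrix_poly n h \<and> (\<exists>g\<in>carrier_mat n n. h g \<noteq> 0)" if "h \<in> insert ?det (f ` monoms n d)" for h
      using that
    proof
      assume h: "h = ?det"
      have "?det (1\<^sub>m n) \<noteq> 0" using det[of "1\<^sub>m n"] by simp
      then show ?thesis unfolding h using matrix_poly_det one_carrier_mat by blast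
    next
      assume "h \<in> f ` monoms n d"
      then obtain b where "h = f b" by blast
      then show ?thesis using fpoly[of b] data(2)[of b] by (auto simp: f_def GL_iff)
    qed
    then obtain g where g: "g \<in> carrier_mat n n" "\<forall>h\<in>insert ?det (f ` monoms n d). h g \<noteq> 0"
      using common_nonzero[of "insert ?det (f ` monoms n d)" n] finite_monoms[of n d] by blast
    then have "g \<in> GL n" using det[OF g(1)] by (simp add: GL_iff)
    then have "g \<in> U" using g(2) by (simp add: U_def finite_monoms)
    then show ?thesis by blast
  qed
  moreover have "infinitesimally_stable n (act n g ` V\<^sub>0)" if "g \<in> U" for g
    unfolding infinitesimally_stable_def
  proof (intro ballI allI impI)
    fix v b i j assume "v \<in> act n g ` V\<^sub>0" and b: "is_largest_monom b v" and ij: "1 \<le> i" "i < j" "j \<le> n"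
    then obtain q where q: "q \<in> V\<^sub>0" "v = act n g q" by blast
    have Vg: "act n g ` V\<^sub>0 \<subseteq> forms n d" using V(2) act_forms by blast
    have v: "v \<in> forms n d" using q V(2) act_forms by blast
    then have "b \<in> monoms n d" using b keys_of_form unfolding is_largest_monom_iff by blast
    then have fb: "f b g \<noteq> 0" and gGL: "g \<in> GL n" using that by (auto simp: U_def finite_monoms)
    have zero: "lookup (act n g q) t = 0" if "t \<in> S b" for t
    proof (rule ccontr)
      assume "lookup (act n g q) t \<noteq> 0"
      then have "t \<in> keys v" using q(2) by (simp add: in_keys_iff)
      then have "mle t b" using b by (simp add: is_largest_monom_iff)
      then have "\<not> mless b t" by (rule ml.leD)
      then show False using that by (simp add: S_def)
    qed
    have ij': "i \<in> {1..n}" "j \<in> {1..n}" "i \<noteq> j" using ij by auto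
    obtain q' where q': "q' \<in> act n g ` V\<^sub>0" "\<forall>t\<in>S b. lookup q' t = lookup (shift_deriv i j v) t"
      using maximal_minor_shift_deriv[OF V gGL data(1) fb[unfolded f_def] data(3) q(1) zero ij']
      unfolding q(2) by blast
    \<comment> \<open>\<open>S b\<close> contains only monomials of degree \<open>d\<close> in the
      given variables; elsewhere both forms have coefficient zero.\<close>
    have "lookup q' t = lookup (shift_deriv i j v) t" if "mless b t" for t
    proof (cases "t \<in> monoms n d")
      case True
      then show ?thesis using q'(2) that by (simp add: S_def)
    next
      case False
      have "t \<notin> keys q'" using False keys_of_form[of q' n d t] q'(1) Vg by blast
      moreover have "t \<notin> keys (shift_deriv i j v)"
        using False keys_of_form[OF shift_deriv_forms[OF v ij'(1,3)], of t] by blast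
      ultimately show ?thesis by (simp add: in_keys_iff)
    qed
    then show "\<exists>q\<in>act n g ` V\<^sub>0. \<forall>t. mless b t \<longrightarrow> lookup q t = lookup (shift_deriv i j v) t"
      using q'(1) by blast
  qed
  ultimately show ?thesis by blast
qed

theorem theorem2p4:
  fixes n d :: nat and V\<^sub>0 :: "'a::field_char_0 mpoly set"
  assumes "1 \<le> n"
    and "lin.subspace V\<^sub>0"
    and "V\<^sub>0 \<subseteq> forms n d"
  shows "\<exists>U. zariski_open_GL n U \<and> U \<noteq> {} \<and>
    (\<forall>g\<in>U. let V = act n g ` V\<^sub>0; I = ideal_gen n V in
      ((space_prod (colon (in_space V) n 1) (lin.span (X ` {1..n})) = in_space V
          \<longleftrightarrow> \<not> has_min_generator (n - 1) (J_ideal n d (in_space V)) d) \<and>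
       (space_prod (colon (in_space V) n 1) (lin.span (X ` {1..n})) = in_space V
          \<longrightarrow> agree_from (n - 1) d
                (in_ideal (n - 1) (restrict_space {n} I))
                (J_ideal n d (in_space V)))) \<and>
      (\<forall>r. 0 \<le> r \<and> r \<le> n - 1 \<longrightarrow>
        (let J = J_ideal (n - r) d (restrict_space {n - r + 1..n} (in_space V)) in
          \<not> has_min_generator (n - r - 1) J d
            \<longrightarrow> agree_from (n - r - 1) d
                  (in_ideal (n - r - 1) (restrict_space {n - r..n} I)) J)))"
proof -
  obtain U where U: "zariski_open_GL n U" "U \<noteq> {}"
    "\<And>g. g \<in> U \<Longrightarrow> infinitesimally_stable n (act n g ` V\<^sub>0)"
    using general_coordinates[OF assms(2,3)] by blast
  have main: "((space_prod (colon (in_space V) n 1) (lin.span (X ` {1..n})) = in_space V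
        \<longleftrightarrow> \<not> has_min_generator (n - 1) (J_ideal n d (in_space V)) d)
    \<and> (space_prod (colon (in_space V) n 1) (lin.span (X ` {1..n})) = in_space V
        \<longrightarrow> agree_from (n - 1) d (in_ideal (n - 1) (restrict_space {n} (ideal_gen n V))) (J_ideal n d (in_space V))))
    \<and> (\<forall>r. 0 \<le> r \<and> r \<le> n - 1 \<longrightarrow>
        \<not> has_min_generator (n - r - 1) (J_ideal (n - r) d (restrict_space {n - r + 1..n} (in_space V))) d
          \<longrightarrow> agree_from (n - r - 1) d (in_ideal (n - r - 1) (restrict_space {n - r..n} (ideal_gen n V)))
                (J_ideal (n - r) d (restrict_space {n - r + 1..n} (in_space V))))"
    if "g \<in> U" and Vdef: "V = act n g ` V\<^sub>0" for g V
  proof -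
    have V: "lin.subspace V" "V \<subseteq> forms n d" "infinitesimally_stable n V"
      unfolding Vdef using subspace_act[OF assms(2)] act_forms assms(3) U(3)[OF that(1)] by blast+
    let ?B = "lead_monoms V" and ?Bm = "\<lambda>m. {b \<in> lead_monoms V. keys b \<subseteq> {1..m}}"
    have st: "strongly_stable ?B" using V(2,3) by (rule strongly_stable_lead_monoms)
    have Bn: "?B \<subseteq> monoms n d" using V(2) by (rule lead_monoms_subset)
    \<comment> \<open>Part (b) is the case m = n - r, and part (a) is m = n.\<close>
    have restricted: "\<not> has_min_generator (m - 1) (J_ideal m d (monom_space (?Bm m)) :: 'a mpoly set) d
          \<longleftrightarrow> generated_below m (?Bm m)"
      "generated_below m (?Bm m) \<Longrightarrow>
        agree_from (m - 1) d (in_ideal (m - 1) (restrict_space {m..n} (ideal_gen n V)))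
          (J_ideal m d (monom_space (?Bm m)))"
      if m: "1 \<le> m" "m \<le> n" for m
    proof -
      have "strongly_stable (?Bm m)"
        unfolding strongly_stable_def
      proof (intro allI impI)
        fix t i j assume "t + unit_exp j \<in> ?Bm m" "1 \<le> i" "i < j"
        then show "t + unit_exp i \<in> ?Bm m"
          using strongly_stableD[OF st, of t j i] by (auto simp: keys_add_monom)
      qed
      moreover have "?Bm m \<subseteq> monoms m d" using Bn by (auto simp: monoms_def)
      ultimately show "\<not> has_min_generator (m - 1) (J_ideal m d (monom_space (?Bm m)) :: 'a mpoly set) d
          \<longleftrightarrow> generated_below m (?Bm m)"
        using m(1) by (intro has_min_generator_J_ideal)
      show "agree_from (m - 1) d (in_ideal (m - 1) (restrict_space {m..n} (ideal_gen n V)))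
          (J_ideal m d (monom_space (?Bm m)))" if "generated_below m (?Bm m)"
        using V m that by (rule initial_restricted_ideal)
    qed
    have full: "?Bm n = ?B" using Bn by (auto simp: monoms_def)
    have a: "space_prod (colon (in_space V) n 1) (lin.span (X ` {1..n})) = in_space V \<longleftrightarrow> generated_below n ?B"
      unfolding in_space_alt using Bn st assms(1) by (rule colon_times_variables)
    have res: "restrict_space {n - r + 1..n} (in_space V) = monom_space (?Bm (n - r))" for r
    proof -
      have "keys t \<inter> {n - r + 1..n} = {} \<longleftrightarrow> keys t \<subseteq> {1..n - r}" if "t \<in> ?B" for t
      proof -
        have "{1..n} - {n - r + 1..n} = {1..n - r}" by auto
        moreover have "keys t \<subseteq> {1..n}" using that Bn by (auto simp: monoms_def)
        ultimately show ?thesis by blast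
      qed
      then have "{t \<in> ?B. keys t \<inter> {n - r + 1..n} = {}} = ?Bm (n - r)" by blast
      then show ?thesis by (simp only: in_space_alt restrict_monom_space)
    qed
    have b: "agree_from (n - r - 1) d (in_ideal (n - r - 1) (restrict_space {n - r..n} (ideal_gen n V)))
        (J_ideal (n - r) d (restrict_space {n - r + 1..n} (in_space V)))"
      if "r \<le> n - 1" "\<not> has_min_generator (n - r - 1)
        (J_ideal (n - r) d (restrict_space {n - r + 1..n} (in_space V))) d" for r
    proof -
      have "1 \<le> n - r" "n - r \<le> n" using that(1) assms(1) by auto
      from restricted[OF this] show ?thesis using that(2) unfolding res by blast
    qed
    have 1: "\<not> has_min_generator (n - 1) (J_ideal n d (in_space V)) d \<longleftrightarrow> generated_below n ?B"
      using restricted(1)[OF assms(1) order.refl] unfolding full in_space_alt .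
    have 2: "agree_from (n - 1) d (in_ideal (n - 1) (restrict_space {n} (ideal_gen n V))) (J_ideal n d (in_space V))"
      if "generated_below n ?B"
      using restricted(2)[OF assms(1) order.refl] that unfolding full in_space_alt atLeastAtMost_singleton .
    show ?thesis unfolding a 1 using 2 b by blast
  qed
  show ?thesis
    unfolding Let_def
    by (intro exI[of _ U] conjI[OF U(1)] conjI[OF U(2)] ballI) (rule main[OF _ refl])
qed

end
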